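(* Let $n\ge 1$ be an integer, let $a,b\in\mathbb R$ with $a\neq 0$, and let $k\in\mathbb N$, $k\ge 3$. There exists a functional $J_k=J_k(u)$ of order $\le k-1$ (in the sense defined in the context; the defining polynomial does not depend on $u$) such that the following holds. Let $T>0$ and let $u$ be a function with $$u\in C^j([0,T);H^{k-j}(\mathbb R^n))\qquad (j=0,1),$$ such that $$q(t):=a\,\|\nabla u(\cdot,t)\|^2+b\neq 0\qquad\text{for all } t\in[0,T).$$ If $u$ is a solution of $$u_{tt}-\frac{\Delta u}{\big(a\|\nabla u\|^2+b\big)^2}=0\quad\text{in }\mathbb R^n\times[0,T),$$ then $$I_k(u)=q\,\|\nabla^{k-1}u_t\|^2+\frac{\|\nabla^k u\|^2}{q}-q'\int_{\mathbb R^n}\nabla^{k-1}u\cdot\nabla^{k-1}u_t\,dx+J_k(u)$$ remains constant in $[0,T)$.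
   Context: Here $u=u(x,t)$ is real-valued, $\|\cdot\|$ is the $L^2(\mathbb R^n)$ norm in the $x$ variable (so $\|\nabla u\|^2=\int_{\mathbb R^n}|\nabla u(x,t)|^2dx$ is a function of $t$), $\nabla$ and $\Delta$ act in $x$, and $'$ and $(h)$ denote derivatives in $t$. The equation is understood in the usual (distributional) sense for functions of the stated regularity. Notation: for $i\in\mathbb N$ (including $0$) and a function $v$, $\nabla^{2i}v:=\Delta^i v$ and $\nabla^{2i+1}v:=\nabla(\Delta^i v)$. Definition (functional of order $\le l$). Let $l\in\mathbb N$, $l\ge 2$. For a sufficiently regular solution $u$ with $q=a\|\nabla u\|^2+b\ne0$ on $[0,T)$, $J=J(u)$ is a functional of order $\le l$ if it can be expressed as $$J(u)=P\Big(q^{-1},\,q,\,q',\dots,q^{(2l-2)},\,\|\nabla u\|^2,\dots,\|\nabla^l u\|^2,\,\|\nabla u_t\|^2,\dots,\|\nabla^{l-1}u_t\|^2,\,\int_{\mathbb R^n}\nabla u\cdot\nabla u_t\,dx,\dots,\int_{\mathbb R^n}\nabla^{l-1}u\cdot\nabla^{l-1}u_t\,dx\Big),$$ where $P$ is a polynomial (with real constant coefficients) of its arguments. Fact making this meaningful: if $u\in C^j([0,T);H^{l-j}(\mathbb R^n))$ ($j=0,1$), $l\ge 2$, solves the equation and $q\neq0$ on $[0,T)$, then $q\in C^{2l-2}([0,T))$. *)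

theory Defs
  imports "HOL-Analysis.Analysis"
begin

section \<open>Test functions\<close>

definition dir_deriv :: "'a::euclidean_space \<Rightarrow> ('a \<Rightarrow> real) \<Rightarrow> 'a \<Rightarrow> real" where
  "dir_deriv e f = (\<lambda>x. frechet_derivative f (at x) e)"

definition partials :: "'a::euclidean_space list \<Rightarrow> ('a \<Rightarrow> real) \<Rightarrow> 'a \<Rightarrow> real" where
  "partials es f = foldr dir_deriv es f"

definition smooth :: "('a::euclidean_space \<Rightarrow> real) \<Rightarrow> bool" where
  "smooth f \<longleftrightarrow> (\<forall>es. set es \<subseteq> Basis \<longrightarrow> partials es f differentiable_on UNIV)"

definition test_functions :: "'a::euclidean_space set \<Rightarrow> ('a \<Rightarrow> real) set" where
  "test_functions \<Omega> =
     {\<phi>. smooth \<phi> \<and> compact (closure {x. \<phi> x \<noteq> 0}) \<and> closure {x. \<phi> x \<noteq> 0} \<subseteq> \<Omega>}"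


section \<open>Square integrable functions, weak derivatives and Sobolev spaces\<close>

text \<open>
  Elements of \<open>L\<^sup>2\<close> and \<open>H\<^sup>m\<close> are represented by Borel measurable functions; every Lebesgue class
  has such a representative, and all notions below are invariant under changes on null sets.
\<close>

definition L2 :: "('a::euclidean_space \<Rightarrow> real) set" where
  "L2 = {f \<in> borel_measurable lborel. integrable lborel (\<lambda>x. (f x)\<^sup>2)}"

definition L2_inner :: "('a::euclidean_space \<Rightarrow> 'b::euclidean_space) \<Rightarrow> ('a \<Rightarrow> 'b) \<Rightarrow> real" where
  "L2_inner f g = (LINT x|lborel. f x \<bullet> g x)"

definition L2_norm :: "('a::euclidean_space \<Rightarrow> 'b::euclidean_space) \<Rightarrow> real" where
  "L2_norm f = sqrt (LINT x|lborel. (norm (f x))\<^sup>2)"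

text \<open>
  Multi-indices are encoded as lists of basis vectors: \<open>[e\<^sub>1, \<dots>, e\<^sub>r]\<close> stands for the
  derivative \<open>\<partial>\<^bsub>e\<^sub>1\<^esub> \<cdots> \<partial>\<^bsub>e\<^sub>r\<^esub>\<close> of order \<open>r\<close>.
\<close>

definition has_weak_deriv ::
    "'a::euclidean_space list \<Rightarrow> ('a \<Rightarrow> real) \<Rightarrow> ('a \<Rightarrow> real) \<Rightarrow> bool" where
  "has_weak_deriv es f g \<longleftrightarrow>
     (\<forall>\<phi>\<in>test_functions UNIV.
        (LINT x|lborel. f x * partials es \<phi> x) = (-1) ^ length es * (LINT x|lborel. g x * \<phi> x))"

text \<open>A square integrable weak derivative is unique up to null sets; one of its versions is chosen.\<close>

definition weak_deriv :: "'a::euclidean_space list \<Rightarrow> ('a \<Rightarrow> real) \<Rightarrow> 'a \<Rightarrow> real" where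
  "weak_deriv es f = (SOME g. g \<in> L2 \<and> has_weak_deriv es f g)"

definition sobolev :: "nat \<Rightarrow> ('a::euclidean_space \<Rightarrow> real) set" where
  "sobolev m = {f \<in> L2. \<forall>es. set es \<subseteq> Basis \<and> length es \<le> m \<longrightarrow> (\<exists>g\<in>L2. has_weak_deriv es f g)}"

text \<open>
  Each multi-index is counted once per ordering, which yields an equivalent Sobolev norm.
\<close>

definition sobolev_norm :: "nat \<Rightarrow> ('a::euclidean_space \<Rightarrow> real) \<Rightarrow> real" where
  "sobolev_norm m f =
     sqrt (\<Sum>es | set es \<subseteq> Basis \<and> length es \<le> m. (L2_norm (weak_deriv es f))\<^sup>2)"


section \<open>The operators \<open>\<nabla>\<^sup>m\<close>\<close>

definition laplacian :: "('a::euclidean_space \<Rightarrow> real) \<Rightarrow> 'a \<Rightarrow> real" where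
  "laplacian f = (\<lambda>x. \<Sum>e\<in>Basis. weak_deriv [e, e] f x)"

definition gradient :: "('a::euclidean_space \<Rightarrow> real) \<Rightarrow> 'a \<Rightarrow> 'a" where
  "gradient f = (\<lambda>x. \<Sum>e\<in>Basis. weak_deriv [e] f x *\<^sub>R e)"

text \<open>
  \<open>\<nabla>\<^sup>m v\<close> is the scalar function \<open>\<Delta>\<^sup>i v\<close> for \<open>m = 2i\<close> and the vector field \<open>\<nabla>(\<Delta>\<^sup>i v)\<close> for
  \<open>m = 2i + 1\<close>. As these have different types, only \<open>\<parallel>\<nabla>\<^sup>m v\<parallel>\<close> and \<open>\<integral> \<nabla>\<^sup>m v \<cdot> \<nabla>\<^sup>m w\<close> are defined.
\<close>

definition nabla_norm :: "nat \<Rightarrow> ('a::euclidean_space \<Rightarrow> real) \<Rightarrow> real" where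
  "nabla_norm m v =
     (if even m then L2_norm ((laplacian ^^ (m div 2)) v)
      else L2_norm (gradient ((laplacian ^^ (m div 2)) v)))"

definition nabla_inner ::
    "nat \<Rightarrow> ('a::euclidean_space \<Rightarrow> real) \<Rightarrow> ('a \<Rightarrow> real) \<Rightarrow> real" where
  "nabla_inner m v w =
     (if even m then L2_inner ((laplacian ^^ (m div 2)) v) ((laplacian ^^ (m div 2)) w)
      else L2_inner (gradient ((laplacian ^^ (m div 2)) v)) (gradient ((laplacian ^^ (m div 2)) w)))"


section \<open>Functions of time with values in Sobolev spaces\<close>

text \<open>
  A function \<open>u(x,t)\<close> is given as \<open>u t x\<close>; only its values for \<open>t \<in> [0,T)\<close> matter. All limits and
  derivatives in \<open>t\<close> are taken within \<open>[0,T)\<close>, hence are one-sided at \<open>t = 0\<close>.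
\<close>

definition diff_quot :: "(real \<Rightarrow> 'a \<Rightarrow> real) \<Rightarrow> real \<Rightarrow> real \<Rightarrow> 'a \<Rightarrow> real" where
  "diff_quot u t s = (\<lambda>x. (u s x - u t x) / (s - t))"

text \<open>\<open>sobolev_C j T m\<close> is \<open>C\<^sup>j([0,T); H\<^sup>m)\<close>.\<close>

fun sobolev_C :: "nat \<Rightarrow> real \<Rightarrow> nat \<Rightarrow> (real \<Rightarrow> 'a::euclidean_space \<Rightarrow> real) set" where
  "sobolev_C 0 T m =
     {u. (\<forall>t\<in>{0..<T}. u t \<in> sobolev m) \<and>
         (\<forall>t\<in>{0..<T}. ((\<lambda>s. sobolev_norm m (\<lambda>x. u s x - u t x)) \<longlongrightarrow> 0) (at t within {0..<T}))}"
| "sobolev_C (Suc j) T m =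
     {u. u \<in> sobolev_C 0 T m \<and>
         (\<exists>v\<in>sobolev_C j T m. \<forall>t\<in>{0..<T}.
            ((\<lambda>s. sobolev_norm m (\<lambda>x. diff_quot u t s x - v t x)) \<longlongrightarrow> 0) (at t within {0..<T}))}"

text \<open>
  \<open>u\<^sub>t\<close> is determined (up to null sets) as the limit of the difference quotients in \<open>L\<^sup>2\<close>;
  if \<open>u \<in> C\<^sup>1([0,T); H\<^sup>m)\<close>, this is the derivative in \<open>H\<^sup>m\<close>.
\<close>

definition time_deriv :: "real \<Rightarrow> (real \<Rightarrow> 'a::euclidean_space \<Rightarrow> real) \<Rightarrow> real \<Rightarrow> 'a \<Rightarrow> real" where
  "time_deriv T u t =
     (SOME g. g \<in> L2 \<and>
        ((\<lambda>s. L2_norm (\<lambda>x. diff_quot u t s x - g x)) \<longlongrightarrow> 0) (at t within {0..<T}))"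

definition scalar_deriv :: "real \<Rightarrow> nat \<Rightarrow> (real \<Rightarrow> real) \<Rightarrow> real \<Rightarrow> real" where
  "scalar_deriv T h = (\<lambda>f t. vector_derivative f (at t within {0..<T})) ^^ h"


section \<open>The equation\<close>

definition q_fun :: "real \<Rightarrow> real \<Rightarrow> (real \<Rightarrow> 'a::euclidean_space \<Rightarrow> real) \<Rightarrow> real \<Rightarrow> real" where
  "q_fun a b u t = a * (nabla_norm 1 (u t))\<^sup>2 + b"

text \<open>
  Distributional form of \<open>u\<^sub>t\<^sub>t - \<Delta>u / (a\<parallel>\<nabla>u\<parallel>\<^sup>2 + b)\<^sup>2 = 0\<close>. The pairing is an iterated integral,
  so that no joint measurability of the chosen representatives \<open>u t\<close> is required.
\<close>

definition is_solution :: "real \<Rightarrow> real \<Rightarrow> real \<Rightarrow> (real \<Rightarrow> 'a::euclidean_space \<Rightarrow> real) \<Rightarrow> bool" where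
  "is_solution a b T u \<longleftrightarrow>
     (\<forall>\<phi>\<in>test_functions ((UNIV :: 'a set) \<times> {0<..<T}).
        (LINT t:{0<..<T}|lborel.
           (LINT x|lborel. u t x * partials [(0, 1), (0, 1)] \<phi> (x, t)) -
           (LINT x|lborel. u t x * (\<Sum>e\<in>Basis. partials [(e, 0), (e, 0)] \<phi> (x, t)))
             / (q_fun a b u t)\<^sup>2) = 0)"

definition regular_solution ::
    "real \<Rightarrow> real \<Rightarrow> nat \<Rightarrow> real \<Rightarrow> (real \<Rightarrow> 'a::euclidean_space \<Rightarrow> real) \<Rightarrow> bool" where
  "regular_solution a b l T u \<longleftrightarrow>
     (\<forall>j\<in>{0, 1}. u \<in> sobolev_C j T (l - j)) \<and>
     (\<forall>t\<in>{0..<T}. q_fun a b u t \<noteq> 0) \<and>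
     is_solution a b T u"


section \<open>Functionals of bounded order\<close>

text \<open>Polynomials with real coefficients in the variables \<open>V\<close>, as functions of an assignment.\<close>

inductive_set polynomials :: "'v set \<Rightarrow> (('v \<Rightarrow> real) \<Rightarrow> real) set" for V :: "'v set" where
  var: "i \<in> V \<Longrightarrow> (\<lambda>X. X i) \<in> polynomials V"
| const: "(\<lambda>X. c) \<in> polynomials V"
| add: "f \<in> polynomials V \<Longrightarrow> g \<in> polynomials V \<Longrightarrow> (\<lambda>X. f X + g X) \<in> polynomials V"
| mult: "f \<in> polynomials V \<Longrightarrow> g \<in> polynomials V \<Longrightarrow> (\<lambda>X. f X * g X) \<in> polynomials V"

datatype arg = Q_inv | Q_deriv nat | Nabla_u nat | Nabla_ut nat | Nabla_mixed nat

definition args :: "nat \<Rightarrow> arg set" where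
  "args l = {Q_inv} \<union> Q_deriv ` {0..2 * l - 2} \<union> Nabla_u ` {1..l}
              \<union> Nabla_ut ` {1..l - 1} \<union> Nabla_mixed ` {1..l - 1}"

fun arg_value ::
    "real \<Rightarrow> real \<Rightarrow> real \<Rightarrow> (real \<Rightarrow> 'a::euclidean_space \<Rightarrow> real) \<Rightarrow> real \<Rightarrow> arg \<Rightarrow> real" where
  "arg_value a b T u t Q_inv = inverse (q_fun a b u t)"
| "arg_value a b T u t (Q_deriv h) = scalar_deriv T h (q_fun a b u) t"
| "arg_value a b T u t (Nabla_u i) = (nabla_norm i (u t))\<^sup>2"
| "arg_value a b T u t (Nabla_ut i) = (nabla_norm i (time_deriv T u t))\<^sup>2"
| "arg_value a b T u t (Nabla_mixed i) = nabla_inner i (u t) (time_deriv T u t)"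

text \<open>
  \<open>J T u t\<close> is the value at time \<open>t\<close> of the functional on a solution \<open>u\<close> over \<open>[0,T)\<close>. One
  polynomial has to serve all \<open>T\<close> and \<open>u\<close>.
\<close>

definition functional_of_order_le ::
    "real \<Rightarrow> real \<Rightarrow> nat \<Rightarrow> (real \<Rightarrow> (real \<Rightarrow> 'a::euclidean_space \<Rightarrow> real) \<Rightarrow> real \<Rightarrow> real) \<Rightarrow> bool" where
  "functional_of_order_le a b l J \<longleftrightarrow> 2 \<le> l \<and>
     (\<exists>P\<in>polynomials (args l). \<forall>T u. 0 < T \<longrightarrow> regular_solution a b l T u \<longrightarrow>
        (\<forall>t\<in>{0..<T}. J T u t = P (arg_value a b T u t)))"

end

(*
  Let A_j = |nabla^j u|^2 and z_j = A_j / q. Differentiating the leading part of I_k along the equation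
  leaves the single term - q'' (nabla^(k-1) u, nabla^(k-1) u_t) = - q'' A_(k-1)' / 2, so J_k has to be
  a primitive of q'' A_(k-1)' / 2. The moments obey the recursion A_j''' = - (4 / q) z_(j+1)', in
  which the third derivative is skew; hence z_i' z_j and z_(i+1)' z_(j-1) agree up to an exact
  derivative of lower order. Since q A_1''' = a multiple of z_2', integrating q'' A_(k-1)' by parts gives
  z_2' z_(k-1), and moving indices towards the middle ends with z_i' z_i or A_i A_i''', both exact.

  The top order terms are only continuous in time. There one space derivative is replaced by a
  difference quotient, for which the identity holds classically up to an error that is locally bounded
  and tends to 0 pointwise; dominated convergence gives the identity in the limit.

  All of this takes place in the Hilbert space of square integrable functions modulo null sets. Density of
  test functions turns weak differentiability of a curve with continuous weak derivative into strong
  differentiability; applied to translations this yields integration by parts and the symmetry of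
  second derivatives, and applied in time (after the lemma of du Bois-Reymond) it turns the
  distributional equation into an evolution equation.
*)

theory Submission
  imports Defs
begin

section \<open>The Hilbert space of square integrable functions\<close>

text \<open>Write A_j, B_j, C_j for the moments of order j of (u,u), (u,u_t), (u_t,u_t). Formally
  the equation says A_j' = 2 B_j, B_j' = C_j - A_(j+1) / q^2, C_j' = - 2 B_(j+1) / q^2. This
  explains the coefficients of I_k: with weights q and 1/q the two B_k terms cancel, and what the
  product rule adds is q' (C_(k-1) - A_k / q^2) = q' B_(k-1)', which the third term removes at the
  price of - q'' B_(k-1). The exponent 2 in the equation makes the multiplier q of the kinetic
  energy affine in A_1, so that q''' = a A_1''' falls under the same recursion as every A_j'''. This
  brings the remainder q'' B_(k-1) within reach of that recursion. The obstacle is B_k: it pairs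
  derivatives of order k of u and of u_t, and the latter do not exist for u_t in H^(k-1). The
  cancellation of the two B_k terms is therefore carried out on difference quotients. The proof is
  indexed by m = k - 2, the order for which u_tt takes values in H^m.\<close>

lemma L2_measurable: "f \<in> L2 \<Longrightarrow> f \<in> borel_measurable borel"
  by (simp add: L2_def)

lemma L2_square_integrable: "f \<in> L2 \<Longrightarrow> integrable lborel (\<lambda>x. (f x)\<^sup>2)"
  by (simp add: L2_def)

lemma L2_mult_integrable:
  assumes "f \<in> L2" "g \<in> L2"
  shows "integrable lborel (\<lambda>x. f x * g x)"
proof (rule Bochner_Integration.integrable_bound)
  show "integrable lborel (\<lambda>x. (f x)\<^sup>2 + (g x)\<^sup>2)"
    using assms by (simp add: L2_square_integrable)
  show "(\<lambda>x. f x * g x) \<in> borel_measurable lborel"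
    using assms[THEN L2_measurable] by measurable
  show "AE x in lborel. norm (f x * g x) \<le> norm ((f x)\<^sup>2 + (g x)\<^sup>2)"
  proof (rule AE_I2)
    fix x
    have "0 \<le> (\<bar>f x\<bar> - \<bar>g x\<bar>)\<^sup>2" by simp
    then have "2 * (\<bar>f x\<bar> * \<bar>g x\<bar>) \<le> (f x)\<^sup>2 + (g x)\<^sup>2"
      by (simp add: power2_diff)
    moreover have "0 \<le> \<bar>f x\<bar> * \<bar>g x\<bar>" by simp
    ultimately show "norm (f x * g x) \<le> norm ((f x)\<^sup>2 + (g x)\<^sup>2)"
      unfolding abs_mult real_norm_def by (smt (verit))
  qed
qed

lemma L2_add: "f \<in> L2 \<Longrightarrow> g \<in> L2 \<Longrightarrow> (\<lambda>x. f x + g x) \<in> L2"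
  using L2_mult_integrable[of f g] by (auto simp: L2_def power2_sum mult.assoc)

lemma L2_cmult: "f \<in> L2 \<Longrightarrow> (\<lambda>x. c * f x) \<in> L2"
  by (auto simp: L2_def power_mult_distrib)

lemma L2_zero: "(\<lambda>x. 0) \<in> L2"
  by (simp add: L2_def)

lemma L2_uminus: "f \<in> L2 \<Longrightarrow> (\<lambda>x. - f x) \<in> L2"
  using L2_cmult[of f "-1"] by simp

lemma L2_diff: "f \<in> L2 \<Longrightarrow> g \<in> L2 \<Longrightarrow> (\<lambda>x. f x - g x) \<in> L2"
  using L2_add[of f "\<lambda>x. - g x"] L2_uminus[of g] by simp

lemma L2_sum: "(\<And>i. i \<in> I \<Longrightarrow> f i \<in> L2) \<Longrightarrow> (\<lambda>x. \<Sum>i\<in>I. f i x) \<in> L2"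
  by (induction I rule: infinite_finite_induct) (auto intro: L2_add L2_zero)

text \<open>Membership in \<open>L2\<close> is built into the relation, which is therefore only a
  partial equivalence: only square integrable functions have a class, and \<open>abs_lsq f\<close>
  is informative for \<open>f \<in> L2\<close> alone.\<close>

definition L2_eq :: "('a::euclidean_space \<Rightarrow> real) \<Rightarrow> ('a \<Rightarrow> real) \<Rightarrow> bool" where
  "L2_eq f g \<longleftrightarrow> f \<in> L2 \<and> g \<in> L2 \<and> (AE x in lborel. f x = g x)"

quotient_type (overloaded) 'a lsq = "'a::euclidean_space \<Rightarrow> real" / partial: L2_eq
proof (rule part_equivpI)
  show "\<exists>f::'a \<Rightarrow> real. L2_eq f f"
    using L2_zero by (auto simp: L2_eq_def)
  show "symp (L2_eq :: ('a \<Rightarrow> real) \<Rightarrow> _)"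
    by (auto intro!: sympI simp: L2_eq_def)
  show "transp (L2_eq :: ('a \<Rightarrow> real) \<Rightarrow> _)"
    by (auto intro!: transpI simp: L2_eq_def)
qed

lemma lsq_cases [case_names abs]:
  obtains f where "f \<in> L2" "F = abs_lsq f"
proof -
  have "L2_eq (rep_lsq F) (rep_lsq F)"
    using Quotient_rep_reflp[OF Quotient_lsq] .
  then show ?thesis
    using that[of "rep_lsq F"] Quotient_abs_rep[OF Quotient_lsq, of F] by (auto simp: L2_eq_def)
qed

instantiation lsq :: (euclidean_space) real_inner
begin

lift_definition zero_lsq :: "'a lsq" is "\<lambda>x. 0"
  by (simp add: L2_eq_def L2_zero)

lift_definition plus_lsq :: "'a lsq \<Rightarrow> 'a lsq \<Rightarrow> 'a lsq" is "\<lambda>f g x. f x + g x"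
  by (auto simp: L2_eq_def L2_add)

lift_definition uminus_lsq :: "'a lsq \<Rightarrow> 'a lsq" is "\<lambda>f x. - f x"
  by (auto simp: L2_eq_def L2_uminus)

lift_definition minus_lsq :: "'a lsq \<Rightarrow> 'a lsq \<Rightarrow> 'a lsq" is "\<lambda>f g x. f x - g x"
  by (auto simp: L2_eq_def L2_diff)

lift_definition scaleR_lsq :: "real \<Rightarrow> 'a lsq \<Rightarrow> 'a lsq" is "\<lambda>c f x. c * f x"
  by (auto simp: L2_eq_def L2_cmult)

lift_definition inner_lsq :: "'a lsq \<Rightarrow> 'a lsq \<Rightarrow> real" is "\<lambda>f g. LINT x|lborel. f x * g x"
  by (rule integral_cong_AE) (auto simp: L2_eq_def intro!: borel_measurable_times dest: L2_measurable)

definition norm_lsq :: "'a lsq \<Rightarrow> real" where "norm_lsq F = sqrt (inner F F)"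
definition dist_lsq :: "'a lsq \<Rightarrow> 'a lsq \<Rightarrow> real" where "dist_lsq F G = norm (F - G)"
definition sgn_lsq :: "'a lsq \<Rightarrow> 'a lsq" where "sgn_lsq F = inverse (norm F) *\<^sub>R F"
definition uniformity_lsq :: "('a lsq \<times> 'a lsq) filter" where
  "uniformity_lsq = (INF e\<in>{0<..}. principal {(x, y). dist x y < e})"
definition open_lsq :: "'a lsq set \<Rightarrow> bool" where
  "open_lsq U \<longleftrightarrow> (\<forall>x\<in>U. \<forall>\<^sub>F (x', y) in uniformity. x' = x \<longrightarrow> y \<in> U)"

instance
proof
  fix F G H :: "'a lsq" and r s :: real
  show "dist F G = norm (F - G)" by (rule dist_lsq_def)
  show "sgn F = inverse (norm F) *\<^sub>R F" by (rule sgn_lsq_def)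
  show "norm F = sqrt (inner F F)" by (rule norm_lsq_def)
  show "uniformity = (INF e\<in>{0<..}. principal {(x::'a lsq, y). dist x y < e})"
    by (rule uniformity_lsq_def)
  show "open U \<longleftrightarrow> (\<forall>x\<in>U. \<forall>\<^sub>F (x', y) in uniformity. x' = x \<longrightarrow> y \<in> U)" for U :: "'a lsq set"
    by (rule open_lsq_def)
  show "F + G + H = F + (G + H)"
    by transfer (auto simp: L2_eq_def add.assoc intro: L2_add)
  show "F + G = G + F"
    by transfer (auto simp: L2_eq_def add.commute intro: L2_add)
  show "0 + F = F"
    by transfer (auto simp: L2_eq_def)
  show "- F + F = 0"
    by transfer (auto simp: L2_eq_def L2_zero)
  show "F - G = F + - G"
    by transfer (auto simp: L2_eq_def intro: L2_diff)
  show "r *\<^sub>R (F + G) = r *\<^sub>R F + r *\<^sub>R G"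
    by transfer (auto simp: L2_eq_def distrib_left intro: L2_add L2_cmult)
  show "(r + s) *\<^sub>R F = r *\<^sub>R F + s *\<^sub>R F"
    by transfer (auto simp: L2_eq_def distrib_right intro: L2_add L2_cmult)
  show "r *\<^sub>R s *\<^sub>R F = (r * s) *\<^sub>R F"
    by transfer (auto simp: L2_eq_def mult.assoc intro: L2_cmult)
  show "1 *\<^sub>R F = F"
    by transfer (auto simp: L2_eq_def)
  show "inner F G = inner G F"
    by transfer (simp add: mult.commute)
  show "inner (F + G) H = inner F H + inner G H"
    by transfer (auto simp: L2_eq_def distrib_right intro!: Bochner_Integration.integral_add L2_mult_integrable)
  show "inner (r *\<^sub>R F) G = r * inner F G"
    by transfer (auto simp: mult.assoc)
  show "0 \<le> inner F F"
    by transfer auto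
  show "inner F F = 0 \<longleftrightarrow> F = 0"
    by transfer (auto simp: L2_eq_def L2_zero power2_eq_square[symmetric] integral_nonneg_eq_0_iff_AE
        L2_square_integrable)
qed

end

section \<open>Computing with classes; dominated convergence in the mean square\<close>

lemma abs_lsq_add: "f \<in> L2 \<Longrightarrow> g \<in> L2 \<Longrightarrow> abs_lsq f + abs_lsq g = abs_lsq (\<lambda>x. f x + g x)"
  by (auto intro!: plus_lsq.abs_eq simp: L2_eq_def)

lemma abs_lsq_diff: "f \<in> L2 \<Longrightarrow> g \<in> L2 \<Longrightarrow> abs_lsq f - abs_lsq g = abs_lsq (\<lambda>x. f x - g x)"
  by (auto intro!: minus_lsq.abs_eq simp: L2_eq_def)

lemma abs_lsq_scaleR: "f \<in> L2 \<Longrightarrow> c *\<^sub>R abs_lsq f = abs_lsq (\<lambda>x. c * f x)"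
  by (auto intro!: scaleR_lsq.abs_eq simp: L2_eq_def)

lemma abs_lsq_zero: "abs_lsq (\<lambda>x. 0) = 0"
  by (simp add: zero_lsq.abs_eq)

lemma inner_abs_lsq: "f \<in> L2 \<Longrightarrow> g \<in> L2 \<Longrightarrow> inner (abs_lsq f) (abs_lsq g) = (LINT x|lborel. f x * g x)"
  by (auto intro!: inner_lsq.abs_eq simp: L2_eq_def)

lemma abs_lsq_sum:
  "(\<And>i. i \<in> I \<Longrightarrow> f i \<in> L2) \<Longrightarrow> (\<Sum>i\<in>I. abs_lsq (f i)) = abs_lsq (\<lambda>x. \<Sum>i\<in>I. f i x)"
  by (induction I rule: infinite_finite_induct) (auto simp: abs_lsq_zero abs_lsq_add L2_sum)

lemma norm_abs_lsq: "f \<in> L2 \<Longrightarrow> norm (abs_lsq f) = L2_norm f"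
  by (simp add: norm_eq_sqrt_inner inner_abs_lsq L2_norm_def power2_eq_square[symmetric])

lemma norm_abs_lsq_square: "f \<in> L2 \<Longrightarrow> (norm (abs_lsq f))\<^sup>2 = (LINT x|lborel. (f x)\<^sup>2)"
  by (simp add: power2_norm_eq_inner inner_abs_lsq power2_eq_square[symmetric])

text \<open>Dominated convergence for the squared error. The majorant bounds the error
  \<open>f n - g\<close> and has to lie in \<open>L2\<close>, so that its square is
  integrable.\<close>

lemma abs_lsq_tendsto_dominated:
  fixes g :: "'a::euclidean_space \<Rightarrow> real"
  assumes "\<And>n. f n \<in> L2" "g \<in> L2" "w \<in> L2"
    and "AE x in lborel. (\<lambda>n. f n x) \<longlonglongrightarrow> g x"
    and "\<And>n. AE x in lborel. \<bar>f n x - g x\<bar> \<le> w x"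
  shows "(\<lambda>n. abs_lsq (f n)) \<longlonglongrightarrow> abs_lsq g"
proof -
  have meas[measurable]: "f n \<in> borel_measurable borel" "g \<in> borel_measurable borel" for n
    using assms(1,2) by (auto dest: L2_measurable)
  have "(\<lambda>n. LINT x|lborel. (f n x - g x)\<^sup>2) \<longlonglongrightarrow> (LINT x::'a|lborel. (0::real))"
  proof (rule integral_dominated_convergence)
    show "integrable lborel (\<lambda>x. (w x)\<^sup>2)" by (rule L2_square_integrable[OF assms(3)])
    show "AE x in lborel. (\<lambda>n. (f n x - g x)\<^sup>2) \<longlonglongrightarrow> 0"
      using assms(4)
    proof eventually_elim
      case (elim x)
      then have "(\<lambda>n. (f n x - g x)\<^sup>2) \<longlonglongrightarrow> (g x - g x)\<^sup>2"
        by (intro tendsto_intros)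
      then show ?case by simp
    qed
    show "AE x in lborel. norm ((f n x - g x)\<^sup>2) \<le> (w x)\<^sup>2" for n
      using assms(5)[of n]
    proof eventually_elim
      case (elim x)
      then show ?case using power_mono[OF elim, of 2] by simp
    qed
  qed measurable
  moreover have "(norm (abs_lsq (f n) - abs_lsq g))\<^sup>2 = (LINT x|lborel. (f n x - g x)\<^sup>2)" for n
    by (simp add: abs_lsq_diff assms norm_abs_lsq_square L2_diff)
  ultimately have "(\<lambda>n. (norm (abs_lsq (f n) - abs_lsq g))\<^sup>2) \<longlonglongrightarrow> 0"
    by simp
  then have "(\<lambda>n. sqrt ((norm (abs_lsq (f n) - abs_lsq g))\<^sup>2)) \<longlonglongrightarrow> sqrt 0"
    by (intro tendsto_intros)
  then show ?thesis
    by (subst LIM_zero_iff[symmetric]) (simp add: tendsto_norm_zero_iff)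
qed

section \<open>Smooth functions and test functions\<close>

lemma dir_deriv_eq: "(f has_derivative f') (at x) \<Longrightarrow> dir_deriv e f x = f' e"
  unfolding dir_deriv_def by (metis frechet_derivative_at)

lemma partials_Nil [simp]: "partials [] f = f"
  and partials_Cons: "partials (e # es) f = dir_deriv e (partials es f)"
  and partials_append: "partials (es @ fs) f = partials es (partials fs f)"
  by (simp_all add: partials_def)

section \<open>A criterion for smoothness and its closure properties\<close>

inductive_set function_algebra :: "('a \<Rightarrow> real) set \<Rightarrow> ('a \<Rightarrow> real) set" for S where
  base: "f \<in> S \<Longrightarrow> f \<in> function_algebra S"
| const: "(\<lambda>x. c) \<in> function_algebra S"
| add: "f \<in> function_algebra S \<Longrightarrow> g \<in> function_algebra S \<Longrightarrow> (\<lambda>x. f x + g x) \<in> function_algebra S"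
| mult: "f \<in> function_algebra S \<Longrightarrow> g \<in> function_algebra S \<Longrightarrow> (\<lambda>x. f x * g x) \<in> function_algebra S"

text \<open>
  Smoothness is a greatest fixed point: it suffices to find a set of differentiable functions whose
  first derivatives stay within the algebra generated by that set.
\<close>

lemma smooth_function_algebra:
  fixes S :: "('a::euclidean_space \<Rightarrow> real) set"
  assumes diff: "\<And>f x. f \<in> S \<Longrightarrow> f differentiable (at x)"
    and deriv: "\<And>f e. f \<in> S \<Longrightarrow> e \<in> Basis \<Longrightarrow> dir_deriv e f \<in> function_algebra S"
    and f: "f \<in> function_algebra S"
  shows "smooth f"
proof -
  have D: "g differentiable (at x)" if "g \<in> function_algebra S" for g x
    using that by induction (auto intro: diff differentiable_add differentiable_mult)
  have dd: "dir_deriv e g \<in> function_algebra S" if "g \<in> function_algebra S" "e \<in> Basis" for g e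
    using that
  proof induction
    case (const c)
    then show ?case by (simp add: dir_deriv_def function_algebra.const)
  next
    case (add f g)
    have "dir_deriv e (\<lambda>x. f x + g x) = (\<lambda>x. dir_deriv e f x + dir_deriv e g x)"
    proof
      fix x
      obtain f' g' where "(f has_derivative f') (at x)" "(g has_derivative g') (at x)"
        using D[OF add.hyps(1), of x] D[OF add.hyps(2), of x] by (auto simp: differentiable_def)
      then show "dir_deriv e (\<lambda>x. f x + g x) x = dir_deriv e f x + dir_deriv e g x"
        by (simp add: dir_deriv_eq dir_deriv_eq[OF has_derivative_add])
    qed
    then show ?case using add by (auto intro: function_algebra.add)
  next
    case (mult f g)
    have "dir_deriv e (\<lambda>x. f x * g x) = (\<lambda>x. f x * dir_deriv e g x + dir_deriv e f x * g x)"
    proof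
      fix x
      obtain f' g' where "(f has_derivative f') (at x)" "(g has_derivative g') (at x)"
        using D[OF mult.hyps(1), of x] D[OF mult.hyps(2), of x] by (auto simp: differentiable_def)
      then show "dir_deriv e (\<lambda>x. f x * g x) x = f x * dir_deriv e g x + dir_deriv e f x * g x"
        by (simp add: dir_deriv_eq dir_deriv_eq[OF has_derivative_mult])
    qed
    then show ?case using mult by (auto intro: function_algebra.add function_algebra.mult)
  qed (use deriv in auto)
  have "partials es f \<in> function_algebra S" if "set es \<subseteq> Basis" for es
    using that by (induction es) (auto simp: partials_Cons intro: dd f)
  then show ?thesis
    unfolding smooth_def differentiable_on_def
    by (auto intro: D)
qed

lemma smooth_differentiable: "smooth f \<Longrightarrow> f differentiable (at x)"
  unfolding smooth_def differentiable_on_def by (drule spec[of _ "[]"]) auto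

lemma smooth_partials: "smooth f \<Longrightarrow> set es \<subseteq> Basis \<Longrightarrow> smooth (partials es f)"
  unfolding smooth_def by (auto simp: partials_append[symmetric])

lemma smooth_dir_deriv: "smooth f \<Longrightarrow> e \<in> Basis \<Longrightarrow> smooth (dir_deriv e f)"
  using smooth_partials[of f "[e]"] by (simp add: partials_Cons)

lemma smooth_continuous_on: "smooth f \<Longrightarrow> continuous_on A f"
  by (meson differentiable_imp_continuous_within smooth_differentiable continuous_at_imp_continuous_on)

text \<open>Taking all smooth functions as generators makes the criterion yield closure under sums
  and products at once.\<close>

lemma smooth_algebra: "f \<in> function_algebra {f. smooth f} \<Longrightarrow> smooth f"
  by (rule smooth_function_algebra) (auto intro: smooth_differentiable function_algebra.base smooth_dir_deriv)

lemma smooth_const: "smooth (\<lambda>x. c)"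
  by (rule smooth_algebra) (rule function_algebra.const)

lemma smooth_add: "smooth f \<Longrightarrow> smooth g \<Longrightarrow> smooth (\<lambda>x. f x + g x)"
  by (rule smooth_algebra) (auto intro: function_algebra.intros)

lemma smooth_mult: "smooth f \<Longrightarrow> smooth g \<Longrightarrow> smooth (\<lambda>x. f x * g x)"
  by (rule smooth_algebra) (auto intro: function_algebra.intros)

lemma smooth_prod: "(\<And>i. i \<in> I \<Longrightarrow> smooth (f i)) \<Longrightarrow> smooth (\<lambda>x. \<Prod>i\<in>I. f i x)"
  by (induction I rule: infinite_finite_induct) (auto intro: smooth_const smooth_mult)

lemma smooth_real_has_derivative:
  "smooth (f :: real \<Rightarrow> real) \<Longrightarrow> (f has_real_derivative dir_deriv 1 f t) (at t)"
proof -
  assume "smooth f"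
  from smooth_differentiable[OF this, of t] obtain f' where f': "(f has_derivative f') (at t)"
    by (auto simp: differentiable_def)
  have "f' = (*) (dir_deriv 1 f t)"
  proof
    fix h show "f' h = dir_deriv 1 f t * h"
      using linear_scale[OF has_derivative_linear[OF f'], of h 1] by (simp add: mult.commute dir_deriv_eq[OF f'])
  qed
  with f' show ?thesis by (simp add: has_field_derivative_def)
qed

text \<open>Differentiating \<open>h (c * (x \<bullet> i) + d)\<close> gives a function of the same
  kind, with the derivative of \<open>h\<close>, times the constant
  \<open>c * (e \<bullet> i)\<close>, which the generated algebra absorbs.\<close>

lemma smooth_compose_affine:
  fixes g :: "real \<Rightarrow> real"
  assumes "smooth g"
  shows "smooth (\<lambda>x::'a::euclidean_space. g (c * (x \<bullet> i) + d))"
proof -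
  define S where "S = {\<lambda>x::'a. h (c * (x \<bullet> i) + d) | h. smooth (h :: real \<Rightarrow> real)}"
  have deriv: "((\<lambda>x. h (c * (x \<bullet> i) + d)) has_derivative
      (\<lambda>v. dir_deriv 1 h (c * (x \<bullet> i) + d) * (c * (v \<bullet> i)))) (at x)"
    if "smooth h" for h :: "real \<Rightarrow> real" and x :: 'a
    by (rule has_derivative_compose[OF _ smooth_real_has_derivative[OF that, unfolded has_field_derivative_def]])
      (auto intro!: derivative_eq_intros)
  show ?thesis
  proof (rule smooth_function_algebra[of S])
    show "f differentiable (at x)" if "f \<in> S" for f x
      using that deriv unfolding S_def differentiable_def by blast
    show "dir_deriv e f \<in> function_algebra S" if "f \<in> S" "e \<in> Basis" for f e
    proof -
      from that obtain h where h: "f = (\<lambda>x. h (c * (x \<bullet> i) + d))" "smooth h"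
        by (auto simp: S_def)
      have "dir_deriv e f = (\<lambda>x. dir_deriv 1 h (c * (x \<bullet> i) + d) * (c * (e \<bullet> i)))"
        unfolding h(1) by (rule ext, rule dir_deriv_eq, rule deriv, rule h(2))
      moreover have "(\<lambda>x. dir_deriv 1 h (c * (x \<bullet> i) + d)) \<in> S"
        using smooth_dir_deriv[OF h(2), of 1] unfolding S_def by auto
      ultimately show ?thesis
        by (auto intro: function_algebra.intros)
    qed
    show "(\<lambda>x. g (c * (x \<bullet> i) + d)) \<in> function_algebra S"
      using assms by (intro function_algebra.base) (auto simp: S_def)
  qed
qed

section \<open>Bump functions\<close>

definition flat_exp :: "real poly \<Rightarrow> real \<Rightarrow> real" where
  "flat_exp p x = (if x > 0 then poly p (1 / x) * exp (- (1 / x)) else 0)"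

lemma poly_over_exp_tendsto_0: "((\<lambda>x::real. poly p x / exp x) \<longlongrightarrow> 0) at_top"
proof -
  have "((\<lambda>x. \<Sum>i\<le>degree p. coeff p i * (x ^ i / exp x)) \<longlongrightarrow> (\<Sum>i\<le>degree p. coeff p i * 0)) at_top"
    by (intro tendsto_intros tendsto_power_div_exp_0)
  then show ?thesis
    by (simp add: poly_altdef sum_divide_distrib)
qed

text \<open>In the variable y = 1/x, differentiating p(y) exp(-y) gives y^2 (p(y) - p'(y)) exp(-y),
  and \<open>[:0, 0, 1:]\<close> is y^2. The polynomial parameter is there to close the family under
  differentiation.\<close>

lemma flat_exp_has_derivative:
  "(flat_exp p has_field_derivative flat_exp ([:0, 0, 1:] * (p - pderiv p)) x) (at x)"
proof -
  consider "x > 0" | "x < 0" | "x = 0" by linarith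
  then show ?thesis
  proof cases
    case 1
    have "((\<lambda>x. poly p (1 / x) * exp (- (1 / x))) has_field_derivative
        flat_exp ([:0, 0, 1:] * (p - pderiv p)) x) (at x)"
      using 1 by (auto intro!: derivative_eq_intros DERIV_chain'[OF _ poly_DERIV]
          simp: flat_exp_def field_simps power2_eq_square)
    then show ?thesis
      by (rule DERIV_cong_ev[THEN iffD1, rotated 3])
        (use 1 eventually_nhds_in_open[of "{0<..}" x] in \<open>auto simp: flat_exp_def elim!: eventually_mono\<close>)
  next
    case 2
    have "((\<lambda>x. 0) has_field_derivative flat_exp ([:0, 0, 1:] * (p - pderiv p)) x) (at x)"
      using 2 by (auto simp: flat_exp_def)
    then show ?thesis
      by (rule DERIV_cong_ev[THEN iffD1, rotated 3])
        (use 2 eventually_nhds_in_open[of "{..<0}" x] in \<open>auto simp: flat_exp_def elim!: eventually_mono\<close>)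
  next
    case 3
    have "((\<lambda>h. flat_exp p h / h) \<longlongrightarrow> 0) (at 0)"
    proof (rule filterlim_split_at)
      show "((\<lambda>h. flat_exp p h / h) \<longlongrightarrow> 0) (at_left 0)"
        by (rule tendsto_eventually)
          (auto simp: eventually_at_filter flat_exp_def intro!: always_eventually)
      \<comment> \<open>\<open>pCons 0 p\<close> is y p(y): dividing by h = 1/y costs one power of
        y, which the exponential still beats.\<close>
      have "((\<lambda>h. poly (pCons 0 p) (inverse h) / exp (inverse h)) \<longlongrightarrow> 0) (at_right 0)"
        by (rule filterlim_compose[OF poly_over_exp_tendsto_0 filterlim_inverse_at_top_right])
      then show "((\<lambda>h. flat_exp p h / h) \<longlongrightarrow> 0) (at_right 0)"
        by (rule tendsto_cong[THEN iffD1, rotated])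
          (auto simp: eventually_at_filter flat_exp_def exp_minus field_simps intro!: always_eventually)
    qed
    then show ?thesis
      using 3 by (simp add: DERIV_def flat_exp_def)
  qed
qed

lemma smooth_flat_exp: "smooth (flat_exp p)"
proof (rule smooth_function_algebra[of "range flat_exp"])
  show "f differentiable (at x)" if "f \<in> range flat_exp" for f x
    using that flat_exp_has_derivative by (auto simp: has_field_derivative_def differentiable_def)
  show "dir_deriv e f \<in> function_algebra (range flat_exp)"
    if "f \<in> range flat_exp" "e \<in> Basis" for f and e :: real
  proof -
    from that obtain p where f: "f = flat_exp p" and e: "e = 1" by auto
    have "dir_deriv e f = flat_exp ([:0, 0, 1:] * (p - pderiv p))"
      using dir_deriv_eq[OF flat_exp_has_derivative[unfolded has_field_derivative_def], of 1]
      unfolding f e by auto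
    then show ?thesis by (auto intro: function_algebra.base)
  qed
  show "flat_exp p \<in> function_algebra (range flat_exp)"
    by (auto intro: function_algebra.base)
qed

text \<open>The factor \<open>c\<close> steepens the walls without moving the support:
  \<open>flat_exp 1 (c * y)\<close> increases to the indicator of y > 0 as \<open>c\<close> grows.
  Indicators of boxes thus become limits of test functions supported in one fixed box.\<close>

definition box_bump :: "'a::euclidean_space \<Rightarrow> 'a \<Rightarrow> real \<Rightarrow> 'a \<Rightarrow> real" where
  "box_bump a b c x =
     (\<Prod>i\<in>Basis. flat_exp 1 (c * (x \<bullet> i - a \<bullet> i)) * flat_exp 1 (c * (b \<bullet> i - x \<bullet> i)))"

lemma smooth_box_bump: "smooth (box_bump a b c)"
proof -
  have "smooth (\<lambda>x. \<Prod>i\<in>Basis. flat_exp 1 (c * (x \<bullet> i) + - c * (a \<bullet> i)) * flat_exp 1 (- c * (x \<bullet> i) + c * (b \<bullet> i)))"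
    by (intro smooth_prod smooth_mult smooth_compose_affine smooth_flat_exp)
  then show ?thesis
    by (rule back_subst[of smooth]) (auto simp: box_bump_def algebra_simps fun_eq_iff)
qed

lemma flat_exp_1_bounds: "0 \<le> flat_exp 1 x" "flat_exp 1 x \<le> 1"
  by (auto simp: flat_exp_def)

lemma box_bump_pos: "c > 0 \<Longrightarrow> x \<in> box a b \<Longrightarrow> box_bump a b c x > 0"
  unfolding box_bump_def by (intro prod_pos) (auto simp: flat_exp_def mem_box)

lemma box_bump_bounds: "0 \<le> box_bump a b c x" "box_bump a b c x \<le> 1"
  unfolding box_bump_def
  by (auto intro!: prod_nonneg prod_le_1 mult_le_one mult_nonneg_nonneg flat_exp_1_bounds)

lemma box_bump_eq_0:
  assumes "c > 0" "x \<notin> box a b"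
  shows "box_bump a b c x = 0"
proof -
  from assms obtain i where i: "i \<in> Basis" "x \<bullet> i \<le> a \<bullet> i \<or> b \<bullet> i \<le> x \<bullet> i"
    by (auto simp: mem_box not_less)
  then have "c * (x \<bullet> i - a \<bullet> i) \<le> 0 \<or> c * (b \<bullet> i - x \<bullet> i) \<le> 0"
    using \<open>c > 0\<close> by (simp add: mult_le_0_iff)
  then have "flat_exp 1 (c * (x \<bullet> i - a \<bullet> i)) * flat_exp 1 (c * (b \<bullet> i - x \<bullet> i)) = 0"
    by (auto simp: flat_exp_def)
  then show ?thesis
    unfolding box_bump_def using i(1) by (intro prod_zero) auto
qed

lemma box_bump_tendsto: "(\<lambda>n. box_bump a b (real (Suc n)) x) \<longlonglongrightarrow> indicator (box a b) x"
proof (cases "x \<in> box a b")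
  case True
  have lim: "(\<lambda>n. flat_exp 1 (real (Suc n) * y)) \<longlonglongrightarrow> 1" if "y > 0" for y
  proof -
    have "(\<lambda>n. exp (- (inverse y * inverse (real (Suc n))))) \<longlonglongrightarrow> exp (- (inverse y * 0))"
      by (intro tendsto_intros LIMSEQ_inverse_real_of_nat)
    moreover have "flat_exp 1 (real (Suc n) * y) = exp (- (inverse y * inverse (real (Suc n))))" for n
      using that by (simp add: flat_exp_def inverse_eq_divide mult.commute del: of_nat_Suc)
    ultimately show ?thesis by simp
  qed
  have "(\<lambda>n. box_bump a b (real (Suc n)) x) \<longlonglongrightarrow> (\<Prod>i\<in>(Basis::'a set). 1 * 1)"
    unfolding box_bump_def using True by (intro tendsto_intros lim) (auto simp: mem_box)
  then show ?thesis using True by simp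
next
  case False
  then show ?thesis by (simp add: box_bump_eq_0)
qed

section \<open>Test functions and their closure properties\<close>

lemma test_functions_smooth: "\<phi> \<in> test_functions \<Omega> \<Longrightarrow> smooth \<phi>"
  by (simp add: test_functions_def)

lemma test_functions_compact_support:
  assumes "\<phi> \<in> test_functions \<Omega>"
  obtains K where "compact K" "K \<subseteq> \<Omega>" "{x. \<phi> x \<noteq> 0} \<subseteq> K"
  using assms that[of "closure {x. \<phi> x \<noteq> 0}"] closure_subset[of "{x. \<phi> x \<noteq> 0}"]
  by (simp add: test_functions_def)

lemma test_functionsI:
  assumes "smooth \<phi>" "compact K" "K \<subseteq> \<Omega>" "{x. \<phi> x \<noteq> 0} \<subseteq> K"
  shows "\<phi> \<in> test_functions \<Omega>"
proof -
  have sub: "closure {x. \<phi> x \<noteq> 0} \<subseteq> K"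
    using assms by (intro closure_minimal compact_imp_closed) auto
  have "compact (K \<inter> closure {x. \<phi> x \<noteq> 0})"
    using assms(2) by (rule compact_Int_closed) simp
  then have "compact (closure {x. \<phi> x \<noteq> 0})"
    using sub by (simp add: Int_absorb1)
  then show ?thesis
    using assms(1,3) sub unfolding test_functions_def by simp
qed

lemma test_functions_add:
  assumes "\<phi> \<in> test_functions \<Omega>" "\<psi> \<in> test_functions \<Omega>"
  shows "(\<lambda>x. \<phi> x + \<psi> x) \<in> test_functions \<Omega>"
proof -
  obtain K where "compact K" "K \<subseteq> \<Omega>" "{x. \<phi> x \<noteq> 0} \<subseteq> K"
    using assms(1) by (rule test_functions_compact_support)
  moreover obtain L where "compact L" "L \<subseteq> \<Omega>" "{x. \<psi> x \<noteq> 0} \<subseteq> L"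
    using assms(2) by (rule test_functions_compact_support)
  ultimately show ?thesis
    using assms by (intro test_functionsI[of _ "K \<union> L"])
      (fastforce intro: smooth_add test_functions_smooth)+
qed

lemma test_functions_cmult:
  assumes "\<phi> \<in> test_functions \<Omega>"
  shows "(\<lambda>x. c * \<phi> x) \<in> test_functions \<Omega>"
proof -
  obtain K where "compact K" "K \<subseteq> \<Omega>" "{x. \<phi> x \<noteq> 0} \<subseteq> K"
    using assms(1) by (rule test_functions_compact_support)
  then show ?thesis
    using assms by (intro test_functionsI[of _ K]) (auto intro: smooth_mult smooth_const test_functions_smooth)
qed

lemma test_functions_dir_deriv:
  assumes "\<phi> \<in> test_functions \<Omega>" "e \<in> Basis"
  shows "dir_deriv e \<phi> \<in> test_functions \<Omega>"
proof -
  obtain K where K: "compact K" "K \<subseteq> \<Omega>" "{x. \<phi> x \<noteq> 0} \<subseteq> K"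
    using assms(1) by (rule test_functions_compact_support)
  have "dir_deriv e \<phi> x = 0" if "x \<notin> K" for x
  proof (rule dir_deriv_eq[of _ "\<lambda>_. 0"])
    have "((\<lambda>x. 0) has_derivative (\<lambda>_. 0)) (at x)" by simp
    then show "(\<phi> has_derivative (\<lambda>_. 0)) (at x)"
      by (rule has_derivative_transform_within_open[of _ _ _ _ "- K"])
        (use K that compact_imp_closed in auto)
  qed
  then show ?thesis
    using assms K(1,2) by (intro test_functionsI[of _ K]) (auto intro: smooth_dir_deriv test_functions_smooth)
qed

lemma test_functions_partials:
  "\<phi> \<in> test_functions \<Omega> \<Longrightarrow> set es \<subseteq> Basis \<Longrightarrow> partials es \<phi> \<in> test_functions \<Omega>"
  by (induction es) (auto simp: partials_Cons intro: test_functions_dir_deriv)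

lemma box_bump_test_function:
  assumes "c > 0" "cbox a b \<subseteq> \<Omega>"
  shows "box_bump a b c \<in> test_functions \<Omega>"
  using assms box_subset_cbox[of a b]
  by (intro test_functionsI[of _ "cbox a b"]) (auto intro: smooth_box_bump box_bump_eq_0)

lemma test_functions_integrable:
  fixes \<phi> :: "'a::euclidean_space \<Rightarrow> real"
  assumes "\<phi> \<in> test_functions \<Omega>"
  shows "integrable lborel \<phi>"
proof -
  obtain K where K: "compact K" "K \<subseteq> \<Omega>" "{x. \<phi> x \<noteq> 0} \<subseteq> K"
    using assms(1) by (rule test_functions_compact_support)
  have "(\<lambda>x. indicator K x *\<^sub>R \<phi> x) = \<phi>"
    using subsetD[OF K(3)] by (auto simp: indicator_def fun_eq_iff)
  then show ?thesis
    using borel_integrable_compact[OF K(1) smooth_continuous_on[OF test_functions_smooth[OF assms]]]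
    by simp
qed

lemma test_functions_mult:
  assumes "\<phi> \<in> test_functions \<Omega>" "\<psi> \<in> test_functions \<Omega>"
  shows "(\<lambda>x. \<phi> x * \<psi> x) \<in> test_functions \<Omega>"
proof -
  obtain K where "compact K" "K \<subseteq> \<Omega>" "{x. \<phi> x \<noteq> 0} \<subseteq> K"
    using assms(1) by (rule test_functions_compact_support)
  then show ?thesis
    using assms by (intro test_functionsI[of _ K]) (auto intro: smooth_mult test_functions_smooth)
qed

lemma test_functions_L2:
  assumes "\<phi> \<in> test_functions \<Omega>"
  shows "\<phi> \<in> L2"
  using borel_measurable_integrable[OF test_functions_integrable[OF assms]]
    test_functions_integrable[OF test_functions_mult[OF assms assms]]
  by (simp add: L2_def power2_eq_square)

section \<open>Density of test functions in the Hilbert space\<close>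

definition test_vectors :: "'a::euclidean_space lsq set" where
  "test_vectors = abs_lsq ` test_functions UNIV"

lemma test_vectors_add: "F \<in> test_vectors \<Longrightarrow> G \<in> test_vectors \<Longrightarrow> F + G \<in> test_vectors"
  by (auto simp: test_vectors_def abs_lsq_add test_functions_L2 intro!: imageI test_functions_add)

lemma test_vectors_scaleR: "F \<in> test_vectors \<Longrightarrow> c *\<^sub>R F \<in> test_vectors"
  by (auto simp: test_vectors_def abs_lsq_scaleR test_functions_L2 intro!: imageI test_functions_cmult)

lemma closure_test_vectors_add:
  assumes "F \<in> closure test_vectors" "G \<in> closure test_vectors"
  shows "F + G \<in> closure test_vectors"
proof -
  obtain f g where f: "\<And>n. f n \<in> test_vectors" "f \<longlonglongrightarrow> F" and g: "\<And>n. g n \<in> test_vectors" "g \<longlonglongrightarrow> G"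
    using assms unfolding closure_sequential by metis
  have "(\<lambda>n. f n + g n) \<longlonglongrightarrow> F + G" using f g by (intro tendsto_intros)
  then show ?thesis
    using f(1) g(1) test_vectors_add unfolding closure_sequential by fast
qed

lemma closure_test_vectors_scaleR:
  assumes "F \<in> closure test_vectors"
  shows "c *\<^sub>R F \<in> closure test_vectors"
proof -
  obtain f where f: "\<And>n. f n \<in> test_vectors" "f \<longlonglongrightarrow> F"
    using assms unfolding closure_sequential by metis
  have "(\<lambda>n. c *\<^sub>R f n) \<longlonglongrightarrow> c *\<^sub>R F" using f by (intro tendsto_intros)
  then show ?thesis
    using f(1) test_vectors_scaleR unfolding closure_sequential by fast
qed

lemma closure_test_vectors_limit:
  "(\<And>n. f n \<in> closure test_vectors) \<Longrightarrow> f \<longlonglongrightarrow> F \<Longrightarrow> F \<in> closure test_vectors"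
  by (meson closed_closure closed_sequential_limits)

lemma zero_in_closure_test_vectors: "0 \<in> closure test_vectors"
  using closure_test_vectors_scaleR[of _ 0] box_bump_test_function[of 1 0 0 UNIV] closure_subset
  unfolding test_vectors_def by fastforce

lemma closure_test_vectors_sum:
  "(\<And>i. i \<in> I \<Longrightarrow> f i \<in> closure test_vectors) \<Longrightarrow> (\<Sum>i\<in>I. f i) \<in> closure test_vectors"
  by (induction I rule: infinite_finite_induct)
    (auto intro: zero_in_closure_test_vectors closure_test_vectors_add)

lemma indicator_L2:
  assumes "A \<in> sets borel" "emeasure lborel A < \<infinity>"
  shows "indicator A \<in> L2"
proof -
  have "(indicator A x)\<^sup>2 = (indicator A x :: real)" for x
    by (simp add: indicator_def)
  then show ?thesis using assms by (simp add: L2_def)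
qed

lemma indicator_box_in_closure: "abs_lsq (indicator (box a b)) \<in> closure test_vectors"
proof (rule closure_test_vectors_limit)
  have tf: "box_bump a b (real (Suc n)) \<in> test_functions UNIV" for n
    by (rule box_bump_test_function) auto
  show "abs_lsq (box_bump a b (real (Suc n))) \<in> closure test_vectors" for n
    using tf closure_subset unfolding test_vectors_def by blast
  have "indicator (box a b) \<in> L2"
    by (intro indicator_L2 emeasure_lborel_box_finite) simp
  then show "(\<lambda>n. abs_lsq (box_bump a b (real (Suc n)))) \<longlonglongrightarrow> abs_lsq (indicator (box a b))"
  proof (rule abs_lsq_tendsto_dominated[OF test_functions_L2[OF tf]])
    show "AE x in lborel. (\<lambda>n. box_bump a b (real (Suc n)) x) \<longlonglongrightarrow> indicator (box a b) x"
      using box_bump_tendsto by (intro AE_I2)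
    show "AE x in lborel. \<bar>box_bump a b (real (Suc n)) x - indicator (box a b) x\<bar> \<le> indicator (box a b) x" for n
      using box_bump_bounds[of a b "real (Suc n)"] box_bump_eq_0[of "real (Suc n)" _ a b]
      by (intro AE_I2) (auto simp: indicator_def)
  qed (rule \<open>indicator (box a b) \<in> L2\<close>)
qed

text \<open>Dynkin's argument: boxes are an intersection-stable generator of the Borel sets, and the
  good sets are closed under complements and disjoint unions. Intersecting with one fixed box keeps
  all measures finite, so that complements stay square integrable.\<close>

lemma indicator_Int_box_in_closure:
  assumes "A \<in> sets borel"
  shows "abs_lsq (indicator (A \<inter> box u v)) \<in> closure test_vectors"
proof -
  let ?B = "box u v"
  have fin: "emeasure lborel (A \<inter> ?B) < \<infinity>" if "A \<in> sets borel" for A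
    using emeasure_mono[of "A \<inter> ?B" ?B lborel] emeasure_lborel_box_finite[of u v]
    by (auto intro: le_less_trans)
  have L2: "indicator (A \<inter> ?B) \<in> L2" if "A \<in> sets borel" for A
    using that fin by (intro indicator_L2) auto
  have L2B: "indicator ?B \<in> L2"
    using L2[of UNIV] by simp
  let ?G = "range (\<lambda>(a, b). box a b :: 'a set)"
  have sig: "sigma_sets UNIV ?G = sets borel"
    by (subst borel_eq_box) simp
  have "Int_stable ?G"
    by (auto simp: Int_stable_def box_Int_box)
  moreover have "?G \<subseteq> Pow UNIV" by simp
  moreover have "A \<in> sigma_sets UNIV ?G" using assms sig by simp
  ultimately show ?thesis
  proof (induction rule: sigma_sets_induct_disjoint)
    case (basic A)
    then show ?case by (auto simp: box_Int_box indicator_box_in_closure)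
  next
    case empty
    have "indicator {} = (\<lambda>x::'a. 0::real)" by auto
    then show ?case by (simp add: abs_lsq_zero zero_in_closure_test_vectors)
  next
    case (compl A)
    then have A: "A \<in> sets borel" by (simp add: sig)
    have "indicator ((UNIV - A) \<inter> ?B) = (\<lambda>x. indicator ?B x + (-1) * indicator (A \<inter> ?B) x :: real)"
      by (auto simp: indicator_def fun_eq_iff)
    then have "abs_lsq (indicator ((UNIV - A) \<inter> ?B)) =
        abs_lsq (indicator ?B) + (-1) *\<^sub>R abs_lsq (indicator (A \<inter> ?B))"
      using L2[OF A] L2B by (simp only: abs_lsq_add abs_lsq_scaleR L2_cmult)
    then show ?case
      using compl(2) indicator_box_in_closure[of u v]
      by (simp only: closure_test_vectors_add closure_test_vectors_scaleR)
  next
    case (union A)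
    then have A: "A i \<in> sets borel" for i by (auto simp: sig)
    show ?case
    proof (rule closure_test_vectors_limit)
      show "(\<Sum>i<n. abs_lsq (indicator (A i \<inter> ?B))) \<in> closure test_vectors" for n
        by (intro closure_test_vectors_sum union)
      have eq: "(\<lambda>x. \<Sum>i<n. indicator (A i \<inter> ?B) x) = (indicator ((\<Union>i<n. A i) \<inter> ?B) :: 'a \<Rightarrow> real)" for n
      proof
        fix x
        have "disjoint_family_on (\<lambda>i. A i \<inter> ?B) {..<n}"
          using union(1) by (auto simp: disjoint_family_on_def)
        moreover have "(\<Union>i<n. A i) \<inter> ?B = (\<Union>i<n. A i \<inter> ?B)" by auto
        ultimately show "(\<Sum>i<n. indicator (A i \<inter> ?B) x) = (indicator ((\<Union>i<n. A i) \<inter> ?B) x :: real)"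
          by (simp only: indicator_UN_disjoint finite_lessThan)
      qed
      have "(\<Sum>i<n. abs_lsq (indicator (A i \<inter> ?B))) = abs_lsq (indicator ((\<Union>i<n. A i) \<inter> ?B))" for n
        by (subst abs_lsq_sum) (auto intro: L2 A simp: eq)
      moreover have "(\<lambda>n. abs_lsq (indicator ((\<Union>i<n. A i) \<inter> ?B))) \<longlonglongrightarrow> abs_lsq (indicator ((\<Union>i. A i) \<inter> ?B))"
      proof (rule abs_lsq_tendsto_dominated[OF L2 L2 L2[of UNIV]])
        show "AE x in lborel. (\<lambda>n. indicator ((\<Union>i<n. A i) \<inter> ?B) x) \<longlonglongrightarrow> (indicator ((\<Union>i. A i) \<inter> ?B) x :: real)"
        proof (intro AE_I2)
          fix x
          have "(\<lambda>n. indicator (\<Union>i<n. A i) x * indicator ?B x) \<longlonglongrightarrow> (indicator (\<Union>i. A i) x * indicator ?B x :: real)"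
            by (intro tendsto_intros LIMSEQ_indicator_UN)
          then show "(\<lambda>n. indicator ((\<Union>i<n. A i) \<inter> ?B) x) \<longlonglongrightarrow> (indicator ((\<Union>i. A i) \<inter> ?B) x :: real)"
            by (simp add: indicator_inter_arith)
        qed
        show "AE x in lborel. \<bar>indicator ((\<Union>i<n. A i) \<inter> ?B) x - indicator ((\<Union>i. A i) \<inter> ?B) x\<bar>
            \<le> (indicator (UNIV \<inter> ?B) x :: real)" for n
          by (intro AE_I2) (auto simp: indicator_def)
      qed (use A in auto)
      ultimately show "(\<lambda>n. \<Sum>i<n. abs_lsq (indicator (A i \<inter> ?B))) \<longlonglongrightarrow> abs_lsq (indicator ((\<Union>i. A i) \<inter> ?B))"
        by simp
    qed
  qed
qed

lemma indicator_in_closure: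
  fixes A :: "'a::euclidean_space set"
  assumes A: "A \<in> sets borel" and L2: "indicator A \<in> L2"
  shows "abs_lsq (indicator A) \<in> closure test_vectors"
proof (rule closure_test_vectors_limit)
  let ?B = "\<lambda>n. box (- real n *\<^sub>R One) (real n *\<^sub>R One) :: 'a set"
  show "abs_lsq (indicator (A \<inter> ?B n)) \<in> closure test_vectors" for n
    by (rule indicator_Int_box_in_closure[OF A])
  have L2': "indicator (A \<inter> ?B n) \<in> L2" for n
    unfolding L2_def
  proof (intro CollectI conjI)
    show "indicator (A \<inter> ?B n) \<in> borel_measurable lborel" using A by simp
    then show "integrable lborel (\<lambda>x. (indicator (A \<inter> ?B n) x :: real)\<^sup>2)"
      by (intro Bochner_Integration.integrable_bound[OF L2_square_integrable[OF L2]] AE_I2)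
        (auto intro: borel_measurable_power split: split_indicator)
  qed
  show "(\<lambda>n. abs_lsq (indicator (A \<inter> ?B n))) \<longlonglongrightarrow> abs_lsq (indicator A)"
  proof (rule abs_lsq_tendsto_dominated[OF L2' L2 L2])
    show "AE x in lborel. (\<lambda>n. indicator (A \<inter> ?B n) x) \<longlonglongrightarrow> (indicator A x :: real)"
    proof (intro AE_I2 tendsto_eventually)
      fix x :: 'a
      obtain N :: nat where N: "norm x < real N" using reals_Archimedean2 by blast
      have "x \<in> ?B n" if "n \<ge> N" for n
        unfolding mem_box
      proof
        fix i :: 'a assume i: "i \<in> Basis"
        have "\<bar>x \<bullet> i\<bar> \<le> norm x" by (rule Basis_le_norm[OF i])
        then have "\<bar>x \<bullet> i\<bar> < real n" using N that by linarith
        then show "(- real n *\<^sub>R One) \<bullet> i < x \<bullet> i \<and> x \<bullet> i < (real n *\<^sub>R One) \<bullet> i"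
          using i by auto
      qed
      then show "\<forall>\<^sub>F n in sequentially. indicator (A \<inter> ?B n) x = (indicator A x :: real)"
        unfolding eventually_sequentially by (intro exI[of _ N]) (auto simp: indicator_def)
    qed
    show "AE x in lborel. \<bar>indicator (A \<inter> ?B n) x - indicator A x\<bar> \<le> (indicator A x :: real)" for n
      by (intro AE_I2) (auto simp: indicator_def)
  qed
qed

lemma test_vectors_dense: "closure test_vectors = (UNIV :: 'a::euclidean_space lsq set)"
proof (intro equalityI subsetI UNIV_I)
  fix F :: "'a lsq"
  obtain f where f: "f \<in> L2" "F = abs_lsq f" by (rule lsq_cases)
  obtain s where s: "\<And>i. simple_function borel (s i)" "\<And>x. (\<lambda>i. s i x) \<longlonglongrightarrow> f x"
      "\<And>i x. dist (s i x) 0 \<le> 2 * dist (f x) 0"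
    using borel_measurable_implies_sequence_metric[OF L2_measurable[OF f(1)], of 0] by auto
  have meas: "s i \<in> borel_measurable borel" for i
    using s(1) by (rule borel_measurable_simple_function)
  have f2: "integrable lborel (\<lambda>x. (2 * \<bar>f x\<bar>)\<^sup>2)"
    using L2_square_integrable[OF f(1)] by (simp add: power_mult_distrib)
  have bd: "\<bar>s i x\<bar> \<le> 2 * \<bar>f x\<bar>" for i x
    using s(3)[of i x] by simp
  have sL2: "s i \<in> L2" for i
    unfolding L2_def
  proof (intro CollectI conjI Bochner_Integration.integrable_bound[OF f2])
    show "AE x in lborel. norm ((s i x)\<^sup>2) \<le> norm ((2 * \<bar>f x\<bar>)\<^sup>2)"
    proof (rule AE_I2)
      fix x show "norm ((s i x)\<^sup>2) \<le> norm ((2 * \<bar>f x\<bar>)\<^sup>2)"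
        using power_mono[OF bd[of i x], of 2] by simp
    qed
  qed (use meas in auto)
  show "F \<in> closure test_vectors"
  proof (rule closure_test_vectors_limit)
    fix i
    \<comment> \<open>The value 0 is left out because its level set may have infinite measure. On
      the level set of another value y, the indicator is bounded by |s_i| / |y|, hence square
      integrable.\<close>
    let ?Y = "range (s i) - {0}"
    have fin: "finite ?Y" using s(1)[of i] by (auto simp: simple_function_def)
    have A: "s i -` {y} \<in> sets borel" for y
      using meas[of i] measurable_sets[of "s i" borel borel "{y}"] by simp
    have ind: "indicator (s i -` {y}) \<in> L2" if "y \<in> ?Y" for y
    proof -
      have "integrable lborel (\<lambda>x. (s i x)\<^sup>2 * (1 / y\<^sup>2))"
        using L2_square_integrable[OF sL2] by simp
      then have "integrable lborel (\<lambda>x. (indicator (s i -` {y}) x :: real)\<^sup>2)"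
        by (rule Bochner_Integration.integrable_bound)
          (use A that in \<open>auto split: split_indicator\<close>)
      then show ?thesis using A by (simp add: L2_def)
    qed
    have eq: "(\<Sum>y\<in>?Y. y * indicator (s i -` {y}) x) = s i x" for x
    proof (cases "s i x = 0")
      case True
      then show ?thesis by (auto intro!: sum.neutral simp: indicator_def)
    next
      case False
      have "(\<Sum>y\<in>?Y. y * indicator (s i -` {y}) x) = (\<Sum>y\<in>?Y. if y = s i x then y else 0)"
        by (intro sum.cong) (auto simp: indicator_def)
      then show ?thesis using False fin by (simp add: sum.delta)
    qed
    have "abs_lsq (s i) = (\<Sum>y\<in>?Y. y *\<^sub>R abs_lsq (indicator (s i -` {y})))"
      using abs_lsq_sum[of ?Y "\<lambda>y x. y * indicator (s i -` {y}) x"] ind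
      by (simp add: abs_lsq_scaleR L2_cmult eq)
    also have "\<dots> \<in> closure test_vectors"
      using ind A by (intro closure_test_vectors_sum closure_test_vectors_scaleR indicator_in_closure) auto
    finally show "abs_lsq (s i) \<in> closure test_vectors" .
  next
    show "(\<lambda>i. abs_lsq (s i)) \<longlonglongrightarrow> F"
      unfolding f(2)
    proof (rule abs_lsq_tendsto_dominated[OF sL2 f(1)])
      \<comment> \<open>3 = 2 + 1: the approximating simple functions satisfy |s_n| \<le> 2
        |f|.\<close>
      show "(\<lambda>x. 3 * \<bar>f x\<bar>) \<in> L2"
        using f(1) by (auto simp: L2_def power_mult_distrib)
      show "AE x in lborel. \<bar>s n x - f x\<bar> \<le> 3 * \<bar>f x\<bar>" for n
      proof (rule AE_I2)
        fix x show "\<bar>s n x - f x\<bar> \<le> 3 * \<bar>f x\<bar>" using bd[of n x] by linarith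
      qed
    qed (use s(2) in auto)
  qed
qed

text \<open>Duality: test vectors approximating \<open>F\<close> itself turn the hypothesis into
  |F|^2 \<le> M |F|.\<close>

lemma norm_le_of_test_vectors:
  fixes F :: "'a::euclidean_space lsq"
  assumes "0 \<le> M" "\<And>\<phi>. \<phi> \<in> test_vectors \<Longrightarrow> inner F \<phi> \<le> M * norm \<phi>"
  shows "norm F \<le> M"
proof -
  have "F \<in> closure test_vectors" by (simp add: test_vectors_dense)
  then obtain f where f: "\<And>n. f n \<in> test_vectors" "f \<longlonglongrightarrow> F"
    unfolding closure_sequential by metis
  have "inner F F \<le> M * norm F"
  proof (rule LIMSEQ_le)
    show "(\<lambda>n. inner F (f n)) \<longlonglongrightarrow> inner F F" "(\<lambda>n. M * norm (f n)) \<longlonglongrightarrow> M * norm F"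
      using f(2) by (auto intro!: tendsto_intros)
  qed (use assms(2) f(1) in auto)
  then have *: "norm F * norm F \<le> M * norm F"
    by (simp add: power2_norm_eq_inner[symmetric] power2_eq_square)
  show ?thesis
    using * assms(1) by (cases "F = 0") auto
qed

lemma eq_of_test_vectors:
  fixes F G :: "'a::euclidean_space lsq"
  assumes "\<And>\<phi>. \<phi> \<in> test_vectors \<Longrightarrow> inner F \<phi> = inner G \<phi>"
  shows "F = G"
proof -
  have "norm (F - G) \<le> 0"
    by (rule norm_le_of_test_vectors) (simp_all add: inner_diff_left assms)
  then show ?thesis by simp
qed

section \<open>Translations\<close>

text \<open>The mean value inequality is applied to each scalar function r \<mapsto> (V r - r W(t),
  \<phi>). Norm continuity of \<open>W\<close> at \<open>t\<close> bounds its derivative by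
  \<epsilon> |\<phi>| with the same neighbourhood for every \<phi>, so duality returns a bound on
  the norm of the increment. Convexity of \<open>S\<close> provides the interval for the mean value
  inequality.\<close>

lemma has_vector_derivative_weak:
  fixes V W :: "real \<Rightarrow> 'a::euclidean_space lsq"
  assumes S: "convex S" "t \<in> S"
    and V: "\<And>s \<phi>. s \<in> S \<Longrightarrow> \<phi> \<in> test_vectors \<Longrightarrow>
      ((\<lambda>s. inner (V s) \<phi>) has_real_derivative inner (W s) \<phi>) (at s within S)"
    and W: "continuous (at t within S) W"
  shows "(V has_vector_derivative W t) (at t within S)"
  unfolding has_vector_derivative_def has_derivative_within_alt
proof (intro conjI allI impI)
  show "bounded_linear (\<lambda>x. x *\<^sub>R W t)" by (rule bounded_linear_scaleR_left)
  fix \<epsilon> :: real assume \<epsilon>: "\<epsilon> > 0"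
  then obtain \<delta> where \<delta>: "\<delta> > 0" "\<And>s. s \<in> S \<Longrightarrow> dist s t < \<delta> \<Longrightarrow> dist (W s) (W t) < \<epsilon>"
    using W unfolding continuous_within_eps_delta by meson
  have "norm (V s - V t - (s - t) *\<^sub>R W t) \<le> \<epsilon> * norm (s - t)" if s: "s \<in> S" "norm (s - t) < \<delta>" for s
  proof (rule norm_le_of_test_vectors)
    fix \<phi> :: "'a lsq" assume \<phi>: "\<phi> \<in> test_vectors"
    \<comment> \<open>The part of \<open>S\<close> on which \<open>W\<close> stays within \<epsilon>
      of \<open>W t\<close>; it is still convex.\<close>
    let ?S = "S \<inter> ball t \<delta>"
    have "norm ((inner (V s) \<phi> - s * inner (W t) \<phi>) - (inner (V t) \<phi> - t * inner (W t) \<phi>))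
        \<le> (\<epsilon> * norm \<phi>) * norm (s - t)"
    proof (rule field_differentiable_bound[where S = ?S])
      show "convex ?S" using S by (intro convex_Int convex_ball)
      show "s \<in> ?S" "t \<in> ?S" using s S \<delta> by (auto simp: dist_norm norm_minus_commute)
      fix r assume r: "r \<in> ?S"
      show "((\<lambda>r. inner (V r) \<phi> - r * inner (W t) \<phi>) has_field_derivative inner (W r) \<phi> - inner (W t) \<phi>)
          (at r within ?S)"
        using r by (auto intro!: derivative_eq_intros DERIV_subset[OF V[OF _ \<phi>]])
      have "norm (inner (W r - W t) \<phi>) \<le> norm (W r - W t) * norm \<phi>"
        using Cauchy_Schwarz_ineq2 by simp
      also have "\<dots> \<le> \<epsilon> * norm \<phi>"
        using r \<delta>(2)[of r] by (intro mult_right_mono) (auto simp: dist_norm abs_minus_commute)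
      finally show "norm (inner (W r) \<phi> - inner (W t) \<phi>) \<le> \<epsilon> * norm \<phi>"
        by (simp add: inner_diff_left)
    qed
    then show "inner (V s - V t - (s - t) *\<^sub>R W t) \<phi> \<le> \<epsilon> * norm (s - t) * norm \<phi>"
      by (simp add: inner_diff_left algebra_simps abs_le_iff)
  qed (use \<epsilon> in simp)
  then show "\<exists>d>0. \<forall>s\<in>S. norm (s - t) < d \<longrightarrow> norm (V s - V t - (s - t) *\<^sub>R W t) \<le> \<epsilon> * norm (s - t)"
    using \<delta>(1) by blast
qed

lemma has_vector_derivative_iff_quotient:
  "(f has_vector_derivative D) (at t within S) \<longleftrightarrow>
     ((\<lambda>s. (f s - f t) /\<^sub>R (s - t)) \<longlongrightarrow> D) (at t within S)"
proof -
  have "norm ((f s - f t) - (s - t) *\<^sub>R D) / norm (s - t) = norm ((f s - f t) /\<^sub>R (s - t) - D)" if "s \<noteq> t" for s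
  proof -
    have "(f s - f t) /\<^sub>R (s - t) - D = ((f s - f t) - (s - t) *\<^sub>R D) /\<^sub>R (s - t)"
      using that by (simp add: scaleR_diff_right)
    then show ?thesis by (simp add: divide_inverse mult.commute)
  qed
  then have "\<forall>\<^sub>F s in at t within S. norm ((f s - f t) - (s - t) *\<^sub>R D) / norm (s - t) =
      norm ((f s - f t) /\<^sub>R (s - t) - D)"
    by (simp add: eventually_at_filter)
  then have "((\<lambda>s. norm ((f s - f t) - (s - t) *\<^sub>R D) / norm (s - t)) \<longlongrightarrow> 0) (at t within S) \<longleftrightarrow>
      ((\<lambda>s. norm ((f s - f t) /\<^sub>R (s - t) - D)) \<longlongrightarrow> 0) (at t within S)"
    by (rule tendsto_cong)
  then show ?thesis
    unfolding has_vector_derivative_def has_derivative_iff_norm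
    by (simp add: bounded_linear_scaleR_left tendsto_norm_zero_iff LIM_zero_iff)
qed

section \<open>The translation group\<close>

lemma measurable_translate:
  "f \<in> borel_measurable borel \<Longrightarrow> (\<lambda>x::'a::euclidean_space. f (x + h)) \<in> borel_measurable borel"
  by (rule measurable_compose[where N = borel]) simp_all

lemma AE_lborel_translate:
  fixes f g :: "'a::euclidean_space \<Rightarrow> real"
  assumes [measurable]: "f \<in> borel_measurable borel" "g \<in> borel_measurable borel"
    and ae: "AE x in lborel. f x = g x"
  shows "AE x in lborel. f (x + h) = g (x + h)"
proof -
  have "AE x in distr lborel borel ((+) h). f x = g x"
    using ae by (subst lborel_distr_plus)
  then show ?thesis
    by (subst (asm) AE_distr_iff) (auto simp: add.commute)
qed

lemma integrable_lborel_translate: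
  fixes f :: "'a::euclidean_space \<Rightarrow> real"
  assumes "integrable lborel f"
  shows "integrable lborel (\<lambda>x. f (x + h))"
proof -
  have "integrable (distr lborel borel ((+) h)) f"
    using assms by (simp add: lborel_distr_plus)
  then have "integrable lborel (\<lambda>x. f (h + x))"
    using assms by (subst (asm) integrable_distr_eq) (auto dest: borel_measurable_integrable)
  then show ?thesis by (simp add: add.commute)
qed

lemma integral_lborel_translate:
  fixes f :: "'a::euclidean_space \<Rightarrow> real"
  assumes "f \<in> borel_measurable borel"
  shows "(LINT x|lborel. f (x + h)) = (LINT x|lborel. f x)"
proof -
  have "(LINT x|lborel. f x) = (LINT x|distr lborel borel ((+) h). f x)"
    by (simp add: lborel_distr_plus)
  also have "\<dots> = (LINT x|lborel. f (h + x))"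
    using assms by (subst integral_distr) auto
  finally show ?thesis by (simp add: add.commute)
qed

lemma L2_translate: "f \<in> L2 \<Longrightarrow> (\<lambda>x. f (x + h)) \<in> L2"
  by (auto simp: L2_def intro: measurable_translate integrable_lborel_translate[of "\<lambda>x. (f x)\<^sup>2"])

lift_definition translate :: "'a::euclidean_space \<Rightarrow> 'a lsq \<Rightarrow> 'a lsq" is "\<lambda>h f x. f (x + h)"
  unfolding L2_eq_def by (intro conjI L2_translate AE_lborel_translate) (auto dest: L2_measurable)

lemma translate_abs_lsq: "f \<in> L2 \<Longrightarrow> translate h (abs_lsq f) = abs_lsq (\<lambda>x. f (x + h))"
  by (rule translate.abs_eq) (simp add: L2_eq_def)

lemma translate_add: "translate h (F + G) = translate h F + translate h G"
  and translate_diff: "translate h (F - G) = translate h F - translate h G"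
  and translate_scaleR: "translate h (c *\<^sub>R F) = c *\<^sub>R translate h F"
  and translate_translate: "translate h (translate k F) = translate (h + k) F"
  by (cases F rule: lsq_cases; cases G rule: lsq_cases;
      simp add: translate_abs_lsq L2_translate abs_lsq_add L2_add abs_lsq_diff L2_diff
        abs_lsq_scaleR L2_cmult add.assoc)+

lemma translate_0 [simp]: "translate 0 F = F"
  by (cases F rule: lsq_cases) (simp add: translate_abs_lsq)

lemma inner_translate: "inner (translate h F) (translate h G) = inner F G"
proof -
  obtain f g where fg: "f \<in> L2" "F = abs_lsq f" "g \<in> L2" "G = abs_lsq g"
    by (metis lsq_cases)
  then show ?thesis
    using integral_lborel_translate[of "\<lambda>x. f x * g x" h]
    by (simp add: translate_abs_lsq inner_abs_lsq L2_translate borel_measurable_times L2_measurable)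
qed

lemma norm_translate [simp]: "norm (translate h F) = norm F"
  by (simp add: norm_eq_sqrt_inner inner_translate)

lemma inner_translate_left: "inner (translate h F) G = inner F (translate (- h) G)"
  using inner_translate[of "- h" "translate h F" G] by (simp add: translate_translate)

lemma bounded_linear_translate: "bounded_linear (translate h)"
  by (rule bounded_linear_intro[where K = 1]) (simp_all add: translate_add translate_scaleR)

lemma dir_deriv_translate: "smooth f \<Longrightarrow> dir_deriv e (\<lambda>x. f (x + h)) = (\<lambda>x. dir_deriv e f (x + h))"
proof
  fix x
  assume "smooth f"
  from smooth_differentiable[OF this] obtain f' where f': "(f has_derivative f') (at (x + h))"
    unfolding differentiable_def by blast
  have "((\<lambda>x. x + h) has_derivative (\<lambda>v. v)) (at x)"
    by (auto intro!: derivative_eq_intros)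
  from has_derivative_compose[OF this f']
  show "dir_deriv e (\<lambda>x. f (x + h)) x = dir_deriv e f (x + h)"
    by (simp add: dir_deriv_eq dir_deriv_eq[OF f'])
qed

lemma smooth_translate:
  assumes "smooth f"
  shows "smooth (\<lambda>x. f (x + h))"
proof (rule smooth_function_algebra[of "{\<lambda>x. g (x + h) | g. smooth g}"])
  show "(\<lambda>x. f (x + h)) \<in> function_algebra {\<lambda>x. g (x + h) | g. smooth g}"
    using assms by (auto intro: function_algebra.base)
  show "g differentiable (at x)" if g: "g \<in> {\<lambda>x. g (x + h) | g. smooth g}" for g x
  proof -
    have "(\<lambda>x. x + h) differentiable (at x)"
      by simp
    from differentiable_chain_at[OF this, unfolded o_def] show ?thesis
      using g smooth_differentiable by blast
  qed
  show "dir_deriv e g \<in> function_algebra {\<lambda>x. g (x + h) | g. smooth g}"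
    if "g \<in> {\<lambda>x. g (x + h) | g. smooth g}" "e \<in> Basis" for g e
    using that by (intro function_algebra.base) (auto simp: dir_deriv_translate intro!: smooth_dir_deriv)
qed

lemma test_functions_translate:
  assumes "\<phi> \<in> test_functions UNIV"
  shows "(\<lambda>x. \<phi> (x + h)) \<in> test_functions UNIV"
proof -
  obtain K where K: "compact K" "K \<subseteq> UNIV" "{x. \<phi> x \<noteq> 0} \<subseteq> K"
    using assms(1) by (rule test_functions_compact_support)
  show ?thesis
  proof (rule test_functionsI[of _ "(\<lambda>x. x - h) ` K"])
    show "compact ((\<lambda>x. x - h) ` K)"
      using K(1) by (intro compact_continuous_image continuous_intros)
    show "{x. \<phi> (x + h) \<noteq> 0} \<subseteq> (\<lambda>x. x - h) ` K"
    proof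
      fix x assume "x \<in> {x. \<phi> (x + h) \<noteq> 0}"
      then have "x + h \<in> K" using K(3) by auto
      then show "x \<in> (\<lambda>x. x - h) ` K" by (intro image_eqI[of _ _ "x + h"]) auto
    qed
  qed (use assms in \<open>auto intro: smooth_translate test_functions_smooth\<close>)
qed

text \<open>Pointwise convergence of the difference quotients is the classical derivative.
  Domination comes from the mean value theorem along the line in direction \<open>e\<close> and from
  compact support; as it is available for sequences, the limit is taken along an arbitrary null
  sequence \<open>X\<close>.\<close>

lemma test_function_has_vector_derivative_0:
  assumes \<phi>: "\<phi> \<in> test_functions UNIV" and e: "e \<in> Basis"
  shows "((\<lambda>s. translate (s *\<^sub>R e) (abs_lsq \<phi>)) has_vector_derivative abs_lsq (dir_deriv e \<phi>)) (at 0)"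
proof -
  let ?d = "dir_deriv e \<phi>"
  have d: "?d \<in> test_functions UNIV" by (rule test_functions_dir_deriv[OF \<phi> e])
  have L2: "\<phi> \<in> L2" "?d \<in> L2" using \<phi> d by (auto intro: test_functions_L2)
  obtain K where K: "compact K" "K \<subseteq> UNIV" "{x. \<phi> x \<noteq> 0} \<subseteq> K"
    using \<phi> by (rule test_functions_compact_support)
  obtain K' where K': "compact K'" "K' \<subseteq> UNIV" "{x. ?d x \<noteq> 0} \<subseteq> K'"
    using d by (rule test_functions_compact_support)
  have "bounded (K \<union> K')" using K(1) K'(1) by (simp add: compact_imp_bounded)
  then obtain r where r: "\<And>x. x \<in> K \<union> K' \<Longrightarrow> norm x \<le> r"
    unfolding bounded_iff by blast
  have "bounded (?d ` K')"
    using K'(1) by (intro compact_imp_bounded compact_continuous_image smooth_continuous_on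
        test_functions_smooth[OF d])
  then obtain M0 where "\<And>x. x \<in> K' \<Longrightarrow> \<bar>?d x\<bar> \<le> M0"
    unfolding bounded_iff by auto
  then have M: "\<bar>?d x\<bar> \<le> max M0 0" for x
    using K'(3) by (cases "x \<in> K'") (force simp: le_max_iff_disj)+
  define M where "M = max M0 0"
  have M: "\<bar>?d x\<bar> \<le> M" "0 \<le> M" for x
    using M[of x] by (auto simp: M_def)
  have line: "((\<lambda>s. \<phi> (x + s *\<^sub>R e)) has_real_derivative ?d (x + s *\<^sub>R e)) (at s)" for x s
  proof -
    obtain f' where f': "(\<phi> has_derivative f') (at (x + s *\<^sub>R e))"
      using smooth_differentiable[OF test_functions_smooth[OF \<phi>]] by (auto simp: differentiable_def)
    have "((\<lambda>s. x + s *\<^sub>R e) has_derivative (\<lambda>h. h *\<^sub>R e)) (at s)"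
      by (auto intro!: derivative_eq_intros)
    from has_derivative_compose[OF this f']
    have "((\<lambda>s. \<phi> (x + s *\<^sub>R e)) has_derivative (\<lambda>h. f' (h *\<^sub>R e))) (at s)" .
    moreover have "(\<lambda>h. f' (h *\<^sub>R e)) = (*) (?d (x + s *\<^sub>R e))"
      using linear_scale[OF has_derivative_linear[OF f']] dir_deriv_eq[OF f', of e]
      by (auto simp: fun_eq_iff mult.commute)
    ultimately show ?thesis by (simp add: has_field_derivative_def)
  qed
  have lip: "\<bar>\<phi> (x + s *\<^sub>R e) - \<phi> x\<bar> \<le> M * \<bar>s\<bar>" for x s
    using field_differentiable_bound[of UNIV "\<lambda>s. \<phi> (x + s *\<^sub>R e)" "\<lambda>s. ?d (x + s *\<^sub>R e)" M s 0]
      line M by simp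
  have "((\<lambda>s. (translate (s *\<^sub>R e) (abs_lsq \<phi>) - abs_lsq \<phi>) /\<^sub>R s) \<longlongrightarrow> abs_lsq ?d) (at 0)"
    unfolding tendsto_at_iff_sequentially comp_def
  proof (intro allI impI)
    fix X :: "nat \<Rightarrow> real" assume X: "\<forall>i. X i \<in> UNIV - {0}" "X \<longlonglongrightarrow> 0"
    from X(2) have "Bseq X" by (simp add: convergentI convergent_imp_Bseq)
    then obtain R where R: "\<And>n. \<bar>X n\<bar> \<le> R" unfolding Bseq_def by auto
    let ?f = "\<lambda>n x. inverse (X n) * (\<phi> (x + X n *\<^sub>R e) - \<phi> x)"
    \<comment> \<open>\<open>r\<close> bounds the supports of \<phi> and its derivative,
      \<open>R\<close> the shifts \<open>X n\<close>: outside this ball all difference quotients and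
      the limit vanish.\<close>
    let ?B = "cball (0::'a) (r + R)"
    have fL2: "?f n \<in> L2" for n
      using L2 by (intro L2_cmult L2_diff L2_translate)
    have supp: "?f n x = 0 \<and> ?d x = 0" if "x \<notin> ?B" for n x
    proof -
      have "norm x > r + R" using that by auto
      moreover have "norm x \<le> norm (x + X n *\<^sub>R e) + \<bar>X n\<bar>"
        using norm_triangle_ineq4[of "x + X n *\<^sub>R e" "X n *\<^sub>R e"] e by simp
      ultimately have "norm (x + X n *\<^sub>R e) > r" using R[of n] by linarith
      moreover have "norm x > r" using \<open>norm x > r + R\<close> R[of 0] by linarith
      ultimately have "x + X n *\<^sub>R e \<notin> K \<union> K'" "x \<notin> K \<union> K'"
        using r by (meson not_less)+
      then have "\<phi> (x + X n *\<^sub>R e) = 0" "\<phi> x = 0" "?d x = 0" using K(3) K'(3) by auto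
      then show ?thesis by simp
    qed
    have "(\<lambda>n. abs_lsq (?f n)) \<longlonglongrightarrow> abs_lsq ?d"
    proof (rule abs_lsq_tendsto_dominated[OF fL2 L2(2)])
      have "indicator ?B \<in> L2"
        by (intro indicator_L2 emeasure_bounded_finite bounded_cball) simp
      then show "(\<lambda>x. 2 * M * indicator ?B x) \<in> L2"
        by (rule L2_cmult)
      show "AE x in lborel. (\<lambda>n. ?f n x) \<longlonglongrightarrow> ?d x"
      proof (rule AE_I2)
        fix x
        have "((\<lambda>s. (\<phi> (x + s *\<^sub>R e) - \<phi> x) / s) \<longlongrightarrow> ?d x) (at 0)"
          using line[of x 0] by (simp add: DERIV_def)
        then show "(\<lambda>n. ?f n x) \<longlonglongrightarrow> ?d x"
          using X unfolding tendsto_at_iff_sequentially comp_def by (simp add: divide_inverse mult.commute)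
      qed
      show "AE x in lborel. \<bar>?f n x - ?d x\<bar> \<le> 2 * M * indicator ?B x" for n
      proof (rule AE_I2)
        fix x
        have "\<bar>?f n x\<bar> = \<bar>\<phi> (x + X n *\<^sub>R e) - \<phi> x\<bar> / \<bar>X n\<bar>"
          by (simp add: abs_mult divide_inverse mult.commute)
        also have "\<dots> \<le> M"
          using lip[of x "X n"] X(1) by (simp add: divide_le_eq)
        finally have "\<bar>?f n x - ?d x\<bar> \<le> 2 * M" using M(1)[of x] by linarith
        then show "\<bar>?f n x - ?d x\<bar> \<le> 2 * M * indicator ?B x"
          using supp[of x n] by (cases "x \<in> ?B") auto
      qed
    qed
    moreover have "abs_lsq (?f n) = (translate (X n *\<^sub>R e) (abs_lsq \<phi>) - abs_lsq \<phi>) /\<^sub>R X n" for n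
      using L2 by (simp add: translate_abs_lsq abs_lsq_diff abs_lsq_scaleR L2_diff L2_translate)
    ultimately show "(\<lambda>n. (translate (X n *\<^sub>R e) (abs_lsq \<phi>) - abs_lsq \<phi>) /\<^sub>R X n) \<longlonglongrightarrow> abs_lsq ?d"
      by simp
  qed
  then show ?thesis
    by (simp add: has_vector_derivative_iff_quotient)
qed

text \<open>At 0 an \<epsilon>/3 argument extends continuity from test vectors, where it follows
  from differentiability, to all vectors, since translations are isometries. The group law carries
  it to any \<open>s\<close>.\<close>

lemma continuous_translate: "continuous (at s within S) (\<lambda>s. translate (s *\<^sub>R e) F)"
  if e: "e \<in> Basis" for e :: "'a::euclidean_space"
proof -
  have lim0: "((\<lambda>s. translate (s *\<^sub>R e) F) \<longlongrightarrow> F) (at 0)"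
  proof (rule tendstoI)
    fix \<epsilon> :: real assume "\<epsilon> > 0"
    then obtain G where G: "G \<in> test_vectors" "dist G F < \<epsilon> / 3"
      using test_vectors_dense closure_approachable[of F test_vectors]
      by (metis UNIV_I divide_pos_pos zero_less_numeral)
    then obtain \<phi> where \<phi>: "\<phi> \<in> test_functions UNIV" "G = abs_lsq \<phi>"
      by (auto simp: test_vectors_def)
    have "isCont (\<lambda>s. translate (s *\<^sub>R e) G) 0"
      using test_function_has_vector_derivative_0[OF \<phi>(1) e] \<phi>(2) by (auto intro: has_vector_derivative_continuous)
    then have "\<forall>\<^sub>F s in at 0. dist (translate (s *\<^sub>R e) G) G < \<epsilon> / 3"
      using \<open>\<epsilon> > 0\<close> by (auto simp: isCont_def dest: tendstoD[of _ _ _ "\<epsilon> / 3"])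
    then show "\<forall>\<^sub>F s in at 0. dist (translate (s *\<^sub>R e) F) F < \<epsilon>"
    proof eventually_elim
      case (elim s)
      have "dist (translate (s *\<^sub>R e) F) (translate (s *\<^sub>R e) G) = dist F G"
        by (simp add: dist_norm flip: translate_diff)
      then show ?case
        using elim G(2) dist_triangle[of "translate (s *\<^sub>R e) F" F "translate (s *\<^sub>R e) G"]
          dist_triangle[of "translate (s *\<^sub>R e) G" F G] by (simp add: dist_commute)
    qed
  qed
  have "((\<lambda>h. translate (s *\<^sub>R e) (translate (h *\<^sub>R e) F)) \<longlongrightarrow> translate (s *\<^sub>R e) F) (at 0)"
    by (rule bounded_linear.tendsto[OF bounded_linear_translate lim0])
  then have "isCont (\<lambda>s. translate (s *\<^sub>R e) F) s"
    by (simp add: isCont_iff translate_translate scaleR_left_distrib)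
  then show ?thesis by (rule continuous_at_imp_continuous_at_within)
qed

lemma test_function_has_vector_derivative:
  assumes \<phi>: "\<phi> \<in> test_functions UNIV" and e: "e \<in> Basis"
  shows "((\<lambda>s. translate (s *\<^sub>R e) (abs_lsq \<phi>)) has_vector_derivative
    translate (s *\<^sub>R e) (abs_lsq (dir_deriv e \<phi>))) (at s)"
proof -
  have "((\<lambda>h. translate (s *\<^sub>R e) (translate (h *\<^sub>R e) (abs_lsq \<phi>))) has_vector_derivative
    translate (s *\<^sub>R e) (abs_lsq (dir_deriv e \<phi>))) (at 0)"
    by (rule bounded_linear.has_vector_derivative[OF bounded_linear_translate
          test_function_has_vector_derivative_0[OF assms]])
  then have "((\<lambda>h. translate ((s + h) *\<^sub>R e) (abs_lsq \<phi>)) has_vector_derivative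
    translate (s *\<^sub>R e) (abs_lsq (dir_deriv e \<phi>))) (at 0)"
    by (simp add: translate_translate scaleR_left_distrib)
  then show ?thesis
    unfolding has_vector_derivative_iff_quotient
    by (subst LIM_offset_zero_iff) auto
qed

section \<open>Weak partial derivatives\<close>

text \<open>Direction \<open>e\<close> is required to be a basis vector within the relation, so that
  \<open>dir_deriv e \<phi>\<close> is again a test function and its class is meaningful.\<close>

definition weak_partial :: "'a::euclidean_space \<Rightarrow> 'a lsq \<Rightarrow> 'a lsq \<Rightarrow> bool" where
  "weak_partial e F G \<longleftrightarrow> e \<in> Basis \<and> (\<forall>\<phi>\<in>test_functions UNIV.
     inner F (abs_lsq (dir_deriv e \<phi>)) = - inner G (abs_lsq \<phi>))"

lemma weak_partial_unique: "weak_partial e F G \<Longrightarrow> weak_partial e F H \<Longrightarrow> G = H"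
  by (rule eq_of_test_vectors) (auto simp: weak_partial_def test_vectors_def)

lemma weak_partial_add: "weak_partial e F F' \<Longrightarrow> weak_partial e G G' \<Longrightarrow> weak_partial e (F + G) (F' + G')"
  by (auto simp: weak_partial_def inner_add_left)

lemma weak_partial_scaleR: "weak_partial e F F' \<Longrightarrow> weak_partial e (c *\<^sub>R F) (c *\<^sub>R F')"
  by (auto simp: weak_partial_def)

lemma weak_partial_zero: "e \<in> Basis \<Longrightarrow> weak_partial e 0 0"
  by (simp add: weak_partial_def)

lemma weak_partial_sum:
  "e \<in> Basis \<Longrightarrow> (\<And>i. i \<in> I \<Longrightarrow> weak_partial e (f i) (f' i)) \<Longrightarrow> weak_partial e (\<Sum>i\<in>I. f i) (\<Sum>i\<in>I. f' i)"
  by (induction I rule: infinite_finite_induct) (auto intro: weak_partial_zero weak_partial_add)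

lemma weak_partial_translate:
  assumes "weak_partial e F F'"
  shows "weak_partial e (translate h F) (translate h F')"
  unfolding weak_partial_def
proof (intro conjI ballI)
  show e: "e \<in> Basis" using assms by (simp add: weak_partial_def)
  fix \<phi> :: "'a \<Rightarrow> real" assume \<phi>: "\<phi> \<in> test_functions UNIV"
  let ?\<psi> = "\<lambda>x. \<phi> (x + - h)"
  have L2: "\<phi> \<in> L2" "dir_deriv e \<phi> \<in> L2"
    using \<phi> e by (auto intro: test_functions_L2 test_functions_dir_deriv)
  have "inner (translate h F) (abs_lsq (dir_deriv e \<phi>)) = inner F (abs_lsq (dir_deriv e ?\<psi>))"
    using L2 dir_deriv_translate[OF test_functions_smooth[OF \<phi>], of e "- h"]
    by (simp add: inner_translate_left translate_abs_lsq)
  also have "\<dots> = - inner F' (abs_lsq ?\<psi>)"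
    using assms test_functions_translate[OF \<phi>, of "- h"] by (simp add: weak_partial_def)
  also have "\<dots> = - inner (translate h F') (abs_lsq \<phi>)"
    using L2 by (simp add: inner_translate_left translate_abs_lsq)
  finally show "inner (translate h F) (abs_lsq (dir_deriv e \<phi>)) = - inner (translate h F') (abs_lsq \<phi>)" .
qed

section \<open>Weak derivatives as derivatives along translations\<close>

lemma has_real_derivative_inner_left:
  assumes "(f has_vector_derivative D) (at s within S)"
  shows "((\<lambda>s. inner (f s) G) has_real_derivative inner D G) (at s within S)"
  using bounded_linear.has_vector_derivative[OF bounded_linear_inner_left assms]
  by (simp add: has_real_derivative_iff_has_vector_derivative)

text \<open>The translation is moved onto \<phi>, where it acts as the inverse translation; the
  reversed parameter is the source of the minus sign.\<close>

lemma DERIV_inner_translate_test: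
  assumes "\<phi> \<in> test_functions UNIV" "e \<in> Basis"
  shows "((\<lambda>s. inner (translate (s *\<^sub>R e) F) (abs_lsq \<phi>)) has_real_derivative
    - inner (translate (s *\<^sub>R e) F) (abs_lsq (dir_deriv e \<phi>))) (at s)"
proof -
  have "((\<lambda>s. inner (translate ((- s) *\<^sub>R e) (abs_lsq \<phi>)) F) has_real_derivative
      inner (translate ((- s) *\<^sub>R e) (abs_lsq (dir_deriv e \<phi>))) F * (- 1)) (at s)"
    by (rule DERIV_chain2[where f = "\<lambda>s. inner (translate (s *\<^sub>R e) (abs_lsq \<phi>)) F" and g = uminus])
      (auto intro!: derivative_eq_intros has_real_derivative_inner_left
        test_function_has_vector_derivative[OF assms, of "- s", simplified])
  then show ?thesis
    by (simp add: inner_translate_left inner_commute[of F])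
qed

text \<open>A weakly differentiable vector lies in the domain of the generator of the translation
  group. Tested with \<phi> this is the definition of the weak derivative, and strong continuity of
  translations lifts it to the norm.\<close>

lemma translate_has_vector_derivative:
  assumes "weak_partial e F F'"
  shows "((\<lambda>s. translate (s *\<^sub>R e) F) has_vector_derivative translate (s *\<^sub>R e) F') (at s)"
proof (rule has_vector_derivative_weak[where S = UNIV])
  have e: "e \<in> Basis" using assms by (simp add: weak_partial_def)
  then show "continuous (at s) (\<lambda>s. translate (s *\<^sub>R e) F')"
    by (rule continuous_translate)
  fix t and \<phi>' :: "'a lsq" assume "\<phi>' \<in> test_vectors"
  then obtain \<phi> where \<phi>: "\<phi> \<in> test_functions UNIV" "\<phi>' = abs_lsq \<phi>"
    by (auto simp: test_vectors_def)
  show "((\<lambda>s. inner (translate (s *\<^sub>R e) F) \<phi>') has_real_derivative inner (translate (t *\<^sub>R e) F') \<phi>') (at t)"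
    using DERIV_inner_translate_test[OF \<phi>(1) e, of F t] weak_partial_translate[OF assms, of "t *\<^sub>R e"] \<phi>
    by (simp add: weak_partial_def)
qed auto

lemma DERIV_inner_translate:
  assumes "weak_partial e F F'"
  shows "((\<lambda>s. inner (translate (s *\<^sub>R e) F) G) has_real_derivative inner F' G) (at 0)"
  using has_real_derivative_inner_left[OF translate_has_vector_derivative[OF assms, of 0], of G] by simp

lemma DERIV_inner_translate':
  assumes "weak_partial e F F'"
  shows "((\<lambda>s. inner (translate (s *\<^sub>R e) G) F) has_real_derivative - inner G F') (at 0)"
proof -
  have "((\<lambda>s. inner (translate ((- s) *\<^sub>R e) F) G) has_real_derivative inner F' G * (- 1)) (at 0)"
    by (rule DERIV_chain2[where f = "\<lambda>s. inner (translate (s *\<^sub>R e) F) G" and g = uminus])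
      (use DERIV_inner_translate[OF assms, of G] in \<open>auto intro!: derivative_eq_intros\<close>)
  then show ?thesis
    by (simp add: inner_translate_left inner_commute[of G])
qed

text \<open>Both sides are the derivative at 0 of the pairing of the translate of \<open>F\<close>
  with \<open>G\<close>, computed by differentiating the translation on \<open>F\<close> or, after
  transposition, on \<open>G\<close>.\<close>

lemma weak_partial_by_parts:
  assumes "weak_partial e F F'" "weak_partial e G G'"
  shows "inner F' G = - inner F G'"
  using DERIV_unique[OF DERIV_inner_translate[OF assms(1), of G] DERIV_inner_translate'[OF assms(2), of F]] .

text \<open>Existence of the derivative of \<open>K\<close> is part of the conclusion. It comes from
  differentiating in s the identity (\<open>K\<close> translated, \<phi>) = - (\<open>F\<close>
  translated, derivative of \<phi> along \<open>e'\<close>), where the right side is differentiable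
  because \<open>F\<close> is.\<close>

lemma weak_partial_commute:
  assumes FG: "weak_partial e F G" and FK: "weak_partial e' F K" and GL: "weak_partial e' G L"
  shows "weak_partial e K L"
  unfolding weak_partial_def
proof (intro conjI ballI)
  show e: "e \<in> Basis" using FG by (simp add: weak_partial_def)
  fix \<phi> :: "'a \<Rightarrow> real" assume \<phi>: "\<phi> \<in> test_functions UNIV"
  let ?d = "abs_lsq (dir_deriv e' \<phi>)"
  have "inner (translate (s *\<^sub>R e) K) (abs_lsq \<phi>) = - inner (translate (s *\<^sub>R e) F) ?d" for s
    using weak_partial_translate[OF FK] \<phi> by (simp add: weak_partial_def)
  moreover have "((\<lambda>s. - inner (translate (s *\<^sub>R e) F) ?d) has_real_derivative - inner G ?d) (at 0)"
    by (intro DERIV_minus DERIV_inner_translate[OF FG])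
  ultimately have "((\<lambda>s. inner (translate (s *\<^sub>R e) K) (abs_lsq \<phi>)) has_real_derivative - inner G ?d) (at 0)"
    by simp
  from DERIV_unique[OF this DERIV_inner_translate_test[OF \<phi> e, of K 0]]
  have "inner K (abs_lsq (dir_deriv e \<phi>)) = inner G ?d" by simp
  then show "inner K (abs_lsq (dir_deriv e \<phi>)) = - inner L (abs_lsq \<phi>)"
    using GL \<phi> by (simp add: weak_partial_def)
qed

text \<open>Formally two integrations by parts, but they would require second derivatives of
  \<open>F\<close> or \<open>G\<close>. Translating \<open>F\<close> in direction \<open>e\<close>,
  integrating by parts in direction \<open>e'\<close> and differentiating in the parameter uses
  first derivatives only.\<close>

lemma weak_partial_exchange:
  assumes F1: "weak_partial e F F1" and F2: "weak_partial e' F F2"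
    and G1: "weak_partial e G G1" and G2: "weak_partial e' G G2"
  shows "inner F1 G2 = inner F2 G1"
proof -
  have "inner (translate (s *\<^sub>R e) F) G2 = - inner (translate (s *\<^sub>R e) F2) G" for s
    using weak_partial_by_parts[OF weak_partial_translate[OF F2, of "s *\<^sub>R e"] G2] by simp
  moreover have "((\<lambda>s. - inner (translate (s *\<^sub>R e) F2) G) has_real_derivative - (- inner F2 G1)) (at 0)"
    by (intro DERIV_minus DERIV_inner_translate'[OF G1])
  ultimately have "((\<lambda>s. inner (translate (s *\<^sub>R e) F) G2) has_real_derivative inner F2 G1) (at 0)"
    by simp
  from DERIV_unique[OF DERIV_inner_translate[OF F1, of G2] this] show ?thesis .
qed

section \<open>Difference quotients in space\<close>

definition diff_op :: "real \<Rightarrow> 'a \<Rightarrow> 'a::euclidean_space lsq \<Rightarrow> 'a lsq" where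
  "diff_op h e F = (translate (h *\<^sub>R e) F - F) /\<^sub>R h"

lemma diff_op_tendsto:
  assumes "weak_partial e F F'"
  shows "((\<lambda>h. diff_op h e F) \<longlongrightarrow> F') (at 0)"
  using translate_has_vector_derivative[OF assms, of 0]
  unfolding has_vector_derivative_iff_quotient diff_op_def by simp

text \<open>Mean value inequality along the curve of translates, whose velocity has constant norm
  |F'| since translations are isometries.\<close>

lemma norm_diff_op_le:
  assumes "weak_partial e F F'"
  shows "norm (diff_op h e F) \<le> norm F'"
proof -
  have "norm (translate (h *\<^sub>R e) F - translate (0 *\<^sub>R e) F) \<le> norm F' * norm (h - 0)"
  proof (rule differentiable_bound[where S = UNIV and f' = "\<lambda>s h. h *\<^sub>R translate (s *\<^sub>R e) F'"])
    show "((\<lambda>s. translate (s *\<^sub>R e) F) has_derivative (\<lambda>h. h *\<^sub>R translate (s *\<^sub>R e) F')) (at s)" for s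
      using translate_has_vector_derivative[OF assms] by (simp add: has_vector_derivative_def)
    show "onorm (\<lambda>h. h *\<^sub>R translate (s *\<^sub>R e) F') \<le> norm F'" for s :: real
      by (rule onorm_le) (simp add: mult.commute)
  qed auto
  then show ?thesis
    \<comment> \<open>For \<open>h = 0\<close> the quotient is 0, by the convention
      \<open>inverse 0 = 0\<close>.\<close>
    by (cases "h = 0") (auto simp: diff_op_def divide_simps inverse_eq_divide)
qed

lemma bounded_linear_diff_op: "bounded_linear (diff_op h e)"
  unfolding diff_op_def
  by (intro bounded_linear_const_scaleR bounded_linear_sub bounded_linear_translate bounded_linear_ident)

lemma weak_partial_diff_op: "weak_partial e' F F' \<Longrightarrow> weak_partial e' (diff_op h e F) (diff_op h e F')"
  unfolding diff_op_def
  using weak_partial_scaleR[OF weak_partial_add[OF weak_partial_translate weak_partial_scaleR[where c = "-1"]]]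
  by simp

section \<open>Sobolev spaces inside the Hilbert space\<close>

text \<open>The recursion peels off one derivative at a time, in step with
  \<open>nabla_form\<close>, and supports induction on the order. Agreement with the multi-index
  definition is shown in \<open>sobolev_iff\<close>.\<close>

fun Sob :: "nat \<Rightarrow> 'a::euclidean_space lsq set" where
  "Sob 0 = UNIV"
| "Sob (Suc m) = {F. \<forall>e\<in>Basis. \<exists>G\<in>Sob m. weak_partial e F G}"

text \<open>\<open>pd e F\<close> is arbitrary unless \<open>F\<close> has a square integrable weak derivative, e.g. \<open>F \<in> Sob (Suc m)\<close>.\<close>

definition pd :: "'a::euclidean_space \<Rightarrow> 'a lsq \<Rightarrow> 'a lsq" where
  "pd e F = (THE G. weak_partial e F G)"

definition lap :: "'a::euclidean_space lsq \<Rightarrow> 'a lsq" where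
  "lap F = (\<Sum>e\<in>Basis. pd e (pd e F))"

text \<open>This is the integrated product of the full tensors of derivatives of order j, summed
  over all ordered j-tuples of directions. Unlike powers of the Laplacian it treats even and odd
  orders alike; \<open>nabla_form_lap_lap\<close> shows that the two agree.\<close>

fun nabla_form :: "nat \<Rightarrow> 'a::euclidean_space lsq \<Rightarrow> 'a lsq \<Rightarrow> real" where
  "nabla_form 0 F G = inner F G"
| "nabla_form (Suc j) F G = (\<Sum>e\<in>Basis. nabla_form j (pd e F) (pd e G))"

lemma pd_eqI: "weak_partial e F G \<Longrightarrow> pd e F = G"
  unfolding pd_def by (rule the_equality) (auto intro: weak_partial_unique)

lemma
  assumes "F \<in> Sob (Suc m)" "e \<in> Basis"
  shows weak_partial_pd: "weak_partial e F (pd e F)" and pd_Sob: "pd e F \<in> Sob m"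
proof -
  obtain G where "G \<in> Sob m" "weak_partial e F G" using assms by auto
  then show "weak_partial e F (pd e F)" "pd e F \<in> Sob m" using pd_eqI by auto
qed

lemma Sob_Suc_iff: "F \<in> Sob (Suc m) \<longleftrightarrow> (\<forall>e\<in>Basis. weak_partial e F (pd e F) \<and> pd e F \<in> Sob m)"
  using weak_partial_pd[of F m] pd_Sob[of F m] by auto

lemma Sob_SucD: "F \<in> Sob (Suc m) \<Longrightarrow> F \<in> Sob m"
proof (induction m arbitrary: F)
  case (Suc m)
  then show ?case by (subst (asm) Sob_Suc_iff, subst Sob_Suc_iff) blast
qed simp

lemma Sob_mono: "F \<in> Sob n \<Longrightarrow> m \<le> n \<Longrightarrow> F \<in> Sob m"
  by (induction n) (metis le_Suc_eq Sob_SucD le_zero_eq)+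

lemma Sob_add: "F \<in> Sob m \<Longrightarrow> G \<in> Sob m \<Longrightarrow> F + G \<in> Sob m"
proof (induction m arbitrary: F G)
  case (Suc m)
  show ?case
    unfolding Sob.simps(2)
  proof (intro CollectI ballI bexI)
    fix e :: 'a assume "e \<in> Basis"
    then show "weak_partial e (F + G) (pd e F + pd e G)" "pd e F + pd e G \<in> Sob m"
      using Suc by (auto intro!: weak_partial_add weak_partial_pd pd_Sob simp del: Sob.simps)
  qed
qed simp

lemma Sob_scaleR: "F \<in> Sob m \<Longrightarrow> c *\<^sub>R F \<in> Sob m"
proof (induction m arbitrary: F)
  case (Suc m)
  show ?case
    unfolding Sob.simps(2)
  proof (intro CollectI ballI bexI)
    fix e :: 'a assume "e \<in> Basis"
    then show "weak_partial e (c *\<^sub>R F) (c *\<^sub>R pd e F)" "c *\<^sub>R pd e F \<in> Sob m"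
      using Suc by (auto intro!: weak_partial_scaleR weak_partial_pd pd_Sob simp del: Sob.simps)
  qed
qed simp

lemma Sob_0: "0 \<in> Sob m"
proof (induction m)
  case (Suc m)
  then show ?case by (auto intro!: bexI[of _ 0] weak_partial_zero)
qed simp

lemma Sob_sum: "(\<And>i. i \<in> I \<Longrightarrow> f i \<in> Sob m) \<Longrightarrow> (\<Sum>i\<in>I. f i) \<in> Sob m"
  by (induction I rule: infinite_finite_induct) (auto intro: Sob_0 Sob_add)

lemma Sob_diff_op: "F \<in> Sob m \<Longrightarrow> diff_op h e F \<in> Sob m"
proof (induction m arbitrary: F)
  case (Suc m)
  show ?case
    unfolding Sob.simps(2)
  proof (intro CollectI ballI bexI)
    fix e' :: 'a assume "e' \<in> Basis"
    then show "weak_partial e' (diff_op h e F) (diff_op h e (pd e' F))" "diff_op h e (pd e' F) \<in> Sob m"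
      using Suc by (auto intro!: weak_partial_diff_op weak_partial_pd pd_Sob simp del: Sob.simps)
  qed
qed simp

lemma pd_add: "F \<in> Sob (Suc m) \<Longrightarrow> G \<in> Sob (Suc m) \<Longrightarrow> e \<in> Basis \<Longrightarrow> pd e (F + G) = pd e F + pd e G"
  by (intro pd_eqI weak_partial_add weak_partial_pd)

lemma pd_scaleR: "F \<in> Sob (Suc m) \<Longrightarrow> e \<in> Basis \<Longrightarrow> pd e (c *\<^sub>R F) = c *\<^sub>R pd e F"
  by (intro pd_eqI weak_partial_scaleR weak_partial_pd)

lemma pd_sum:
  "(\<And>i. i \<in> I \<Longrightarrow> f i \<in> Sob (Suc m)) \<Longrightarrow> e \<in> Basis \<Longrightarrow> pd e (\<Sum>i\<in>I. f i) = (\<Sum>i\<in>I. pd e (f i))"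
  by (intro pd_eqI weak_partial_sum weak_partial_pd)

lemma pd_diff_op: "F \<in> Sob (Suc m) \<Longrightarrow> e' \<in> Basis \<Longrightarrow> pd e' (diff_op h e F) = diff_op h e (pd e' F)"
  by (intro pd_eqI weak_partial_diff_op weak_partial_pd)

lemma pd_commute:
  assumes "F \<in> Sob (Suc (Suc m))" "e \<in> Basis" "e' \<in> Basis"
  shows "pd e (pd e' F) = pd e' (pd e F)"
proof (rule pd_eqI, rule weak_partial_commute)
  show "weak_partial e F (pd e F)" "weak_partial e' F (pd e' F)"
    "weak_partial e' (pd e F) (pd e' (pd e F))"
    using assms pd_Sob[OF assms(1)] by (auto intro!: weak_partial_pd simp del: Sob.simps)
qed

lemma lap_Sob: "F \<in> Sob (Suc (Suc m)) \<Longrightarrow> lap F \<in> Sob m"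
  unfolding lap_def by (intro Sob_sum pd_Sob)

lemma pd_lap:
  assumes "F \<in> Sob (Suc (Suc (Suc m)))" "e \<in> Basis"
  shows "pd e (lap F) = lap (pd e F)"
proof -
  have "pd e (lap F) = (\<Sum>d\<in>Basis. pd e (pd d (pd d F)))"
    unfolding lap_def using assms by (intro pd_sum pd_Sob)
  also have "\<dots> = (\<Sum>d\<in>Basis. pd d (pd d (pd e F)))"
    using assms pd_commute[OF assms(1)] pd_commute[OF pd_Sob[OF assms(1)]]
    by (intro sum.cong) auto
  finally show ?thesis by (simp add: lap_def)
qed

section \<open>The forms of order j and the Laplacian\<close>

lemma nabla_form_commute: "nabla_form j F G = nabla_form j G F"
  by (induction j arbitrary: F G) (simp_all add: inner_commute)

lemma nabla_form_nonneg: "0 \<le> nabla_form j F F"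
  by (induction j arbitrary: F) (auto intro: sum_nonneg)

lemma nabla_form_add_left:
  "F \<in> Sob j \<Longrightarrow> G \<in> Sob j \<Longrightarrow> nabla_form j (F + G) H = nabla_form j F H + nabla_form j G H"
  by (induction j arbitrary: F G H)
    (auto simp: inner_add_left pd_add pd_Sob sum.distrib simp del: Sob.simps)

lemma nabla_form_scaleR_left:
  "F \<in> Sob j \<Longrightarrow> nabla_form j (c *\<^sub>R F) H = c * nabla_form j F H"
  by (induction j arbitrary: F H) (auto simp: pd_scaleR pd_Sob sum_distrib_left simp del: Sob.simps)

lemma nabla_form_add_right:
  "F \<in> Sob j \<Longrightarrow> G \<in> Sob j \<Longrightarrow> nabla_form j H (F + G) = nabla_form j H F + nabla_form j H G"
  using nabla_form_add_left[of F j G H] by (simp add: nabla_form_commute[of j H])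

lemma nabla_form_scaleR_right:
  "F \<in> Sob j \<Longrightarrow> nabla_form j H (c *\<^sub>R F) = c * nabla_form j H F"
  using nabla_form_scaleR_left[of F j c H] by (simp add: nabla_form_commute[of j H])

text \<open>Positivity of the form at F + G and F - G.\<close>

lemma nabla_form_bound:
  assumes "F \<in> Sob j" "G \<in> Sob j"
  shows "\<bar>nabla_form j F G\<bar> \<le> (nabla_form j F F + nabla_form j G G) / 2"
proof -
  have "0 \<le> nabla_form j (F + c *\<^sub>R G) (F + c *\<^sub>R G)" for c
    by (rule nabla_form_nonneg)
  then have "0 \<le> nabla_form j F F + 2 * c * nabla_form j F G + c\<^sup>2 * nabla_form j G G" for c
    using assms by (simp add: nabla_form_add_left nabla_form_add_right nabla_form_scaleR_left
        nabla_form_scaleR_right Sob_add Sob_scaleR nabla_form_commute[of j G F] algebra_simps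
        power2_eq_square)
  from this[of 1] this[of "-1"] show ?thesis by simp
qed

text \<open>Integration by parts, lifted to order j because the Laplacian commutes with partial
  derivatives. The regularity is asymmetric on purpose: at the top order G is the solution and F its
  time derivative, which has one space derivative less.\<close>

lemma nabla_form_lap:
  "F \<in> Sob (Suc j) \<Longrightarrow> G \<in> Sob (Suc (Suc j)) \<Longrightarrow> nabla_form j F (lap G) = - nabla_form (Suc j) F G"
proof (induction j arbitrary: F G)
  case 0
  have "inner F (pd e (pd e G)) = - inner (pd e F) (pd e G)" if "e \<in> Basis" for e
    using weak_partial_by_parts[OF weak_partial_pd[OF 0(1) that] weak_partial_pd[OF pd_Sob[OF 0(2) that] that]]
    by simp
  then show ?case
    by (simp add: lap_def inner_sum_right sum_negf)
next
  case (Suc j)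
  have "nabla_form j (pd e F) (pd e (lap G)) = - nabla_form (Suc j) (pd e F) (pd e G)" if "e \<in> Basis" for e
    using Suc.IH[OF pd_Sob[OF Suc.prems(1) that] pd_Sob[OF Suc.prems(2) that]]
      pd_lap[OF Suc.prems(2) that] by simp
  then show ?case by (simp add: sum_negf)
qed

lemma nabla_form_lap_lap:
  "F \<in> Sob (Suc (Suc j)) \<Longrightarrow> G \<in> Sob (Suc (Suc j)) \<Longrightarrow>
    nabla_form j (lap F) (lap G) = nabla_form (Suc (Suc j)) F G"
proof (induction j arbitrary: F G)
  case 0
  have "inner (pd e (pd e F)) (pd e' (pd e' G)) = inner (pd e' (pd e F)) (pd e' (pd e G))"
    if "e \<in> Basis" "e' \<in> Basis" for e e'
  proof -
    have "inner (pd e (pd e F)) (pd e' (pd e' G)) = inner (pd e' (pd e F)) (pd e (pd e' G))"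
      using 0 that pd_Sob[OF 0(1)] pd_Sob[OF 0(2)]
      by (intro weak_partial_exchange) (auto intro!: weak_partial_pd simp del: Sob.simps)
    then show ?thesis using pd_commute[OF 0(2) that] by simp
  qed
  then show ?case
    by (simp add: lap_def inner_sum_right inner_sum_left) (rule sum.swap)
next
  case (Suc j)
  have "nabla_form j (pd e (lap F)) (pd e (lap G)) = nabla_form (Suc (Suc j)) (pd e F) (pd e G)"
    if "e \<in> Basis" for e
    using Suc.IH[OF pd_Sob[OF Suc.prems(1) that] pd_Sob[OF Suc.prems(2) that]]
      pd_lap[OF Suc.prems(1) that] pd_lap[OF Suc.prems(2) that] by simp
  then show ?case by simp
qed

text \<open>Difference quotients commute with weak derivatives, so the estimate reduces to order 0,
  the norm bound of \<open>norm_diff_op_le\<close>.\<close>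

lemma nabla_form_diff_op_le:
  "F \<in> Sob (Suc j) \<Longrightarrow> e \<in> Basis \<Longrightarrow>
    nabla_form j (diff_op h e F) (diff_op h e F) \<le> nabla_form j (pd e F) (pd e F)"
proof (induction j arbitrary: F)
  case 0
  then show ?case
    using norm_diff_op_le[OF weak_partial_pd[OF 0], of h]
    by (simp add: power_mono flip: power2_norm_eq_inner)
next
  case (Suc j)
  show ?case
    unfolding nabla_form.simps
  proof (rule sum_mono)
    fix d :: 'a assume d: "d \<in> Basis"
    show "nabla_form j (pd d (diff_op h e F)) (pd d (diff_op h e F)) \<le>
        nabla_form j (pd d (pd e F)) (pd d (pd e F))"
      using Suc.IH[OF pd_Sob[OF Suc.prems(1) d] Suc.prems(2)] pd_diff_op[OF Suc.prems(1) d]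
        pd_commute[OF Suc.prems(1) d Suc.prems(2)] by simp
  qed
qed

lemma nabla_form_diff_op_tendsto:
  "F \<in> Sob (Suc j) \<Longrightarrow> G \<in> Sob (Suc j) \<Longrightarrow> e \<in> Basis \<Longrightarrow>
    ((\<lambda>h. nabla_form j (diff_op h e F) (diff_op h e G)) \<longlongrightarrow> nabla_form j (pd e F) (pd e G)) (at 0)"
proof (induction j arbitrary: F G)
  case 0
  then show ?case
    by (auto intro!: tendsto_inner diff_op_tendsto weak_partial_pd simp del: Sob.simps)
next
  case (Suc j)
  show ?case
    unfolding nabla_form.simps
  proof (rule tendsto_sum)
    fix d :: 'a assume d: "d \<in> Basis"
    show "((\<lambda>h. nabla_form j (pd d (diff_op h e F)) (pd d (diff_op h e G))) \<longlongrightarrow>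
        nabla_form j (pd d (pd e F)) (pd d (pd e G))) (at 0)"
      using Suc.IH[OF pd_Sob[OF Suc.prems(1) d] pd_Sob[OF Suc.prems(2) d] Suc.prems(3)]
        pd_diff_op[OF Suc.prems(1) d] pd_diff_op[OF Suc.prems(2) d]
        pd_commute[OF Suc.prems(1) d Suc.prems(3)] pd_commute[OF Suc.prems(2) d Suc.prems(3)] by simp
  qed
qed

section \<open>Curves in Sobolev spaces\<close>

text \<open>Continuity with values in H^m is expressed by continuity in L^2 of all space derivatives
  up to order m, so that no topology on \<open>Sob m\<close> has to be introduced;
  \<open>Sob_deriv_on\<close> does the same for derivatives in time.\<close>

fun Sob_continuous_on :: "real set \<Rightarrow> nat \<Rightarrow> (real \<Rightarrow> 'a::euclidean_space lsq) \<Rightarrow> bool" where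
  "Sob_continuous_on S 0 V \<longleftrightarrow> continuous_on S V"
| "Sob_continuous_on S (Suc m) V \<longleftrightarrow> continuous_on S V \<and> (\<forall>t\<in>S. V t \<in> Sob (Suc m)) \<and>
     (\<forall>e\<in>Basis. Sob_continuous_on S m (\<lambda>t. pd e (V t)))"

fun Sob_deriv_on :: "real set \<Rightarrow> nat \<Rightarrow> (real \<Rightarrow> 'a::euclidean_space lsq) \<Rightarrow> (real \<Rightarrow> 'a lsq) \<Rightarrow> bool" where
  "Sob_deriv_on S 0 V W \<longleftrightarrow> (\<forall>t\<in>S. (V has_vector_derivative W t) (at t within S))"
| "Sob_deriv_on S (Suc m) V W \<longleftrightarrow> (\<forall>t\<in>S. (V has_vector_derivative W t) (at t within S)) \<and>
     (\<forall>t\<in>S. V t \<in> Sob (Suc m) \<and> W t \<in> Sob (Suc m)) \<and>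
     (\<forall>e\<in>Basis. Sob_deriv_on S m (\<lambda>t. pd e (V t)) (\<lambda>t. pd e (W t)))"

lemma Sob_continuous_on_imp: "Sob_continuous_on S m V \<Longrightarrow> continuous_on S V"
  "Sob_continuous_on S m V \<Longrightarrow> t \<in> S \<Longrightarrow> V t \<in> Sob m"
  by (cases m; auto simp del: Sob.simps(2))+

lemma Sob_deriv_on_imp: "Sob_deriv_on S m V W \<Longrightarrow> Sob_deriv_on S 0 V W"
  "Sob_deriv_on S m V W \<Longrightarrow> t \<in> S \<Longrightarrow> V t \<in> Sob m"
  "Sob_deriv_on S m V W \<Longrightarrow> t \<in> S \<Longrightarrow> W t \<in> Sob m"
  by (cases m; auto simp del: Sob.simps(2))+

lemma Sob_continuous_on_SucD: "Sob_continuous_on S (Suc m) V \<Longrightarrow> Sob_continuous_on S m V"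
  by (induction m arbitrary: V) (auto intro: Sob_SucD simp del: Sob.simps)

lemma Sob_continuous_on_mono: "Sob_continuous_on S n V \<Longrightarrow> m \<le> n \<Longrightarrow> Sob_continuous_on S m V"
  by (induction n) (metis le_Suc_eq Sob_continuous_on_SucD le_zero_eq)+

lemma Sob_deriv_on_SucD: "Sob_deriv_on S (Suc m) V W \<Longrightarrow> Sob_deriv_on S m V W"
  by (induction m arbitrary: V W) (auto intro: Sob_SucD simp del: Sob.simps)

lemma Sob_deriv_on_mono: "Sob_deriv_on S n V W \<Longrightarrow> m \<le> n \<Longrightarrow> Sob_deriv_on S m V W"
  by (induction n) (metis le_Suc_eq Sob_deriv_on_SucD le_zero_eq)+

text \<open>A derivative known only in L^2 is automatically one in H^m when it is continuous into
  H^m. Paired with a test function, a space derivative moves onto that function and commutes with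
  the time derivative; continuity then gives the strong statement.\<close>

lemma Sob_deriv_onI:
  fixes V W :: "real \<Rightarrow> 'a::euclidean_space lsq"
  assumes "convex S"
  shows "Sob_deriv_on S 0 V W \<Longrightarrow> Sob_continuous_on S m W \<Longrightarrow> (\<And>t. t \<in> S \<Longrightarrow> V t \<in> Sob m) \<Longrightarrow>
    Sob_deriv_on S m V W"
proof (induction m arbitrary: V W)
  case (Suc m)
  have "Sob_deriv_on S 0 (\<lambda>t. pd e (V t)) (\<lambda>t. pd e (W t))" if e: "e \<in> Basis" for e
    unfolding Sob_deriv_on.simps
  proof
    fix t assume t: "t \<in> S"
    show "((\<lambda>t. pd e (V t)) has_vector_derivative pd e (W t)) (at t within S)"
    proof (rule has_vector_derivative_weak[OF assms t])
      have "continuous_on S (\<lambda>t. pd e (W t))"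
        using Suc.prems(2) e Sob_continuous_on_imp(1)[of S m "\<lambda>t. pd e (W t)"] by simp
      then show "continuous (at t within S) (\<lambda>t. pd e (W t))"
        using t continuous_on_eq_continuous_within by blast
      fix s and \<phi> :: "'a lsq" assume s: "s \<in> S" and "\<phi> \<in> test_vectors"
      then obtain f where f: "f \<in> test_functions UNIV" "\<phi> = abs_lsq f"
        by (auto simp: test_vectors_def)
      have by_parts: "inner (pd e F) \<phi> = - inner F (abs_lsq (dir_deriv e f))" if "F \<in> Sob (Suc m)" for F
        using weak_partial_pd[OF that e] f by (simp add: weak_partial_def)
      have "((\<lambda>s. - inner (V s) (abs_lsq (dir_deriv e f))) has_real_derivative
          - inner (W s) (abs_lsq (dir_deriv e f))) (at s within S)"
        using Suc.prems(1) s by (intro DERIV_minus has_real_derivative_inner_left) auto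
      then have "((\<lambda>s. inner (pd e (V s)) \<phi>) has_real_derivative
          - inner (W s) (abs_lsq (dir_deriv e f))) (at s within S)"
        unfolding has_real_derivative_iff_has_vector_derivative
        by (rule has_vector_derivative_transform[OF s, rotated]) (use by_parts[OF Suc.prems(3)] in simp)
      then show "((\<lambda>s. inner (pd e (V s)) \<phi>) has_real_derivative inner (pd e (W s)) \<phi>) (at s within S)"
        using by_parts[of "W s"] Sob_continuous_on_imp(2)[OF Suc.prems(2) s] by simp
    qed
  qed
  then show ?case
    using Suc Sob_continuous_on_imp(2)[OF Suc.prems(2)] pd_Sob[OF Suc.prems(3)]
    by (simp del: Sob.simps Sob_deriv_on.simps(1)) auto
qed simp

lemma nabla_form_has_derivative:
  "Sob_deriv_on S j V V' \<Longrightarrow> Sob_deriv_on S j W W' \<Longrightarrow> t \<in> S \<Longrightarrow>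
    ((\<lambda>s. nabla_form j (V s) (W s)) has_real_derivative
      nabla_form j (V t) (W' t) + nabla_form j (V' t) (W t)) (at t within S)"
proof (induction j arbitrary: V V' W W')
  case 0
  then have "(V has_vector_derivative V' t) (at t within S)" "(W has_vector_derivative W' t) (at t within S)"
    by auto
  from bounded_bilinear.has_vector_derivative[OF bounded_bilinear_inner this]
  show ?case by (simp add: has_real_derivative_iff_has_vector_derivative)
next
  case (Suc j)
  have "((\<lambda>s. \<Sum>e\<in>Basis. nabla_form j (pd e (V s)) (pd e (W s))) has_real_derivative
      (\<Sum>e\<in>Basis. nabla_form j (pd e (V t)) (pd e (W' t)) + nabla_form j (pd e (V' t)) (pd e (W t))))
      (at t within S)"
    using Suc by (intro DERIV_sum Suc.IH) auto
  then show ?case by (simp add: sum.distrib)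
qed

lemma nabla_form_continuous_on:
  "Sob_continuous_on S j V \<Longrightarrow> Sob_continuous_on S j W \<Longrightarrow> continuous_on S (\<lambda>s. nabla_form j (V s) (W s))"
  by (induction j arbitrary: V W) (auto intro!: continuous_intros)

lemma Sob_deriv_on_0_cong:
  assumes "\<And>t. t \<in> S \<Longrightarrow> V t = V' t" "\<And>t. t \<in> S \<Longrightarrow> W t = W' t" "Sob_deriv_on S 0 V W"
  shows "Sob_deriv_on S 0 V' W'"
  unfolding Sob_deriv_on.simps
proof
  fix t assume t: "t \<in> S"
  have "(V has_vector_derivative W t) (at t within S)" using assms(3) t by simp
  then have "(V' has_vector_derivative W t) (at t within S)"
    by (rule has_vector_derivative_transform[OF t, rotated]) (simp add: assms(1))
  then show "(V' has_vector_derivative W' t) (at t within S)"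
    by (simp only: assms(2)[OF t])
qed

lemma Sob_deriv_on_cong:
  "(\<And>t. t \<in> S \<Longrightarrow> V t = V' t) \<Longrightarrow> (\<And>t. t \<in> S \<Longrightarrow> W t = W' t) \<Longrightarrow> Sob_deriv_on S m V W \<Longrightarrow> Sob_deriv_on S m V' W'"
proof (induction m arbitrary: V V' W W')
  case 0
  then show ?case by (rule Sob_deriv_on_0_cong)
next
  case (Suc m)
  have "Sob_deriv_on S m (\<lambda>t. pd e (V' t)) (\<lambda>t. pd e (W' t))" if "e \<in> Basis" for e
  proof (rule Suc.IH)
    show "Sob_deriv_on S m (\<lambda>t. pd e (V t)) (\<lambda>t. pd e (W t))" using Suc.prems(3) that by simp
  qed (simp_all add: Suc.prems(1,2))
  moreover have "Sob_deriv_on S 0 V' W'"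
    using Suc.prems(1-2) Sob_deriv_on_imp(1)[OF Suc.prems(3)] by (rule Sob_deriv_on_0_cong)
  moreover have "V' t \<in> Sob (Suc m) \<and> W' t \<in> Sob (Suc m)" if t: "t \<in> S" for t
    using Suc.prems(3) t unfolding Sob_deriv_on.simps Suc.prems(1,2)[OF t, symmetric] by blast
  ultimately show ?case by (simp del: Sob.simps)
qed

lemma Sob_deriv_on_diff_op:
  "Sob_deriv_on S m V W \<Longrightarrow> Sob_deriv_on S m (\<lambda>t. diff_op h e (V t)) (\<lambda>t. diff_op h e (W t))"
proof (induction m arbitrary: V W)
  case 0
  then show ?case
    by (auto intro: bounded_linear.has_vector_derivative[OF bounded_linear_diff_op])
next
  case (Suc m)
  have "Sob_deriv_on S m (\<lambda>t. pd d (diff_op h e (V t))) (\<lambda>t. pd d (diff_op h e (W t)))"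
    if "d \<in> Basis" for d
  proof (rule Sob_deriv_on_cong)
    show "Sob_deriv_on S m (\<lambda>t. diff_op h e (pd d (V t))) (\<lambda>t. diff_op h e (pd d (W t)))"
      using Suc.prems that by (intro Suc.IH) auto
  qed (use Suc.prems that in \<open>auto simp: pd_diff_op simp del: Sob.simps\<close>)
  moreover have "\<forall>t\<in>S. ((\<lambda>t. diff_op h e (V t)) has_vector_derivative diff_op h e (W t)) (at t within S)"
    using Suc.prems by (auto intro: bounded_linear.has_vector_derivative[OF bounded_linear_diff_op])
  ultimately show ?case using Suc.prems by (auto intro: Sob_diff_op simp del: Sob.simps)
qed

lemma lap_diff_op: "F \<in> Sob (Suc (Suc m)) \<Longrightarrow> lap (diff_op h e F) = diff_op h e (lap F)"
proof -
  assume F: "F \<in> Sob (Suc (Suc m))"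
  interpret bounded_linear "diff_op h e" by (rule bounded_linear_diff_op)
  have "pd d (pd d (diff_op h e F)) = diff_op h e (pd d (pd d F))" if "d \<in> Basis" for d
    using pd_diff_op[OF F that] pd_diff_op[OF pd_Sob[OF F that] that] by simp
  then show ?thesis by (simp add: lap_def sum)
qed

section \<open>Function representatives\<close>

text \<open>The head of the list acts first here and last in \<open>partials\<close>. This is the
  order in which derivatives leave the test function: the outermost one is integrated by parts
  first.\<close>

fun pds :: "'a::euclidean_space list \<Rightarrow> 'a lsq \<Rightarrow> 'a lsq" where
  "pds [] F = F"
| "pds (e # es) F = pds es (pd e F)"

lemma inner_partials:
  assumes "\<phi> \<in> test_functions UNIV"
  shows "set es \<subseteq> Basis \<Longrightarrow> F \<in> Sob (length es) \<Longrightarrow>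
    inner F (abs_lsq (partials es \<phi>)) = (-1) ^ length es * inner (pds es F) (abs_lsq \<phi>)"
proof (induction es arbitrary: F)
  case (Cons e es)
  then have e: "e \<in> Basis" "set es \<subseteq> Basis" and F: "F \<in> Sob (Suc (length es))" by simp_all
  have "inner F (abs_lsq (partials (e # es) \<phi>)) = - inner (pd e F) (abs_lsq (partials es \<phi>))"
    using weak_partial_pd[OF F e(1)] test_functions_partials[OF assms e(2)]
    by (simp add: weak_partial_def partials_Cons)
  then show ?case using Cons.IH[OF e(2) pd_Sob[OF F e(1)]] by simp
qed simp

lemma has_weak_deriv_iff_inner:
  assumes "f \<in> L2" "g \<in> L2" "set es \<subseteq> Basis"
  shows "has_weak_deriv es f g \<longleftrightarrow> (\<forall>\<phi>\<in>test_functions UNIV.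
    inner (abs_lsq f) (abs_lsq (partials es \<phi>)) = (-1) ^ length es * inner (abs_lsq g) (abs_lsq \<phi>))"
  unfolding has_weak_deriv_def
  by (intro ball_cong refl) (simp add: inner_abs_lsq assms test_functions_L2[of _ UNIV] test_functions_partials)

lemma has_weak_deriv_iff_weak_partial:
  assumes "f \<in> L2" "g \<in> L2" "e \<in> Basis"
  shows "has_weak_deriv [e] f g \<longleftrightarrow> weak_partial e (abs_lsq f) (abs_lsq g)"
  using assms by (simp add: has_weak_deriv_iff_inner weak_partial_def partials_Cons)

lemma has_weak_deriv_unique:
  assumes "f \<in> L2" "g \<in> L2" "h \<in> L2" "set es \<subseteq> Basis" "has_weak_deriv es f g" "has_weak_deriv es f h"
  shows "abs_lsq g = abs_lsq h"
proof (rule eq_of_test_vectors)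
  fix \<phi> :: "'a lsq" assume "\<phi> \<in> test_vectors"
  then show "inner (abs_lsq g) \<phi> = inner (abs_lsq h) \<phi>"
    using assms by (auto simp: has_weak_deriv_iff_inner test_vectors_def)
qed

lemma sobolev_L2: "f \<in> sobolev m \<Longrightarrow> f \<in> L2"
  by (simp add: sobolev_def)

lemma abs_lsq_sobolev: "f \<in> sobolev m \<Longrightarrow> abs_lsq f \<in> Sob m"
proof (induction m arbitrary: f)
  case (Suc m)
  have fL2: "f \<in> L2" by (rule sobolev_L2[OF Suc.prems])
  show ?case
    unfolding Sob.simps
  proof (intro CollectI ballI)
    fix e :: 'a assume e: "e \<in> Basis"
    obtain g where g: "g \<in> L2" "has_weak_deriv [e] f g"
      using Suc.prems e by (auto simp: sobolev_def dest!: spec[of _ "[e]"])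
    have "g \<in> sobolev m"
      unfolding sobolev_def
    proof (intro CollectI conjI allI impI g(1))
      fix es :: "'a list" assume es: "set es \<subseteq> Basis \<and> length es \<le> m"
      then obtain h where h: "h \<in> L2" "has_weak_deriv (e # es) f h"
        using Suc.prems e by (auto simp: sobolev_def dest!: spec[of _ "e # es"])
      \<comment> \<open>The derivative of f along \<open>e # es\<close> serves as the derivative of
        g along \<open>es\<close>: testing the definition of g with
        \<open>partials es \<phi>\<close> produces the same integral.\<close>
      have "has_weak_deriv es g h"
        unfolding has_weak_deriv_def
      proof
        fix \<phi> :: "'a \<Rightarrow> real" assume \<phi>: "\<phi> \<in> test_functions UNIV"
        have "(LINT x|lborel. f x * partials [e] (partials es \<phi>) x) = - (LINT x|lborel. g x * partials es \<phi> x)"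
          using g(2) test_functions_partials[OF \<phi>, of es] es by (simp add: has_weak_deriv_def)
        moreover have "(LINT x|lborel. f x * partials (e # es) \<phi> x)
            = - ((-1) ^ length es * (LINT x|lborel. h x * \<phi> x))"
          using h(2) \<phi> by (simp add: has_weak_deriv_def)
        ultimately show "(LINT x|lborel. g x * partials es \<phi> x) = (-1) ^ length es * (LINT x|lborel. h x * \<phi> x)"
          by (simp add: partials_Cons)
      qed
      then show "\<exists>h\<in>L2. has_weak_deriv es g h" using h(1) by blast
    qed
    then show "\<exists>G\<in>Sob m. weak_partial e (abs_lsq f) G"
      using Suc.IH g fL2 e by (auto simp: has_weak_deriv_iff_weak_partial)
  qed
qed simp

lemma has_weak_deriv_pds:
  assumes "f \<in> L2" "abs_lsq f \<in> Sob (length es)" "g \<in> L2" "abs_lsq g = pds es (abs_lsq f)" "set es \<subseteq> Basis"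
  shows "has_weak_deriv es f g"
  using assms by (simp add: has_weak_deriv_iff_inner inner_partials)

lemma sobolev_iff: "f \<in> sobolev m \<longleftrightarrow> f \<in> L2 \<and> abs_lsq f \<in> Sob m"
proof (intro iffI conjI)
  assume f: "f \<in> L2 \<and> abs_lsq f \<in> Sob m"
  show "f \<in> sobolev m"
    unfolding sobolev_def
  proof (intro CollectI conjI allI impI)
    fix es :: "'a list" assume es: "set es \<subseteq> Basis \<and> length es \<le> m"
    obtain g where "g \<in> L2" "pds es (abs_lsq f) = abs_lsq g" by (rule lsq_cases)
    then show "\<exists>g\<in>L2. has_weak_deriv es f g"
      using f es Sob_mono[of "abs_lsq f" m "length es"] by (intro bexI[of _ g] has_weak_deriv_pds) auto
  qed (use f in simp)
qed (auto intro: sobolev_L2 abs_lsq_sobolev)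

lemma
  assumes f: "f \<in> sobolev m" and es: "set es \<subseteq> Basis" "length es \<le> m"
  shows weak_deriv_L2: "weak_deriv es f \<in> L2"
    and abs_lsq_weak_deriv: "abs_lsq (weak_deriv es f) = pds es (abs_lsq f)"
proof -
  have "\<exists>g. g \<in> L2 \<and> has_weak_deriv es f g"
    using f es unfolding sobolev_def by blast
  from someI_ex[OF this]
  have wd: "weak_deriv es f \<in> L2" "has_weak_deriv es f (weak_deriv es f)"
    unfolding weak_deriv_def by auto
  then show "weak_deriv es f \<in> L2" by simp
  obtain g where g: "g \<in> L2" "pds es (abs_lsq f) = abs_lsq g" by (rule lsq_cases)
  have "has_weak_deriv es f g"
    using f es g Sob_mono[of "abs_lsq f" m "length es"] by (intro has_weak_deriv_pds) (auto simp: sobolev_iff)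
  then show "abs_lsq (weak_deriv es f) = pds es (abs_lsq f)"
    using has_weak_deriv_unique[OF sobolev_L2[OF f] wd(1) g(1) es(1) wd(2)] g(2) by simp
qed

section \<open>Laplacian, gradient and seminorms of representatives\<close>

lemma
  assumes f: "f \<in> sobolev (Suc (Suc m))"
  shows laplacian_sobolev: "laplacian f \<in> sobolev m"
    and abs_lsq_laplacian: "abs_lsq (laplacian f) = lap (abs_lsq f)"
proof -
  have wd: "weak_deriv [e, e] f \<in> L2" "abs_lsq (weak_deriv [e, e] f) = pd e (pd e (abs_lsq f))"
    if "e \<in> Basis" for e
    using weak_deriv_L2[OF f, of "[e, e]"] abs_lsq_weak_deriv[OF f, of "[e, e]"] that by auto
  have *: "laplacian f \<in> L2"
    unfolding laplacian_def by (intro L2_sum wd)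
  show eq: "abs_lsq (laplacian f) = lap (abs_lsq f)"
    unfolding laplacian_def lap_def using wd by (simp flip: abs_lsq_sum)
  show "laplacian f \<in> sobolev m"
    using * eq lap_Sob[OF abs_lsq_sobolev[OF f]] by (simp add: sobolev_iff del: Sob.simps)
qed

lemma L2_inner_real: "f \<in> L2 \<Longrightarrow> g \<in> L2 \<Longrightarrow> L2_inner f g = nabla_form 0 (abs_lsq f) (abs_lsq g)"
  by (simp add: L2_inner_def inner_abs_lsq)

lemma L2_inner_gradient:
  assumes "f \<in> sobolev 1" "g \<in> sobolev 1"
  shows "L2_inner (gradient f) (gradient g) = nabla_form 1 (abs_lsq f) (abs_lsq g)"
proof -
  have wd: "weak_deriv [e] h \<in> L2" "abs_lsq (weak_deriv [e] h) = pd e (abs_lsq h)"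
    if "e \<in> Basis" "h \<in> sobolev 1" for e h
    using weak_deriv_L2[OF that(2), of "[e]"] abs_lsq_weak_deriv[OF that(2), of "[e]"] that by auto
  have "gradient f x \<bullet> gradient g x = (\<Sum>e\<in>Basis. weak_deriv [e] f x * weak_deriv [e] g x)" for x
    unfolding gradient_def by (subst euclidean_inner) (simp add: inner_sum_left_Basis)
  then have "L2_inner (gradient f) (gradient g) =
      (\<Sum>e\<in>Basis. LINT x|lborel. weak_deriv [e] f x * weak_deriv [e] g x)"
    unfolding L2_inner_def using wd(1) assms
    by (simp only:) (intro Bochner_Integration.integral_sum L2_mult_integrable)
  moreover have "(LINT x|lborel. weak_deriv [e] f x * weak_deriv [e] g x) =
      inner (pd e (abs_lsq f)) (pd e (abs_lsq g))" if "e \<in> Basis" for e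
    unfolding wd(2)[OF that assms(1), symmetric] wd(2)[OF that assms(2), symmetric]
    using wd(1)[OF that] assms by (simp only: inner_abs_lsq)
  ultimately show ?thesis by simp
qed

lemma laplacian_funpow:
  "f \<in> sobolev (2 * i + r) \<Longrightarrow>
    (laplacian ^^ i) f \<in> sobolev r \<and> abs_lsq ((laplacian ^^ i) f) = (lap ^^ i) (abs_lsq f)"
proof (induction i arbitrary: f)
  case (Suc i)
  then have "f \<in> sobolev (Suc (Suc (2 * i + r)))" by simp
  then show ?case
    using Suc.IH[OF laplacian_sobolev, of f] by (simp add: funpow_swap1 abs_lsq_laplacian)
qed simp

text \<open>Derivatives are traded for Laplacians two at a time; in \<open>nabla_inner_eq\<close>
  the remainder r is the parity of the order.\<close>

lemma nabla_form_funpow: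
  "F \<in> Sob (2 * i + r) \<Longrightarrow> G \<in> Sob (2 * i + r) \<Longrightarrow>
    nabla_form (2 * i + r) F G = nabla_form r ((lap ^^ i) F) ((lap ^^ i) G)"
proof (induction i arbitrary: F G)
  case (Suc i)
  then have F: "F \<in> Sob (Suc (Suc (2 * i + r)))" and G: "G \<in> Sob (Suc (Suc (2 * i + r)))" by simp_all
  have "nabla_form (Suc (Suc (2 * i + r))) F G = nabla_form (2 * i + r) (lap F) (lap G)"
    using nabla_form_lap_lap[OF F G] by simp
  also have "\<dots> = nabla_form r ((lap ^^ Suc i) F) ((lap ^^ Suc i) G)"
    using Suc.IH[OF lap_Sob[OF F] lap_Sob[OF G]] by (simp add: funpow_swap1)
  finally show ?case by simp
qed simp

lemma nabla_inner_eq: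
  assumes "v \<in> sobolev m" "w \<in> sobolev m"
  shows "nabla_inner m v w = nabla_form m (abs_lsq v) (abs_lsq w)"
proof -
  define i r where "i = m div 2" and "r = m mod 2"
  have m: "m = 2 * i + r" by (simp add: i_def r_def)
  have lf: "(laplacian ^^ i) v \<in> sobolev r" "(laplacian ^^ i) w \<in> sobolev r"
    "abs_lsq ((laplacian ^^ i) v) = (lap ^^ i) (abs_lsq v)"
    "abs_lsq ((laplacian ^^ i) w) = (lap ^^ i) (abs_lsq w)"
    using laplacian_funpow assms unfolding m by blast+
  have form: "nabla_form m (abs_lsq v) (abs_lsq w) = nabla_form r ((lap ^^ i) (abs_lsq v)) ((lap ^^ i) (abs_lsq w))"
    unfolding m using assms unfolding m sobolev_iff by (intro nabla_form_funpow) auto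
  show ?thesis
  proof (cases "even m")
    case True
    then have "r = 0" by (simp add: r_def)
    then show ?thesis
      using True lf form L2_inner_real[of "(laplacian ^^ i) v" "(laplacian ^^ i) w"]
      by (simp add: nabla_inner_def sobolev_iff flip: i_def)
  next
    case False
    then have "r = 1" by (simp add: r_def odd_iff_mod_2_eq_one)
    then show ?thesis
      using False lf form L2_inner_gradient[of "(laplacian ^^ i) v" "(laplacian ^^ i) w"]
      by (simp add: nabla_inner_def flip: i_def)
  qed
qed

lemma L2_norm_square: "(L2_norm f)\<^sup>2 = L2_inner f f"
  unfolding L2_norm_def L2_inner_def
  by (subst real_sqrt_pow2) (auto simp: power2_norm_eq_inner)

lemma nabla_norm_square:
  "v \<in> sobolev m \<Longrightarrow> (nabla_norm m v)\<^sup>2 = nabla_form m (abs_lsq v) (abs_lsq v)"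
  by (simp add: nabla_norm_def L2_norm_square nabla_inner_eq[symmetric] nabla_inner_def)

lemma norm_pds_le_sobolev_norm:
  assumes f: "f \<in> sobolev m" and es: "set es \<subseteq> Basis" "length es \<le> m"
  shows "norm (pds es (abs_lsq f)) \<le> sobolev_norm m f"
proof -
  have fin: "finite {es :: 'a list. set es \<subseteq> Basis \<and> length es \<le> m}"
    by (rule finite_lists_length_le) simp
  have "norm (pds es (abs_lsq f)) = L2_norm (weak_deriv es f)"
    using abs_lsq_weak_deriv[OF f es] weak_deriv_L2[OF f es] by (simp flip: norm_abs_lsq)
  also have "\<dots> \<le> sobolev_norm m f"
    unfolding sobolev_norm_def using es fin
    by (intro real_le_rsqrt member_le_sum) auto
  finally show ?thesis .
qed

lemma pds_add: "F \<in> Sob (length es) \<Longrightarrow> G \<in> Sob (length es) \<Longrightarrow> set es \<subseteq> Basis \<Longrightarrow> pds es (F + G) = pds es F + pds es G"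
  by (induction es arbitrary: F G) (auto simp: pd_add pd_Sob simp del: Sob.simps)

lemma pds_scaleR: "F \<in> Sob (length es) \<Longrightarrow> set es \<subseteq> Basis \<Longrightarrow> pds es (c *\<^sub>R F) = c *\<^sub>R pds es F"
  by (induction es arbitrary: F) (auto simp: pd_scaleR pd_Sob simp del: Sob.simps)

lemma Sob_diff: "F \<in> Sob m \<Longrightarrow> G \<in> Sob m \<Longrightarrow> F - G \<in> Sob m"
  using Sob_add[of F m "(-1) *\<^sub>R G"] Sob_scaleR[of G m "-1"] by simp

lemma pds_diff:
  assumes "F \<in> Sob (length es)" "G \<in> Sob (length es)" "set es \<subseteq> Basis"
  shows "pds es (F - G) = pds es F - pds es G"
  using pds_add[OF assms(1) Sob_scaleR[OF assms(2)] assms(3), of "-1"] pds_scaleR[OF assms(2,3), of "-1"]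
  by simp

section \<open>Curves of representatives and their time derivatives\<close>

lemma Sob_continuous_onI:
  "(\<And>t. t \<in> S \<Longrightarrow> V t \<in> Sob m) \<Longrightarrow>
    (\<And>es. set es \<subseteq> Basis \<Longrightarrow> length es \<le> m \<Longrightarrow> continuous_on S (\<lambda>t. pds es (V t))) \<Longrightarrow>
    Sob_continuous_on S m V"
proof (induction m arbitrary: V)
  case 0
  from 0(2)[of "[]"] show ?case by simp
next
  case (Suc m)
  have "Sob_continuous_on S m (\<lambda>t. pd e (V t))" if e: "e \<in> Basis" for e
  proof (rule Suc.IH)
    show "pd e (V t) \<in> Sob m" if "t \<in> S" for t
      using pd_Sob[OF Suc.prems(1)[OF that] e] .
    show "continuous_on S (\<lambda>t. pds es (pd e (V t)))" if "set es \<subseteq> Basis" "length es \<le> m" for es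
      using Suc.prems(2)[of "e # es"] that e by simp
  qed
  then show ?case
    using Suc.prems(1) Suc.prems(2)[of "[]"] by (simp del: Sob.simps)
qed

lemma Sob_continuous_on_cong:
  "(\<And>t. t \<in> S \<Longrightarrow> V t = V' t) \<Longrightarrow> Sob_continuous_on S m V \<Longrightarrow> Sob_continuous_on S m V'"
proof (induction m arbitrary: V V')
  case 0
  then show ?case using continuous_on_cong[of S S V V'] by simp
next
  case (Suc m)
  have "Sob_continuous_on S m (\<lambda>t. pd e (V' t))" if "e \<in> Basis" for e
  proof (rule Suc.IH)
    show "Sob_continuous_on S m (\<lambda>t. pd e (V t))" using Suc.prems(2) that by simp
  qed (simp add: Suc.prems(1))
  moreover have "continuous_on S V'"
    using Suc.prems continuous_on_cong[of S S V V'] by simp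
  moreover have "V' t \<in> Sob (Suc m)" if t: "t \<in> S" for t
    using Suc.prems(2) t unfolding Sob_continuous_on.simps Suc.prems(1)[OF t, symmetric] by blast
  ultimately show ?case by (simp del: Sob.simps)
qed

lemma sobolev_C_0_Sob:
  assumes "u \<in> sobolev_C 0 T m"
  shows "Sob_continuous_on {0..<T} m (\<lambda>t. abs_lsq (u t))"
proof (rule Sob_continuous_onI)
  show U: "abs_lsq (u t) \<in> Sob m" if "t \<in> {0..<T}" for t
    using assms that by (auto simp: sobolev_iff)
  fix es :: "'a list" assume es: "set es \<subseteq> Basis" "length es \<le> m"
  show "continuous_on {0..<T} (\<lambda>t. pds es (abs_lsq (u t)))"
    unfolding continuous_on_def
  proof
    fix t assume t: "t \<in> {0..<T}"
    have lim: "((\<lambda>s. sobolev_norm m (\<lambda>x. u s x - u t x)) \<longlongrightarrow> 0) (at t within {0..<T})"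
      using assms t by simp
    have "norm (pds es (abs_lsq (u s)) - pds es (abs_lsq (u t))) \<le> sobolev_norm m (\<lambda>x. u s x - u t x)"
      if s: "s \<in> {0..<T}" for s
    proof -
      have L2: "u s \<in> L2" "u t \<in> L2" using assms s t by (auto intro: sobolev_L2)
      have eq: "abs_lsq (\<lambda>x. u s x - u t x) = abs_lsq (u s) - abs_lsq (u t)"
        using L2 by (simp add: abs_lsq_diff)
      have "(\<lambda>x. u s x - u t x) \<in> sobolev m"
        using L2 U[OF s] U[OF t] by (simp add: sobolev_iff eq L2_diff Sob_diff)
      from norm_pds_le_sobolev_norm[OF this es]
      show ?thesis
        unfolding eq using pds_diff[of "abs_lsq (u s)" es "abs_lsq (u t)"] Sob_mono[OF U es(2)] s t es by simp
    qed
    then have "\<forall>\<^sub>F s in at t within {0..<T}.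
        norm (pds es (abs_lsq (u s)) - pds es (abs_lsq (u t))) \<le> sobolev_norm m (\<lambda>x. u s x - u t x)"
      by (simp add: eventually_at_filter)
    then show "((\<lambda>t. pds es (abs_lsq (u t))) \<longlongrightarrow> pds es (abs_lsq (u t))) (at t within {0..<T})"
      by (subst LIM_zero_iff[symmetric], intro Lim_null_comparison[OF _ lim])
  qed
qed

lemma at_within_atLeastLessThan_nontrivial:
  "(t::real) \<in> {0..<T} \<Longrightarrow> at t within {0..<T} \<noteq> bot"
proof -
  assume t: "t \<in> {0..<T}"
  have "t islimpt {t<..<T}" using t by (simp add: islimpt_greaterThanLessThan1)
  then have "t islimpt {0..<T}" by (rule islimpt_subset) (use t in auto)
  then show ?thesis by (simp add: trivial_limit_within)
qed

text \<open>\<open>time_deriv\<close> is chosen by its L^2 limit alone. The derivative v supplied by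
  membership in C^1 with values in H^m is also such a limit, since the Sobolev norm dominates the
  L^2 norm. Uniqueness of limits identifies the two classes, and \<open>time_deriv\<close> inherits
  the regularity of v.\<close>

lemma sobolev_C_1_deriv:
  assumes u: "u \<in> sobolev_C (Suc 0) T m"
  defines "V \<equiv> \<lambda>t. abs_lsq (time_deriv T u t)"
  shows "Sob_continuous_on {0..<T} m V"
    and "Sob_deriv_on {0..<T} m (\<lambda>t. abs_lsq (u t)) V"
    and "t \<in> {0..<T} \<Longrightarrow> time_deriv T u t \<in> sobolev m"
proof -
  obtain v where v: "v \<in> sobolev_C 0 T m" and lim: "\<And>t. t \<in> {0..<T} \<Longrightarrow>
      ((\<lambda>s. sobolev_norm m (\<lambda>x. diff_quot u t s x - v t x)) \<longlongrightarrow> 0) (at t within {0..<T})"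
    using u by auto
  have u0: "u t \<in> sobolev m" and v0: "v t \<in> sobolev m" if "t \<in> {0..<T}" for t
    using u v that by auto
  have quot: "diff_quot u t s \<in> sobolev m"
    "abs_lsq (diff_quot u t s) = (abs_lsq (u s) - abs_lsq (u t)) /\<^sub>R (s - t)"
    if "t \<in> {0..<T}" "s \<in> {0..<T}" for t s
  proof -
    have L2: "u s \<in> L2" "u t \<in> L2" using u0 that by (auto intro: sobolev_L2)
    have q: "diff_quot u t s = (\<lambda>x. inverse (s - t) * (u s x - u t x))"
      by (simp add: diff_quot_def divide_inverse mult.commute)
    show eq: "abs_lsq (diff_quot u t s) = (abs_lsq (u s) - abs_lsq (u t)) /\<^sub>R (s - t)"
      unfolding q using L2 by (simp add: abs_lsq_diff abs_lsq_scaleR L2_diff)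
    show "diff_quot u t s \<in> sobolev m"
    proof -
      have "diff_quot u t s \<in> L2" unfolding q by (intro L2_cmult L2_diff L2)
      then show ?thesis
        using u0 that unfolding sobolev_iff eq by (auto intro: Sob_scaleR Sob_diff)
    qed
  qed
  have deriv: "((\<lambda>t. abs_lsq (u t)) has_vector_derivative abs_lsq (v t)) (at t within {0..<T})"
    if t: "t \<in> {0..<T}" for t
  proof -
    have "norm (abs_lsq (diff_quot u t s) - abs_lsq (v t)) \<le> sobolev_norm m (\<lambda>x. diff_quot u t s x - v t x)"
      if s: "s \<in> {0..<T}" for s
    proof -
      have eq: "abs_lsq (\<lambda>x. diff_quot u t s x - v t x) = abs_lsq (diff_quot u t s) - abs_lsq (v t)"
        using quot(1)[OF t s] v0[OF t] by (simp only: abs_lsq_diff sobolev_L2)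
      have "(\<lambda>x. diff_quot u t s x - v t x) \<in> sobolev m"
        using quot(1)[OF t s] v0[OF t] by (simp add: sobolev_iff eq L2_diff Sob_diff)
      from norm_pds_le_sobolev_norm[OF this, of "[]"] show ?thesis by (simp add: eq)
    qed
    then have "\<forall>\<^sub>F s in at t within {0..<T}.
        norm (abs_lsq (diff_quot u t s) - abs_lsq (v t)) \<le> sobolev_norm m (\<lambda>x. diff_quot u t s x - v t x)"
      by (simp add: eventually_at_filter)
    then have "((\<lambda>s. abs_lsq (diff_quot u t s) - abs_lsq (v t)) \<longlongrightarrow> 0) (at t within {0..<T})"
      by (rule Lim_null_comparison[OF _ lim[OF t]])
    then have "((\<lambda>s. abs_lsq (diff_quot u t s)) \<longlongrightarrow> abs_lsq (v t)) (at t within {0..<T})"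
      by (subst (asm) LIM_zero_iff)
    moreover have "\<forall>\<^sub>F s in at t within {0..<T}. abs_lsq (diff_quot u t s) =
        (abs_lsq (u s) - abs_lsq (u t)) /\<^sub>R (s - t)"
      using quot(2)[OF t] by (simp add: eventually_at_filter)
    ultimately show ?thesis
      unfolding has_vector_derivative_iff_quotient by (rule Lim_transform_eventually)
  qed
  have L2_lim_iff: "((\<lambda>s. L2_norm (\<lambda>x. diff_quot u t s x - g x)) \<longlongrightarrow> 0) (at t within {0..<T}) \<longleftrightarrow>
      ((\<lambda>t. abs_lsq (u t)) has_vector_derivative abs_lsq g) (at t within {0..<T})"
    if t: "t \<in> {0..<T}" and g: "g \<in> L2" for t g
  proof -
    have "L2_norm (\<lambda>x. diff_quot u t s x - g x) = norm ((abs_lsq (u s) - abs_lsq (u t)) /\<^sub>R (s - t) - abs_lsq g)"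
      if s: "s \<in> {0..<T}" for s
      using sobolev_L2[OF quot(1)[OF t s]] g quot(2)[OF t s] norm_abs_lsq[of "\<lambda>x. diff_quot u t s x - g x"]
      by (simp add: L2_diff flip: abs_lsq_diff)
    then have "\<forall>\<^sub>F s in at t within {0..<T}. L2_norm (\<lambda>x. diff_quot u t s x - g x) =
        norm ((abs_lsq (u s) - abs_lsq (u t)) /\<^sub>R (s - t) - abs_lsq g)"
      by (simp add: eventually_at_filter)
    from tendsto_cong[OF this] show ?thesis
      unfolding has_vector_derivative_iff_quotient by (simp add: tendsto_norm_zero_iff LIM_zero_iff)
  qed
  have td: "time_deriv T u t \<in> L2" "V t = abs_lsq (v t)" if t: "t \<in> {0..<T}" for t
  proof -
    have "\<exists>g. g \<in> L2 \<and> ((\<lambda>s. L2_norm (\<lambda>x. diff_quot u t s x - g x)) \<longlongrightarrow> 0) (at t within {0..<T})"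
      using L2_lim_iff[OF t] deriv[OF t] sobolev_L2[OF v0[OF t]] by blast
    from someI_ex[OF this]
    have *: "time_deriv T u t \<in> L2"
      "((\<lambda>s. L2_norm (\<lambda>x. diff_quot u t s x - time_deriv T u t x)) \<longlongrightarrow> 0) (at t within {0..<T})"
      unfolding time_deriv_def by auto
    then show "time_deriv T u t \<in> L2" by simp
    have "((\<lambda>t. abs_lsq (u t)) has_vector_derivative V t) (at t within {0..<T})"
      using L2_lim_iff[OF t *(1)] *(2) by (simp add: V_def)
    then show "V t = abs_lsq (v t)"
      using deriv[OF t] at_within_atLeastLessThan_nontrivial[OF t]
      unfolding has_vector_derivative_iff_quotient by (blast intro: tendsto_unique)
  qed
  show tds: "time_deriv T u t \<in> sobolev m" if "t \<in> {0..<T}" for t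
    using td[OF that] v0[OF that] by (simp add: sobolev_iff V_def)
  have vc: "Sob_continuous_on {0..<T} m (\<lambda>t. abs_lsq (v t))"
    by (rule sobolev_C_0_Sob[OF v])
  show "Sob_continuous_on {0..<T} m V"
    by (rule Sob_continuous_on_cong[OF _ vc]) (simp add: td)
  show "Sob_deriv_on {0..<T} m (\<lambda>t. abs_lsq (u t)) V"
  proof (rule Sob_deriv_on_cong)
    show "Sob_deriv_on {0..<T} m (\<lambda>t. abs_lsq (u t)) (\<lambda>t. abs_lsq (v t))"
    proof (rule Sob_deriv_onI[OF _ _ vc])
      show "convex {0..<T}" by simp
      show "Sob_deriv_on {0..<T} 0 (\<lambda>t. abs_lsq (u t)) (\<lambda>t. abs_lsq (v t))" using deriv by simp
    qed (rule abs_lsq_sobolev[OF u0])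
  qed (simp_all add: td)
qed

section \<open>The equation as an evolution equation\<close>

text \<open>Turns the Lebesgue integral of the weak formulation into a gauge integral over a compact
  interval, where the fundamental theorem of calculus applies.\<close>

lemma set_integral_compact_support:
  fixes h :: "real \<Rightarrow> real"
  assumes "continuous_on {\<alpha>..\<beta>} h" "{\<alpha>..\<beta>} \<subseteq> S" "\<And>t. t \<in> S \<Longrightarrow> t \<notin> {\<alpha>..\<beta>} \<Longrightarrow> h t = 0"
  shows "(LINT t:S|lborel. h t) = integral {\<alpha>..\<beta>} h"
proof -
  have "(LINT t:S|lborel. h t) = (LINT t:{\<alpha>..\<beta>}|lborel. h t)"
    unfolding set_lebesgue_integral_def
    using assms(2,3) by (intro Bochner_Integration.integral_cong) (auto simp: indicator_def)
  also have "\<dots> = integral {\<alpha>..\<beta>} h"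
    using borel_integrable_compact[OF compact_Icc assms(1)]
    by (intro set_borel_integral_eq_integral(2)) (simp add: set_integrable_def)
  finally show ?thesis .
qed

lemma smooth_antiderivative:
  fixes H :: "real \<Rightarrow> real"
  assumes "\<And>t. (H has_real_derivative \<eta> t) (at t)" "smooth \<eta>"
  shows "smooth H" "dir_deriv 1 H = \<eta>"
proof -
  show d: "dir_deriv 1 H = \<eta>"
    using dir_deriv_eq[OF assms(1)[unfolded has_field_derivative_def]] by auto
  show "smooth H"
  proof (rule smooth_function_algebra[of "insert H {f. smooth f}"])
    show "f differentiable (at x)" if "f \<in> insert H {f. smooth f}" for f x
      using that assms(1)[of x] smooth_differentiable
      by (auto simp: differentiable_def has_field_derivative_def)
    show "dir_deriv e f \<in> function_algebra (insert H {f. smooth f})"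
      if "f \<in> insert H {f. smooth f}" "e \<in> Basis" for f e
      using that d assms(2) smooth_dir_deriv[of f e] by (auto intro: function_algebra.base)
  qed (auto intro: function_algebra.base)
qed

text \<open>Here \<open>\<psi>'\<close> is chosen as the difference of two translates of a bump.\<close>

lemma du_Bois_Reymond:
  fixes c :: "real \<Rightarrow> real"
  assumes c: "continuous_on {A<..<B} c"
    and zero: "\<And>\<psi> \<alpha> \<beta>. \<psi> \<in> test_functions {A<..<B} \<Longrightarrow> A < \<alpha> \<Longrightarrow> \<alpha> < \<beta> \<Longrightarrow> \<beta> < B \<Longrightarrow>
      (\<And>t. t \<le> \<alpha> \<or> \<beta> \<le> t \<Longrightarrow> \<psi> t = 0 \<and> dir_deriv 1 \<psi> t = 0) \<Longrightarrow>
      integral {\<alpha>..\<beta>} (\<lambda>t. c t * dir_deriv 1 \<psi> t) = 0"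
    and xy: "x \<in> {A<..<B}" "y \<in> {A<..<B}" "x < y"
  shows "c x = c y"
proof -
  have bound: "\<bar>c x - c y\<bar> \<le> 2 * \<delta>" if \<delta>: "\<delta> > 0" for \<delta>
  proof -
    have near: "\<exists>d>0. \<forall>t. \<bar>t - z\<bar> < d \<longrightarrow> \<bar>c t - c z\<bar> < \<delta>" if z: "z \<in> {A<..<B}" for z
    proof -
      have "isCont c z" using c z by (simp add: continuous_on_eq_continuous_at)
      then show ?thesis using \<delta> unfolding continuous_at_eps_delta by (auto simp: dist_real_def)
    qed
    obtain d1 d2 where d: "d1 > 0" "d2 > 0" "\<And>t. \<bar>t - x\<bar> < d1 \<Longrightarrow> \<bar>c t - c x\<bar> < \<delta>"
        "\<And>t. \<bar>t - y\<bar> < d2 \<Longrightarrow> \<bar>c t - c y\<bar> < \<delta>"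
      using near[OF xy(1)] near[OF xy(2)] by blast
    \<comment> \<open>So small that the \<epsilon>-neighbourhoods of x and y lie inside the interval
      and \<open>c\<close> varies by less than \<delta> on each of them.\<close>
    define \<epsilon> where "\<epsilon> = min (min d1 d2) (min (x - A) (B - y)) / 2"
    have \<epsilon>: "\<epsilon> > 0" "\<epsilon> < d1" "\<epsilon> < d2" "A < x - \<epsilon>" "y + \<epsilon> < B"
    proof -
      have "2 * \<epsilon> \<le> d1" "2 * \<epsilon> \<le> d2" "2 * \<epsilon> \<le> x - A" "2 * \<epsilon> \<le> B - y" "\<epsilon> > 0"
        using d(1,2) xy by (auto simp: \<epsilon>_def)
      then show "\<epsilon> > 0" "\<epsilon> < d1" "\<epsilon> < d2" "A < x - \<epsilon>" "y + \<epsilon> < B" by linarith+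
    qed
    define \<eta> :: "real \<Rightarrow> real" where "\<eta> = box_bump (- \<epsilon>) \<epsilon> 1"
    have \<eta>: "smooth \<eta>" "\<And>s. 0 \<le> \<eta> s" "\<And>s. s \<le> - \<epsilon> \<or> \<epsilon> \<le> s \<Longrightarrow> \<eta> s = 0" "\<And>s. - \<epsilon> < s \<Longrightarrow> s < \<epsilon> \<Longrightarrow> 0 < \<eta> s"
      by (auto simp: \<eta>_def smooth_box_bump box_bump_bounds box_bump_eq_0 box_bump_pos)
    have "\<exists>H. \<forall>s. -\<infinity> < ereal s \<longrightarrow> ereal s < \<infinity> \<longrightarrow> (H has_vector_derivative \<eta> s) (at s)"
      using smooth_continuous_on[OF \<eta>(1), of UNIV]
      by (intro einterval_antiderivative) (auto simp: continuous_on_eq_continuous_at)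
    then obtain H where H: "\<And>s. (H has_real_derivative \<eta> s) (at s)"
      by (auto simp: has_real_derivative_iff_has_vector_derivative)
    have dH0: "(H has_real_derivative 0) (at s within S)" if "s \<le> - \<epsilon> \<or> \<epsilon> \<le> s" for s S
      using has_field_derivative_at_within[OF H[of s], of S] \<eta>(3)[OF that] by simp
    have H_left: "H s = H (- \<epsilon>)" if "s \<le> - \<epsilon>" for s
      by (rule has_field_derivative_zero_constant[of "{..- \<epsilon>}" H, THEN exE])
        (use that in \<open>auto intro!: dH0 simp: \<epsilon>\<close>)
    have H_right: "H s = H \<epsilon>" if "\<epsilon> \<le> s" for s
      by (rule has_field_derivative_zero_constant[of "{\<epsilon>..}" H, THEN exE])
        (use that in \<open>auto intro!: dH0 simp: \<epsilon>\<close>)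
    define m where "m = H \<epsilon> - H (- \<epsilon>)"
    have m: "m > 0"
      unfolding m_def
      using DERIV_pos_imp_increasing_open[of "- \<epsilon>" \<epsilon> H] \<epsilon>(1) H \<eta>(4)
      by (force intro: continuous_at_imp_continuous_on DERIV_isCont)
    define \<eta>' where "\<eta>' = (\<lambda>t. \<eta> (t - x) - \<eta> (t - y))"
    \<comment> \<open>Both bumps have the same mass, so the antiderivative of their difference
      vanishes to the right of y + \<epsilon> as well as to the left of x - \<epsilon>: \<psi> has
      compact support.\<close>
    define \<psi> where "\<psi> = (\<lambda>t. H (t - x) - H (t - y))"
    have shift: "((\<lambda>t. H (t - z)) has_real_derivative \<eta> (t - z)) (at t)" for z t
      using DERIV_shift[of H "\<eta> (t - z)" t "- z"] H[of "t - z"] by simp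
    have d\<psi>: "(\<psi> has_real_derivative \<eta>' t) (at t)" for t
      unfolding \<psi>_def \<eta>'_def by (intro DERIV_diff shift)
    have \<eta>'_smooth: "smooth \<eta>'"
    proof -
      have "smooth (\<lambda>t. \<eta> (t + - x) + (-1) * \<eta> (t + - y))"
        by (intro smooth_add smooth_mult smooth_const smooth_translate \<eta>(1))
      then show ?thesis by (simp add: \<eta>'_def)
    qed
    note \<psi> = smooth_antiderivative[OF d\<psi> \<eta>'_smooth]
    let ?\<alpha> = "x - \<epsilon>" and ?\<beta> = "y + \<epsilon>"
    have vanish: "\<psi> t = 0 \<and> dir_deriv 1 \<psi> t = 0" if "t \<le> ?\<alpha> \<or> ?\<beta> \<le> t" for t
      using that
    proof
      assume "t \<le> ?\<alpha>"
      then have "\<psi> t = 0" "\<eta>' t = 0"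
        using xy(3) H_left[of "t - x"] H_left[of "t - y"] \<eta>(3)[of "t - x"] \<eta>(3)[of "t - y"]
        by (simp_all add: \<eta>'_def \<psi>_def)
      then show ?thesis by (simp add: \<psi>(2))
    next
      assume "?\<beta> \<le> t"
      then have "\<psi> t = 0" "\<eta>' t = 0"
        using xy(3) H_right[of "t - x"] H_right[of "t - y"] \<eta>(3)[of "t - x"] \<eta>(3)[of "t - y"]
        by (simp_all add: \<eta>'_def \<psi>_def)
      then show ?thesis by (simp add: \<psi>(2))
    qed
    have "\<psi> \<in> test_functions {A<..<B}"
    proof (rule test_functionsI[of _ "{?\<alpha>..?\<beta>}"])
      show "{t. \<psi> t \<noteq> 0} \<subseteq> {?\<alpha>..?\<beta>}"
      proof
        fix t assume "t \<in> {t. \<psi> t \<noteq> 0}"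
        then show "t \<in> {?\<alpha>..?\<beta>}" using vanish[of t] by (cases "t \<le> ?\<alpha> \<or> ?\<beta> \<le> t") auto
      qed
    qed (use \<psi> \<epsilon> in auto)
    then have I0: "integral {?\<alpha>..?\<beta>} (\<lambda>t. c t * \<eta>' t) = 0"
      using zero[of \<psi> ?\<alpha> ?\<beta>] vanish \<epsilon> xy(3) \<psi>(2) by simp
    have cc: "continuous_on {?\<alpha>..?\<beta>} c"
      by (rule continuous_on_subset[OF c]) (use \<epsilon> in auto)
    have ce: "continuous_on {?\<alpha>..?\<beta>} (\<lambda>t. \<eta> (t - z))" for z
      by (intro continuous_on_compose2[OF smooth_continuous_on[OF \<eta>(1), of UNIV]] continuous_intros) auto
    have mass: "integral {?\<alpha>..?\<beta>} (\<lambda>t. \<eta> (t - z)) = m" if "z = x \<or> z = y" for z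
    proof -
      have "((\<lambda>t. \<eta> (t - z)) has_integral H (?\<beta> - z) - H (?\<alpha> - z)) {?\<alpha>..?\<beta>}"
        using xy \<epsilon> shift
        by (intro fundamental_theorem_of_calculus)
          (auto simp: has_real_derivative_iff_has_vector_derivative intro: has_vector_derivative_at_within)
      moreover have "H (?\<beta> - z) = H \<epsilon>" "H (?\<alpha> - z) = H (- \<epsilon>)"
        using that xy(3) by (auto intro: H_left H_right)
      ultimately show ?thesis by (simp add: m_def integral_unique)
    qed
    \<comment> \<open>A bump of mass \<open>m\<close> near z averages \<open>c\<close> to within
      \<delta>. As the two averages coincide by hypothesis, \<open>c x\<close> and
      \<open>c y\<close> differ by at most 2 \<delta>.\<close>
    have close: "\<bar>integral {?\<alpha>..?\<beta>} (\<lambda>t. c t * \<eta> (t - z)) - c z * m\<bar> \<le> \<delta> * m"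
      if z: "z = x \<or> z = y" for z
    proof -
      have near: "\<bar>(c t - c z) * \<eta> (t - z)\<bar> \<le> \<delta> * \<eta> (t - z)" for t
      proof (cases "\<bar>t - z\<bar> < \<epsilon>")
        case True
        then have "\<bar>c t - c z\<bar> \<le> \<delta>" using z d(3,4)[of t] \<epsilon> by (auto simp: less_imp_le)
        then show ?thesis using \<eta>(2)[of "t - z"] by (simp add: abs_mult mult_right_mono)
      next
        case False
        then have "\<eta> (t - z) = 0" by (intro \<eta>(3)) linarith
        then show ?thesis by simp
      qed
      have "norm (integral {?\<alpha>..?\<beta>} (\<lambda>t. (c t - c z) * \<eta> (t - z))) \<le> integral {?\<alpha>..?\<beta>} (\<lambda>t. \<delta> * \<eta> (t - z))"
        using near
        by (intro Henstock_Kurzweil_Integration.integral_norm_bound_integral integrable_continuous_interval continuous_intros cc ce) auto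
      also have "\<dots> = \<delta> * m" using mass[OF z] by simp
      also have "integral {?\<alpha>..?\<beta>} (\<lambda>t. (c t - c z) * \<eta> (t - z)) =
          integral {?\<alpha>..?\<beta>} (\<lambda>t. c t * \<eta> (t - z) - c z * \<eta> (t - z))"
        by (simp add: left_diff_distrib)
      also have "\<dots> = integral {?\<alpha>..?\<beta>} (\<lambda>t. c t * \<eta> (t - z)) - integral {?\<alpha>..?\<beta>} (\<lambda>t. c z * \<eta> (t - z))"
        by (intro integral_diff integrable_continuous_interval continuous_intros cc ce)
      finally show ?thesis using mass[OF z] by simp
    qed
    have "0 = integral {?\<alpha>..?\<beta>} (\<lambda>t. c t * \<eta> (t - x) - c t * \<eta> (t - y))"
      using I0 by (simp add: \<eta>'_def right_diff_distrib)
    also have "\<dots> = integral {?\<alpha>..?\<beta>} (\<lambda>t. c t * \<eta> (t - x)) - integral {?\<alpha>..?\<beta>} (\<lambda>t. c t * \<eta> (t - y))"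
      by (intro integral_diff integrable_continuous_interval continuous_intros cc ce)
    finally have "\<bar>c x * m - c y * m\<bar> \<le> 2 * (\<delta> * m)"
      using close[of x] close[of y] by linarith
    then have "\<bar>c x - c y\<bar> * m \<le> (2 * \<delta>) * m"
      using m by (simp add: abs_mult flip: left_diff_distrib)
    then show ?thesis using m by (simp only: mult_le_cancel_right_pos)
  qed
  have "\<bar>c x - c y\<bar> \<le> 0"
  proof (rule field_le_epsilon)
    fix e :: real assume "e > 0" then show "\<bar>c x - c y\<bar> \<le> 0 + e" using bound[of "e / 2"] by simp
  qed
  then show ?thesis by simp
qed

text \<open>If G is an antiderivative of g, integrating by parts moves one derivative onto p and one
  onto G, and the weak equation becomes the vanishing of the integral of (f - G) \<psi>'. Hence f -
  G is constant, and f inherits the classical derivative of G.\<close>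

lemma weak_second_derivative:
  fixes p f g :: "real \<Rightarrow> real"
  assumes T: "T > 0"
    and p: "\<And>t. t \<in> {0..<T} \<Longrightarrow> (p has_real_derivative f t) (at t within {0..<T})"
    and f: "continuous_on {0..<T} f" and g: "continuous_on {0..<T} g"
    and weak: "\<And>\<psi>. \<psi> \<in> test_functions {0<..<T} \<Longrightarrow>
      (LINT t:{0<..<T}|lborel. p t * dir_deriv 1 (dir_deriv 1 \<psi>) t - g t * \<psi> t) = 0"
    and t: "t \<in> {0..<T}"
  shows "(f has_real_derivative g t) (at t within {0..<T})"
proof -
  \<comment> \<open>Freezing g at its value at 0 for negative times gives an antiderivative on an
    open interval that contains the endpoint 0.\<close>
  have "\<exists>G. \<forall>s. -\<infinity> < ereal s \<longrightarrow> ereal s < ereal T \<longrightarrow> (G has_vector_derivative g (max 0 s)) (at s)"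
  proof (rule einterval_antiderivative)
    fix s assume "-\<infinity> < ereal s" "ereal s < ereal T"
    then have s: "s \<in> {..<T}" by simp
    have "continuous_on {..<T} (\<lambda>s. g (max 0 s))"
      by (rule continuous_on_compose2[OF g]) (use T in \<open>auto intro!: continuous_intros\<close>)
    then show "isCont (\<lambda>s. g (max 0 s)) s"
      using s by (simp add: continuous_on_eq_continuous_at)
  qed simp
  then obtain G where G: "\<And>s. s < T \<Longrightarrow> (G has_real_derivative g (max 0 s)) (at s)"
    by (auto simp: has_real_derivative_iff_has_vector_derivative)
  have G': "(G has_real_derivative g s) (at s within S)" if "s \<in> {0..<T}" for s S
    using has_field_derivative_at_within[OF G[of s], of S] that by (simp add: max_def)
  have Gc: "continuous_on {0..<T} G"
    by (rule DERIV_continuous_on[OF G'])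
  have p': "(p has_real_derivative f s) (at s)" if "s \<in> {0<..<T}" for s
  proof -
    have "at s within {0..<T} = at s"
      by (rule at_within_open_subset[of s "{0<..<T}"]) (use that in auto)
    then show ?thesis using p[of s] that by simp
  qed
  have const: "f x - G x = f y - G y" if xy: "x \<in> {0<..<T}" "y \<in> {0<..<T}" "x < y" for x y
  proof (rule du_Bois_Reymond[where A = 0 and B = T and c = "\<lambda>s. f s - G s"])
    show "continuous_on {0<..<T} (\<lambda>s. f s - G s)"
      by (intro continuous_intros continuous_on_subset[OF f] continuous_on_subset[OF Gc]) auto
    fix \<psi> \<alpha> \<beta> assume \<psi>: "\<psi> \<in> test_functions {0<..<T}" and \<alpha>\<beta>: "0 < \<alpha>" "\<alpha> < \<beta>" "\<beta> < T"
      and vanish: "\<And>t. t \<le> \<alpha> \<or> \<beta> \<le> t \<Longrightarrow> \<psi> t = 0 \<and> dir_deriv 1 \<psi> t = 0"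
    let ?d = "dir_deriv 1 \<psi>" and ?dd = "dir_deriv 1 (dir_deriv 1 \<psi>)"
    have d: "?d \<in> test_functions {0<..<T}" "?dd \<in> test_functions {0<..<T}"
      using \<psi> by (simp_all add: test_functions_dir_deriv)
    note D = smooth_real_has_derivative[OF test_functions_smooth[OF \<psi>]]
      smooth_real_has_derivative[OF test_functions_smooth[OF d(1)]]
    note C = smooth_continuous_on[OF test_functions_smooth[OF \<psi>]]
      smooth_continuous_on[OF test_functions_smooth[OF d(1)]]
      smooth_continuous_on[OF test_functions_smooth[OF d(2)]]
    have dd0: "?dd t = 0" if "t \<notin> {\<alpha>..\<beta>}" for t
    proof -
      have "((\<lambda>_. 0) has_real_derivative 0) (at t)" by simp
      then have "(?d has_real_derivative 0) (at t)"
        by (rule has_field_derivative_transform_within_open[of _ _ _ "- {\<alpha>..\<beta>}"])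
          (use that vanish in \<open>auto simp: not_le\<close>)
      then show ?thesis using D(2) DERIV_unique by blast
    qed
    have sub: "{\<alpha>..\<beta>} \<subseteq> {0..<T}" "{\<alpha>..\<beta>} \<subseteq> {0<..<T}" using \<alpha>\<beta> by auto
    have pc: "continuous_on {\<alpha>..\<beta>} p"
      using p' sub(2) by (meson DERIV_isCont continuous_at_imp_continuous_on subsetD)
    note cont = pc continuous_on_subset[OF f sub(1)] continuous_on_subset[OF g sub(1)]
      continuous_on_subset[OF Gc sub(1)]
    have 1: "((\<lambda>t. f t * ?d t + p t * ?dd t) has_integral p \<beta> * ?d \<beta> - p \<alpha> * ?d \<alpha>) {\<alpha>..\<beta>}"
    proof (rule fundamental_theorem_of_calculus)
      fix s assume "s \<in> {\<alpha>..\<beta>}"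
      then have "(p has_real_derivative f s) (at s)" using p' sub by auto
      from has_field_derivative_at_within[OF DERIV_mult[OF this D(2)[of s]], of "{\<alpha>..\<beta>}"]
      show "((\<lambda>t. p t * ?d t) has_vector_derivative f s * ?d s + p s * ?dd s) (at s within {\<alpha>..\<beta>})"
        by (simp add: has_real_derivative_iff_has_vector_derivative add.commute mult.commute)
    qed (use \<alpha>\<beta> in simp)
    have 2: "((\<lambda>t. g t * \<psi> t + G t * ?d t) has_integral G \<beta> * \<psi> \<beta> - G \<alpha> * \<psi> \<alpha>) {\<alpha>..\<beta>}"
    proof (rule fundamental_theorem_of_calculus)
      fix s assume "s \<in> {\<alpha>..\<beta>}"
      then have "(G has_real_derivative g s) (at s)" using G' sub by auto
      from has_field_derivative_at_within[OF DERIV_mult[OF this D(1)[of s]], of "{\<alpha>..\<beta>}"]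
      show "((\<lambda>t. G t * \<psi> t) has_vector_derivative g s * \<psi> s + G s * ?d s) (at s within {\<alpha>..\<beta>})"
        by (simp add: has_real_derivative_iff_has_vector_derivative add.commute mult.commute)
    qed (use \<alpha>\<beta> in simp)
    have "(LINT t:{0<..<T}|lborel. p t * ?dd t - g t * \<psi> t) = integral {\<alpha>..\<beta>} (\<lambda>t. p t * ?dd t - g t * \<psi> t)"
      using sub dd0 vanish
      by (intro set_integral_compact_support continuous_intros cont C) (auto simp: not_le)
    then have 3: "((\<lambda>t. p t * ?dd t - g t * \<psi> t) has_integral 0) {\<alpha>..\<beta>}"
      using weak[OF \<psi>] integrable_integral[of "\<lambda>t. p t * ?dd t - g t * \<psi> t" "{\<alpha>..\<beta>}"]
      by (simp add: integrable_continuous_interval continuous_intros cont C)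
    \<comment> \<open>Two product rules and the weak equation, combined so that everything except (f
      - G) \<psi>' cancels. The boundary terms vanish with \<psi> and \<psi>' at \<alpha> and
      \<beta>.\<close>
    have "((\<lambda>t. (f t * ?d t + p t * ?dd t) - (g t * \<psi> t + G t * ?d t) - (p t * ?dd t - g t * \<psi> t))
        has_integral (p \<beta> * ?d \<beta> - p \<alpha> * ?d \<alpha>) - (G \<beta> * \<psi> \<beta> - G \<alpha> * \<psi> \<alpha>) - 0) {\<alpha>..\<beta>}"
      by (intro has_integral_diff 1 2 3)
    then have "((\<lambda>t. (f t - G t) * ?d t) has_integral 0) {\<alpha>..\<beta>}"
      using vanish[of \<alpha>] vanish[of \<beta>] by (simp add: algebra_simps)
    then show "integral {\<alpha>..\<beta>} (\<lambda>t. (f t - G t) * ?d t) = 0"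
      by (rule integral_unique)
  qed (use xy in auto)
  define C where "C = f (T / 2) - G (T / 2)"
  have eq: "f s = G s + C" if "s \<in> {0<..<T}" for s
  proof -
    have "f s - G s = C"
    proof (cases s "T / 2" rule: linorder_cases)
      case less
      then show ?thesis using const[of s "T / 2"] that by (simp add: C_def)
    next
      case greater
      then show ?thesis using const[of "T / 2" s] that T by (simp add: C_def)
    next
      case equal
      then show ?thesis by (simp only: C_def)
    qed
    then show ?thesis by simp
  qed
  have fG: "f s = G s + C" if "s \<in> {0..<T}" for s
  proof (cases "s = 0")
    case True
    \<comment> \<open>The identity reaches 0 by continuity. The interval stops at T/2 so that its
      closure stays inside [0,T), where f and G are continuous.\<close>
    have "f 0 - G 0 = C"
    proof (rule continuous_constant_on_closure[where S = "{0<..<T / 2}" and f = "\<lambda>s. f s - G s" and x = 0])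
      show "continuous_on (closure {0<..<T / 2}) (\<lambda>s. f s - G s)"
        using T by (intro continuous_intros continuous_on_subset[OF f] continuous_on_subset[OF Gc]) auto
      show "f s - G s = C" if "s \<in> {0<..<T / 2}" for s
        using eq[of s] that by simp
    qed (use T in auto)
    then show ?thesis using True by simp
  next
    case False
    then show ?thesis using eq that by auto
  qed
  have "((\<lambda>s. G s + C) has_real_derivative g t) (at t within {0..<T})"
    using DERIV_add[OF G'[OF t] DERIV_const[of C]] by simp
  then show ?thesis
    unfolding has_real_derivative_iff_has_vector_derivative
    by (rule has_vector_derivative_transform[OF t, rotated]) (rule fG)
qed

section \<open>Product test functions in space and time\<close>

lemma has_derivative_product_function:
  assumes "smooth \<phi>" "smooth \<psi>"
  shows "((\<lambda>z. \<phi> (fst z) * \<psi> (snd z)) has_derivative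
    (\<lambda>h. \<phi> (fst z) * frechet_derivative \<psi> (at (snd z)) (snd h) +
      frechet_derivative \<phi> (at (fst z)) (fst h) * \<psi> (snd z))) (at z)"
proof (rule has_derivative_mult)
  show "((\<lambda>z. \<phi> (fst z)) has_derivative (\<lambda>h. frechet_derivative \<phi> (at (fst z)) (fst h))) (at z)"
    by (rule has_derivative_compose[of fst fst])
      (use smooth_differentiable[OF assms(1)] in
        \<open>auto simp: frechet_derivative_works intro: bounded_linear_imp_has_derivative bounded_linear_fst\<close>)
  show "((\<lambda>z. \<psi> (snd z)) has_derivative (\<lambda>h. frechet_derivative \<psi> (at (snd z)) (snd h))) (at z)"
    by (rule has_derivative_compose[of snd snd])
      (use smooth_differentiable[OF assms(2)] in
        \<open>auto simp: frechet_derivative_works intro: bounded_linear_imp_has_derivative bounded_linear_snd\<close>)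
qed

lemma dir_deriv_product_function:
  assumes "smooth \<phi>" "smooth \<psi>"
  shows "dir_deriv (e, 0) (\<lambda>z. \<phi> (fst z) * \<psi> (snd z)) = (\<lambda>z. dir_deriv e \<phi> (fst z) * \<psi> (snd z))"
    and "dir_deriv (0, d) (\<lambda>z. \<phi> (fst z) * \<psi> (snd z)) = (\<lambda>z. \<phi> (fst z) * dir_deriv d \<psi> (snd z))"
proof -
  have "linear (frechet_derivative \<psi> (at y))" "linear (frechet_derivative \<phi> (at x))" for x y
    using smooth_differentiable assms linear_frechet_derivative by blast+
  then show "dir_deriv (e, 0) (\<lambda>z. \<phi> (fst z) * \<psi> (snd z)) = (\<lambda>z. dir_deriv e \<phi> (fst z) * \<psi> (snd z))"
    "dir_deriv (0, d) (\<lambda>z. \<phi> (fst z) * \<psi> (snd z)) = (\<lambda>z. \<phi> (fst z) * dir_deriv d \<psi> (snd z))"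
    by - (rule ext, subst dir_deriv_eq[OF has_derivative_product_function[OF assms]],
        simp add: dir_deriv_def linear_0)+
qed

lemma smooth_product_function:
  assumes "smooth (\<phi> :: 'a::euclidean_space \<Rightarrow> real)" "smooth (\<psi> :: 'b::euclidean_space \<Rightarrow> real)"
  shows "smooth (\<lambda>z. \<phi> (fst z) * \<psi> (snd z))"
proof -
  define S where "S = {\<lambda>z. \<phi> (fst z) * \<psi> (snd z) | (\<phi> :: 'a \<Rightarrow> real) (\<psi> :: 'b \<Rightarrow> real). smooth \<phi> \<and> smooth \<psi>}"
  show ?thesis
  proof (rule smooth_function_algebra[of S])
    show "f differentiable (at x)" if "f \<in> S" for f x
      using that has_derivative_product_function unfolding S_def differentiable_def by blast
    show "dir_deriv e f \<in> function_algebra S" if "f \<in> S" "e \<in> Basis" for f e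
      using that unfolding S_def Basis_prod_def
      by (auto simp: dir_deriv_product_function intro!: function_algebra.base smooth_dir_deriv)
        (use smooth_dir_deriv in blast)+
    show "(\<lambda>z. \<phi> (fst z) * \<psi> (snd z)) \<in> function_algebra S"
      using assms unfolding S_def by (intro function_algebra.base) blast
  qed
qed

lemma test_functions_product:
  assumes "\<phi> \<in> test_functions A" "\<psi> \<in> test_functions B"
  shows "(\<lambda>z. \<phi> (fst z) * \<psi> (snd z)) \<in> test_functions (A \<times> B)"
proof -
  obtain K where "compact K" "K \<subseteq> A" "{x. \<phi> x \<noteq> 0} \<subseteq> K"
    using assms(1) by (rule test_functions_compact_support)
  moreover obtain L where "compact L" "L \<subseteq> B" "{x. \<psi> x \<noteq> 0} \<subseteq> L"
    using assms(2) by (rule test_functions_compact_support)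
  ultimately show ?thesis
    using assms by (intro test_functionsI[of _ "K \<times> L"])
      (auto intro: smooth_product_function test_functions_smooth compact_Times)
qed

lemma inner_lap_test:
  assumes "F \<in> Sob 2" "\<phi> \<in> test_functions UNIV"
  shows "inner (lap F) (abs_lsq \<phi>) = (\<Sum>e\<in>Basis. inner F (abs_lsq (partials [e, e] \<phi>)))"
  using assms inner_partials[OF assms(2), of "[e, e]" F for e]
  by (simp add: lap_def inner_sum_left numeral_2_eq_2 del: Sob.simps)

text \<open>Testing with products \<phi>(x) \<psi>(t) suffices: for fixed \<phi> the equation
  becomes a scalar second order equation in time, solved classically by
  \<open>weak_second_derivative\<close>. As the right side is norm continuous, the scalar
  derivatives combine to a strong one.\<close>

lemma solution_second_derivative:
  fixes u :: "real \<Rightarrow> 'a::euclidean_space \<Rightarrow> real"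
  assumes T: "T > 0" and sol: "is_solution a b T u"
    and u: "\<And>t. t \<in> {0..<T} \<Longrightarrow> u t \<in> L2"
    and U: "Sob_continuous_on {0..<T} 2 (\<lambda>t. abs_lsq (u t))"
    and UV: "Sob_deriv_on {0..<T} 0 (\<lambda>t. abs_lsq (u t)) V" and V: "continuous_on {0..<T} V"
    and q: "continuous_on {0..<T} (q_fun a b u)" "\<And>t. t \<in> {0..<T} \<Longrightarrow> q_fun a b u t \<noteq> 0"
  shows "Sob_deriv_on {0..<T} 0 V (\<lambda>t. lap (abs_lsq (u t)) /\<^sub>R (q_fun a b u t)\<^sup>2)"
proof -
  let ?q = "q_fun a b u" and ?U = "\<lambda>t. abs_lsq (u t)"
  let ?W = "\<lambda>t. lap (?U t) /\<^sub>R (?q t)\<^sup>2"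
  have "continuous_on {0..<T} (\<lambda>t. lap (?U t))"
    using U unfolding lap_def by (auto simp: numeral_2_eq_2 intro!: continuous_on_sum)
  then have W: "continuous_on {0..<T} ?W"
    using q by (intro continuous_intros) auto
  show ?thesis
    unfolding Sob_deriv_on.simps
  proof
    fix t assume t: "t \<in> {0..<T}"
    show "(V has_vector_derivative ?W t) (at t within {0..<T})"
    proof (rule has_vector_derivative_weak[OF _ t])
      show "continuous (at t within {0..<T}) ?W"
        using W t by (simp add: continuous_on_eq_continuous_within)
      fix s and \<phi>' :: "'a lsq" assume s: "s \<in> {0..<T}" and "\<phi>' \<in> test_vectors"
      then obtain \<phi> where \<phi>: "\<phi> \<in> test_functions UNIV" "\<phi>' = abs_lsq \<phi>"
        by (auto simp: test_vectors_def)
      show "((\<lambda>s. inner (V s) \<phi>') has_real_derivative inner (?W s) \<phi>') (at s within {0..<T})"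
      proof (rule weak_second_derivative[OF T _ _ _ _ s])
        show "((\<lambda>s. inner (?U s) \<phi>') has_real_derivative inner (V t) \<phi>') (at t within {0..<T})"
          if "t \<in> {0..<T}" for t
          using UV that by (auto intro: has_real_derivative_inner_left)
        show "continuous_on {0..<T} (\<lambda>s. inner (V s) \<phi>')" "continuous_on {0..<T} (\<lambda>s. inner (?W s) \<phi>')"
          using V W by (auto intro!: continuous_intros simp del: inner_scaleR_left)
        fix \<psi> assume \<psi>: "\<psi> \<in> test_functions {0<..<T}"
        let ?\<Phi> = "\<lambda>z. \<phi> (fst z) * \<psi> (snd z)"
        have sm: "smooth \<phi>" "smooth \<psi>" "smooth (dir_deriv 1 \<psi>)" "\<And>e. e \<in> Basis \<Longrightarrow> smooth (dir_deriv e \<phi>)"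
          using \<phi> \<psi> by (auto intro: test_functions_smooth smooth_dir_deriv)
        have tt: "partials [(0, 1), (0, 1)] ?\<Phi> (x, t) = dir_deriv 1 (dir_deriv 1 \<psi>) t * \<phi> x" for x t
          using sm by (simp add: partials_Cons dir_deriv_product_function)
        have xx: "partials [(e, 0), (e, 0)] ?\<Phi> (x, t) = \<psi> t * partials [e, e] \<phi> x" if "e \<in> Basis" for e x t
          using sm that by (simp add: partials_Cons dir_deriv_product_function)
        have eq: "(LINT x|lborel. u t x * partials [(0, 1), (0, 1)] ?\<Phi> (x, t)) -
             (LINT x|lborel. u t x * (\<Sum>e\<in>Basis. partials [(e, 0), (e, 0)] ?\<Phi> (x, t))) / (?q t)\<^sup>2 =
             inner (?U t) \<phi>' * dir_deriv 1 (dir_deriv 1 \<psi>) t - inner (?W t) \<phi>' * \<psi> t"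
          if "t \<in> {0<..<T}" for t
        proof -
          have t: "t \<in> {0..<T}" using that by auto
          have "(LINT x|lborel. u t x * partials [(0, 1), (0, 1)] ?\<Phi> (x, t)) =
              (LINT x|lborel. dir_deriv 1 (dir_deriv 1 \<psi>) t * (u t x * \<phi> x))"
            unfolding tt by (simp add: mult_ac)
          also have "\<dots> = inner (?U t) \<phi>' * dir_deriv 1 (dir_deriv 1 \<psi>) t"
            using u[OF t] \<phi> by (simp add: inner_abs_lsq test_functions_L2)
          finally have 1: "(LINT x|lborel. u t x * partials [(0, 1), (0, 1)] ?\<Phi> (x, t)) =
              inner (?U t) \<phi>' * dir_deriv 1 (dir_deriv 1 \<psi>) t" .
          have p: "partials [e, e] \<phi> \<in> L2" if "e \<in> Basis" for e
            using that by (intro test_functions_L2[OF test_functions_partials[OF \<phi>(1)]]) auto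
          have "(LINT x|lborel. u t x * (\<Sum>e\<in>Basis. partials [(e, 0), (e, 0)] ?\<Phi> (x, t))) =
              (LINT x|lborel. \<psi> t * (\<Sum>e\<in>Basis. u t x * partials [e, e] \<phi> x))"
            by (simp add: xx sum_distrib_left mult_ac)
          also have "\<dots> = \<psi> t * (\<Sum>e\<in>Basis. LINT x|lborel. u t x * partials [e, e] \<phi> x)"
            using p u[OF t] by (simp add: Bochner_Integration.integral_sum L2_mult_integrable)
          also have "\<dots> = \<psi> t * inner (lap (?U t)) \<phi>'"
            using p u[OF t] \<phi> inner_lap_test[OF Sob_continuous_on_imp(2)[OF U t] \<phi>(1)]
            by (simp add: inner_abs_lsq)
          finally have 2: "(LINT x|lborel. u t x * (\<Sum>e\<in>Basis. partials [(e, 0), (e, 0)] ?\<Phi> (x, t))) =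
              \<psi> t * inner (lap (?U t)) \<phi>'" .
          show ?thesis unfolding 1 2 by (simp add: divide_inverse mult_ac)
        qed
        have "?\<Phi> \<in> test_functions (UNIV \<times> {0<..<T})"
          by (rule test_functions_product[OF \<phi>(1) \<psi>])
        then have "(LINT t:{0<..<T}|lborel. (LINT x|lborel. u t x * partials [(0, 1), (0, 1)] ?\<Phi> (x, t)) -
             (LINT x|lborel. u t x * (\<Sum>e\<in>Basis. partials [(e, 0), (e, 0)] ?\<Phi> (x, t))) / (?q t)\<^sup>2) = 0"
          using sol unfolding is_solution_def by blast
        also have "(LINT t:{0<..<T}|lborel. (LINT x|lborel. u t x * partials [(0, 1), (0, 1)] ?\<Phi> (x, t)) -
             (LINT x|lborel. u t x * (\<Sum>e\<in>Basis. partials [(e, 0), (e, 0)] ?\<Phi> (x, t))) / (?q t)\<^sup>2) =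
           (LINT t:{0<..<T}|lborel. inner (?U t) \<phi>' * dir_deriv 1 (dir_deriv 1 \<psi>) t - inner (?W t) \<phi>' * \<psi> t)"
          by (rule set_lebesgue_integral_cong) (use eq in auto)
        finally show "(LINT t:{0<..<T}|lborel. inner (?U t) \<phi>' * dir_deriv 1 (dir_deriv 1 \<psi>) t - inner (?W t) \<phi>' * \<psi> t) = 0" .
      qed
    qed simp
  qed
qed

section \<open>The lower order functional\<close>

text \<open>
  With \<open>A\<^sub>j = \<parallel>\<nabla>\<^sup>j u\<parallel>\<^sup>2\<close>, the quotient \<open>z\<^sub>j = A\<^sub>j / q\<close> is \<open>quot_poly j\<close>, the second derivative \<open>A\<^sub>j''\<close> is
  \<open>second_poly j\<close>, and \<open>pair_poly i d\<close> is a primitive of \<open>z\<^sub>i' z\<^sub>j\<close> for \<open>j = i + d\<close>.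
\<close>

definition quot_poly :: "nat \<Rightarrow> (arg \<Rightarrow> real) \<Rightarrow> real" where
  "quot_poly i X = X Q_inv * X (Nabla_u i)"

definition second_poly :: "nat \<Rightarrow> (arg \<Rightarrow> real) \<Rightarrow> real" where
  "second_poly i X = 2 * X (Nabla_ut i) + (- 2) * (X (Nabla_u (Suc i)) * (X Q_inv * X Q_inv))"

fun pair_poly :: "nat \<Rightarrow> nat \<Rightarrow> (arg \<Rightarrow> real) \<Rightarrow> real" where
  "pair_poly i 0 X = (1 / 2) * (quot_poly i X * quot_poly i X)"
| "pair_poly i (Suc 0) X = quot_poly i X * quot_poly (Suc i) X
     + ((1 / 4) * (X (Nabla_u i) * second_poly i X) + (- 1 / 2) * (X (Nabla_mixed i) * X (Nabla_mixed i)))"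
| "pair_poly i (Suc (Suc d)) X = quot_poly i X * quot_poly (Suc (Suc (i + d))) X
     + ((1 / 4) * (X (Nabla_u i) * second_poly (Suc (i + d)) X + second_poly i X * X (Nabla_u (Suc (i + d))))
        + (- 1) * (X (Nabla_mixed i) * X (Nabla_mixed (Suc (i + d)))))
     + pair_poly (Suc i) d X"

text \<open>Since q'' = a A_1'' and B_(m+1) = A_(m+1)' / 2, integrating q'' B_(m+1) by parts gives
  (a/2) A_1'' A_(m+1) minus the integral of (a/2) A_1''' A_(m+1). By the recursion the latter
  integrand is - 2 a z_2' z_(m+1), whence the constant 2 a and the pair from 2 to 2 + (m - 1) = m +
  1.\<close>

definition lower_poly :: "real \<Rightarrow> nat \<Rightarrow> (arg \<Rightarrow> real) \<Rightarrow> real" where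
  "lower_poly a m X = (a / 2) * (second_poly 1 X * X (Nabla_u (Suc m))) + (2 * a) * pair_poly 2 (m - 1) X"

text \<open>The arguments expressible by q and the moments. Over them a polynomial can be evaluated
  in the abstract \<open>moment_system\<close>, which carries no higher time derivatives of
  q.\<close>

definition moment_args :: "nat \<Rightarrow> arg set" where
  "moment_args l = {Q_inv} \<union> Nabla_u ` {1..l} \<union> Nabla_ut ` {1..<l} \<union> Nabla_mixed ` {1..<l}"

lemma moment_args_memI:
  "Q_inv \<in> moment_args l"
  "1 \<le> i \<Longrightarrow> i \<le> l \<Longrightarrow> Nabla_u i \<in> moment_args l"
  "1 \<le> i \<Longrightarrow> i < l \<Longrightarrow> Nabla_ut i \<in> moment_args l"
  "1 \<le> i \<Longrightarrow> i < l \<Longrightarrow> Nabla_mixed i \<in> moment_args l"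
  by (auto simp: moment_args_def)

lemma moment_args_subset: "moment_args l \<subseteq> args l"
  by (auto simp: moment_args_def args_def)

lemma polynomials_mono: "P \<in> polynomials V \<Longrightarrow> V \<subseteq> V' \<Longrightarrow> P \<in> polynomials V'"
  by (induction rule: polynomials.induct) (auto intro: polynomials.intros)

lemma polynomials_cong:
  assumes "P \<in> polynomials V" "\<And>v. v \<in> V \<Longrightarrow> X v = Y v"
  shows "P X = P Y"
  using assms by induction auto

lemma quot_poly_polynomials: "1 \<le> i \<Longrightarrow> i \<le> l \<Longrightarrow> quot_poly i \<in> polynomials (moment_args l)"
  unfolding quot_poly_def by (intro polynomials.intros moment_args_memI)

lemma second_poly_polynomials: "1 \<le> i \<Longrightarrow> i < l \<Longrightarrow> second_poly i \<in> polynomials (moment_args l)"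
  unfolding second_poly_def by (intro polynomials.intros moment_args_memI) auto

lemma pair_poly_polynomials: "1 \<le> i \<Longrightarrow> i + d \<le> l \<Longrightarrow> pair_poly i d \<in> polynomials (moment_args l)"
proof (induction d arbitrary: i rule: induct_nat_012)
  case 0
  then show ?case
    unfolding pair_poly.simps(1)[abs_def] by (intro polynomials.intros quot_poly_polynomials) auto
next
  case 1
  then show ?case
    unfolding pair_poly.simps(2)[abs_def]
    by (intro polynomials.intros quot_poly_polynomials second_poly_polynomials moment_args_memI) auto
next
  case (ge2 d)
  then show ?case
    unfolding pair_poly.simps(3)[abs_def]
    by (intro polynomials.intros quot_poly_polynomials second_poly_polynomials moment_args_memI ge2.IH) auto
qed

lemma lower_poly_polynomials: "1 \<le> m \<Longrightarrow> lower_poly a m \<in> polynomials (moment_args (Suc m))"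
  unfolding lower_poly_def
  by (intro polynomials.intros pair_poly_polynomials second_poly_polynomials moment_args_memI) auto

section \<open>The moment equations and a primitive of q'' B\<close>

text \<open>Reduces the algebra to ordinary differential equations: A, B, C stand for the moments of
  (u,u), (u,u_t), (u_t,u_t). \<open>B_deriv\<close> and \<open>C_deriv\<close> stop one order below
  \<open>A_deriv\<close>, since they differentiate u_t, whose derivative is available in
  H^m.\<close>

locale moment_system =
  fixes S :: "real set" and a b :: real and m :: nat and A B C :: "nat \<Rightarrow> real \<Rightarrow> real" and q :: "real \<Rightarrow> real"
  assumes q_eq: "t \<in> S \<Longrightarrow> q t = a * A 1 t + b" and q_nz: "t \<in> S \<Longrightarrow> q t \<noteq> 0"
    and A_deriv: "j \<le> Suc m \<Longrightarrow> t \<in> S \<Longrightarrow> (A j has_real_derivative 2 * B j t) (at t within S)"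
    and B_deriv: "j \<le> m \<Longrightarrow> t \<in> S \<Longrightarrow> (B j has_real_derivative C j t - A (Suc j) t / (q t)\<^sup>2) (at t within S)"
    and C_deriv: "j \<le> m \<Longrightarrow> t \<in> S \<Longrightarrow> (C j has_real_derivative - 2 * B (Suc j) t / (q t)\<^sup>2) (at t within S)"
    and m: "1 \<le> m"
begin

definition q' :: "real \<Rightarrow> real" where "q' t = 2 * a * B 1 t"

definition q'' :: "real \<Rightarrow> real" where "q'' t = 2 * a * (C 1 t - A 2 t / (q t)\<^sup>2)"

lemma q_deriv: "t \<in> S \<Longrightarrow> (q has_real_derivative q' t) (at t within S)"
proof -
  assume t: "t \<in> S"
  have "((\<lambda>t. a * A 1 t + b) has_real_derivative q' t) (at t within S)"
    using A_deriv[of 1, OF _ t] by (auto intro!: derivative_eq_intros simp: q'_def)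
  then show ?thesis
    unfolding has_real_derivative_iff_has_vector_derivative
    by (rule has_vector_derivative_transform[OF t, rotated]) (rule q_eq)
qed

lemma q'_deriv: "t \<in> S \<Longrightarrow> (q' has_real_derivative q'' t) (at t within S)"
proof -
  assume t: "t \<in> S"
  have "((\<lambda>t. 2 * a * B 1 t) has_real_derivative q'' t) (at t within S)"
    using B_deriv[of 1, OF _ t] m by (auto intro!: derivative_eq_intros simp: q''_def numeral_2_eq_2)
  then show ?thesis by (simp add: q'_def[abs_def])
qed

definition z' :: "nat \<Rightarrow> real \<Rightarrow> real" where
  "z' j t = 2 * B j t / q t - A j t * q' t / (q t)\<^sup>2"

definition X :: "real \<Rightarrow> arg \<Rightarrow> real" where
  "X t = (\<lambda>v. case v of Q_inv \<Rightarrow> inverse (q t) | Q_deriv h \<Rightarrow> 0 | Nabla_u i \<Rightarrow> A i t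
     | Nabla_ut i \<Rightarrow> C i t | Nabla_mixed i \<Rightarrow> B i t)"

lemma X_simps [simp]:
  "X t Q_inv = inverse (q t)" "X t (Nabla_u i) = A i t" "X t (Nabla_ut i) = C i t" "X t (Nabla_mixed i) = B i t"
  by (simp_all add: X_def)

lemma quot_poly_deriv:
  "j \<le> Suc m \<Longrightarrow> t \<in> S \<Longrightarrow> ((\<lambda>t. quot_poly j (X t)) has_real_derivative z' j t) (at t within S)"
  unfolding quot_poly_def X_simps
  using q_nz[of t]
  by (auto intro!: derivative_eq_intros A_deriv q_deriv simp: z'_def field_simps power2_eq_square)

lemma second_poly_deriv:
  "j \<le> m \<Longrightarrow> t \<in> S \<Longrightarrow>
    ((\<lambda>t. second_poly j (X t)) has_real_derivative - (4 / q t) * z' (Suc j) t) (at t within S)"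
  unfolding second_poly_def X_simps
  using q_nz[of t]
  by (auto intro!: derivative_eq_intros A_deriv C_deriv q_deriv simp: z'_def field_simps power2_eq_square)

lemma B_deriv': "j \<le> m \<Longrightarrow> t \<in> S \<Longrightarrow> (B j has_real_derivative second_poly j (X t) / 2) (at t within S)"
proof -
  assume j: "j \<le> m" and t: "t \<in> S"
  have "second_poly j (X t) / 2 = C j t - A (Suc j) t / (q t)\<^sup>2"
    using q_nz[OF t] by (simp add: second_poly_def field_simps power2_eq_square)
  then show ?thesis using B_deriv[OF j t] by (simp only:)
qed

text \<open>
  As \<open>A\<^sub>j''' = - (4 / q) z\<^sub>j\<^sub>+\<^sub>1'\<close> (a recursion of Lenard type), integrating by parts moves one index from the
  second to the first factor of \<open>z\<^sub>i' z\<^sub>j\<close>.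
\<close>

lemma pair_poly_deriv:
  "i + d \<le> Suc m \<Longrightarrow> t \<in> S \<Longrightarrow>
    ((\<lambda>t. pair_poly i d (X t)) has_real_derivative z' i t * quot_poly (i + d) (X t)) (at t within S)"
proof (induction d arbitrary: i rule: induct_nat_012)
  case 0
  then show ?case
    unfolding pair_poly.simps by (auto intro!: derivative_eq_intros quot_poly_deriv)
next
  \<comment> \<open>A_i A_i'' - (A_i')^2 / 2 has derivative A_i A_i''', and a quarter of that is -
    z_i z_(i+1)'. The coefficient - 1/2 of B_i^2 arises from B_i = A_i' / 2.\<close>
  case 1
  then have *: "i \<le> m" "i \<le> Suc m" "Suc i \<le> Suc m" by auto
  have "A i t = q t * quot_poly i (X t)" "q t \<noteq> 0" using q_nz 1 by (simp_all add: quot_poly_def)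
  then show ?case
    unfolding pair_poly.simps X_simps using 1 *
    by (auto intro!: derivative_eq_intros quot_poly_deriv second_poly_deriv A_deriv B_deriv'
        simp: field_simps)
next
  \<comment> \<open>Let j = i + d + 1. The bracket A_i A_j'' + A_i'' A_j - A_i' A_j' has derivative
    A_i A_j''' + A_i''' A_j, which expresses the skewness of the third derivative. A quarter of it
    is - z_i z_(j+1)' - z_(i+1)' z_j: the first term reduces (z_i z_(j+1))' to z_i' z_(j+1), the
    second cancels the derivative of \<open>pair_poly (Suc i) d\<close>.\<close>
  case (ge2 d)
  then have *: "i \<le> m" "i \<le> Suc m" "Suc (i + d) \<le> m" "Suc (i + d) \<le> Suc m" "Suc (Suc (i + d)) \<le> Suc m"
    "Suc i + d \<le> Suc m" by auto
  have "A i t = q t * quot_poly i (X t)" "A (Suc (i + d)) t = q t * quot_poly (Suc (i + d)) (X t)" "q t \<noteq> 0"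
    using q_nz ge2(4) by (simp_all add: quot_poly_def)
  then show ?case
    unfolding pair_poly.simps X_simps using ge2(4) *
    by (auto intro!: derivative_eq_intros quot_poly_deriv second_poly_deriv A_deriv B_deriv' ge2.IH(1)[OF *(6)]
        simp: field_simps)
qed

lemma lower_poly_deriv:
  assumes t: "t \<in> S"
  shows "((\<lambda>t. lower_poly a m (X t)) has_real_derivative q'' t * B (Suc m) t) (at t within S)"
proof -
  have 2: "2 + (m - 1) = Suc m" using m by simp
  have z: "A (Suc m) t / q t = quot_poly (Suc m) (X t)" by (simp add: quot_poly_def divide_inverse)
  have q'': "q'' t = a * second_poly 1 (X t)"
    using q_nz[OF t] by (simp add: q''_def second_poly_def field_simps power2_eq_square numeral_2_eq_2)
  have "((\<lambda>t. lower_poly a m (X t)) has_real_derivative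
      (a / 2) * (- (4 / q t) * z' 2 t * A (Suc m) t + 2 * B (Suc m) t * second_poly 1 (X t))
      + (2 * a) * (z' 2 t * quot_poly (Suc m) (X t))) (at t within S)"
    unfolding lower_poly_def X_simps
    using second_poly_deriv[of 1, OF _ t] m pair_poly_deriv[of 2 "m - 1", OF _ t] A_deriv[OF order_refl t]
    by (intro DERIV_add DERIV_cmult DERIV_mult) (simp_all add: 2 numeral_2_eq_2)
  \<comment> \<open>The z_2' terms cancel because A_(m+1) / q = z_(m+1).\<close>
  moreover have "(a / 2) * (- (4 / q t) * z' 2 t * A (Suc m) t + 2 * B (Suc m) t * second_poly 1 (X t))
      + (2 * a) * (z' 2 t * quot_poly (Suc m) (X t)) = q'' t * B (Suc m) t"
    unfolding q'' z[symmetric] by (simp add: algebra_simps)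
  ultimately show ?thesis by simp
qed

end

section \<open>The energy identity\<close>

text \<open>The solution as a pair of Hilbert space curves, with u_t = V known in H^(m+1) and V' at
  first only in L^2.\<close>

locale evolution =
  fixes T a b :: real and m :: nat and U V :: "real \<Rightarrow> 'a::euclidean_space lsq"
  assumes T: "T > 0" and m: "1 \<le> m"
    and U: "Sob_continuous_on {0..<T} (Suc (Suc m)) U" and V: "Sob_continuous_on {0..<T} (Suc m) V"
    and U_deriv: "Sob_deriv_on {0..<T} (Suc m) U V"
    and V_deriv: "Sob_deriv_on {0..<T} 0 V (\<lambda>t. lap (U t) /\<^sub>R (a * nabla_form (Suc 0) (U t) (U t) + b)\<^sup>2)"
    and q_nz: "t \<in> {0..<T} \<Longrightarrow> a * nabla_form (Suc 0) (U t) (U t) + b \<noteq> 0"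
begin

abbreviation q :: "real \<Rightarrow> real" where "q t \<equiv> a * nabla_form (Suc 0) (U t) (U t) + b"

text \<open>U has m + 2 derivatives, so the right side of the equation is continuous into H^m, and
  \<open>Sob_deriv_onI\<close> upgrades the time derivative of V from L^2 to H^m.\<close>

lemma V_deriv_m: "Sob_deriv_on {0..<T} m V (\<lambda>t. lap (U t) /\<^sub>R (q t)\<^sup>2)"
proof (rule Sob_deriv_onI)
  have cont_q: "continuous_on {0..<T} q"
    using Sob_continuous_on_mono[OF U, of 1]
    by (auto intro!: continuous_intros nabla_form_continuous_on simp del: Sob_continuous_on.simps nabla_form.simps)
  have lap: "Sob_continuous_on {0..<T} n (\<lambda>t. lap (F t))" if "Sob_continuous_on {0..<T} (Suc (Suc n)) F"
    for n and F :: "real \<Rightarrow> 'a lsq"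
    using that
  proof (induction n arbitrary: F)
    case 0
    then show ?case unfolding lap_def by (auto intro!: continuous_on_sum)
  next
    case (Suc n)
    have mem: "F t \<in> Sob (Suc (Suc (Suc n)))" if "t \<in> {0..<T}" for t
      using Sob_continuous_on_imp(2)[OF Suc.prems that] .
    have "Sob_continuous_on {0..<T} n (\<lambda>t. pd e (lap (F t)))" if "e \<in> Basis" for e
    proof (rule Sob_continuous_on_cong)
      show "Sob_continuous_on {0..<T} n (\<lambda>t. lap (pd e (F t)))"
        using Suc.prems that by (intro Suc.IH) auto
    qed (use that in \<open>simp add: pd_lap[OF mem]\<close>)
    moreover have "continuous_on {0..<T} (\<lambda>t. lap (F t))"
      using Suc.prems unfolding lap_def by (auto intro!: continuous_on_sum)
    ultimately show ?case using mem by (simp add: lap_Sob del: Sob.simps)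
  qed
  have scale: "Sob_continuous_on {0..<T} n (\<lambda>t. c t *\<^sub>R F t)"
    if "Sob_continuous_on {0..<T} n F" "continuous_on {0..<T} c" for n c and F :: "real \<Rightarrow> 'a lsq"
    using that
  proof (induction n arbitrary: F)
    case 0
    then show ?case by (auto intro!: continuous_intros)
  next
    case (Suc n)
    have mem: "F t \<in> Sob (Suc n)" if "t \<in> {0..<T}" for t
      using Sob_continuous_on_imp(2)[OF Suc.prems(1) that] .
    have "Sob_continuous_on {0..<T} n (\<lambda>t. pd e (c t *\<^sub>R F t))" if "e \<in> Basis" for e
    proof (rule Sob_continuous_on_cong)
      show "Sob_continuous_on {0..<T} n (\<lambda>t. c t *\<^sub>R pd e (F t))"
        using Suc.prems that by (intro Suc.IH) auto
    qed (use that in \<open>simp add: pd_scaleR[OF mem]\<close>)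
    moreover have "continuous_on {0..<T} (\<lambda>t. c t *\<^sub>R F t)"
      using Suc.prems by (auto intro!: continuous_intros)
    ultimately show ?case using mem by (simp add: Sob_scaleR del: Sob.simps)
  qed
  show "Sob_continuous_on {0..<T} m (\<lambda>t. lap (U t) /\<^sub>R (q t)\<^sup>2)"
    using q_nz by (intro scale lap U continuous_intros cont_q) auto
  show "V t \<in> Sob m" if "t \<in> {0..<T}" for t
    using Sob_continuous_on_imp(2)[OF V that] by (rule Sob_SucD)
qed (use V_deriv in auto)

text \<open>Product rule for the forms, then \<open>nabla_form_lap\<close> to turn the Laplacian in
  V' into a form of order j + 1.\<close>

sublocale moment_system "{0..<T}" a b m "\<lambda>j t. nabla_form j (U t) (U t)" "\<lambda>j t. nabla_form j (U t) (V t)"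
  "\<lambda>j t. nabla_form j (V t) (V t)" q
proof
  fix t j assume t: "t \<in> {0..<T}"
  show "q t = a * nabla_form 1 (U t) (U t) + b" "q t \<noteq> 0" using q_nz[OF t] by simp_all
  show "((\<lambda>t. nabla_form j (U t) (U t)) has_real_derivative 2 * nabla_form j (U t) (V t)) (at t within {0..<T})"
    if "j \<le> Suc m"
    using nabla_form_has_derivative[OF Sob_deriv_on_mono[OF U_deriv that] Sob_deriv_on_mono[OF U_deriv that] t]
    by (simp add: nabla_form_commute[of j "V t"])
  assume j: "j \<le> m"
  have Um: "U t \<in> Sob (Suc (Suc m))" and Vm: "V t \<in> Sob (Suc m)"
    using Sob_continuous_on_imp(2) U V t by blast+
  have lapm: "lap (U t) \<in> Sob j" using lap_Sob[OF Um] j by (rule Sob_mono)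
  have form_lap: "nabla_form j F (lap (U t) /\<^sub>R (q t)\<^sup>2) = - nabla_form (Suc j) F (U t) / (q t)\<^sup>2"
    if "F \<in> Sob (Suc m)" for F
    using nabla_form_lap[OF Sob_mono[OF that, of "Suc j"] Sob_mono[OF Um, of "Suc (Suc j)"]] j lapm
    by (simp add: nabla_form_scaleR_right divide_inverse mult.commute del: nabla_form.simps)
  have dU: "Sob_deriv_on {0..<T} j U V" using Sob_deriv_on_mono[OF U_deriv] j by auto
  have dV: "Sob_deriv_on {0..<T} j V (\<lambda>t. lap (U t) /\<^sub>R (q t)\<^sup>2)" using Sob_deriv_on_mono[OF V_deriv_m j] .
  show "((\<lambda>t. nabla_form j (U t) (V t)) has_real_derivative
      nabla_form j (V t) (V t) - nabla_form (Suc j) (U t) (U t) / (q t)\<^sup>2) (at t within {0..<T})"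
    using nabla_form_has_derivative[OF dU dV t] form_lap[OF Sob_SucD[OF Um]]
    by (simp add: del: nabla_form.simps)
  show "((\<lambda>t. nabla_form j (V t) (V t)) has_real_derivative
      - 2 * nabla_form (Suc j) (U t) (V t) / (q t)\<^sup>2) (at t within {0..<T})"
    using nabla_form_has_derivative[OF dV dV t] form_lap[OF Vm]
    by (simp add: nabla_form_commute[of j _ "V t"] nabla_form_commute[of "Suc j" "V t"] del: nabla_form.simps)
qed (rule m)

end

context evolution
begin

section \<open>The energy and its difference quotient version\<close>

text \<open>I_k for k = m + 2.\<close>

definition energy :: "real \<Rightarrow> real" where
  "energy t = q t * nabla_form (Suc m) (V t) (V t) + nabla_form (Suc (Suc m)) (U t) (U t) / q t
     - q' t * nabla_form (Suc m) (U t) (V t) + lower_poly a m (X t)"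

definition kinetic_diff :: "real \<Rightarrow> real \<Rightarrow> real" where
  "kinetic_diff h t = (\<Sum>e\<in>Basis. nabla_form m (diff_op h e (V t)) (diff_op h e (V t)))"

definition potential_diff :: "real \<Rightarrow> real \<Rightarrow> real" where
  "potential_diff h t = (\<Sum>e\<in>Basis. nabla_form (Suc m) (diff_op h e (U t)) (diff_op h e (U t)))"

definition mixed_diff :: "real \<Rightarrow> real \<Rightarrow> real" where
  "mixed_diff h t = (\<Sum>e\<in>Basis. nabla_form m (diff_op h e (U t)) (diff_op h e (V t)))"

text \<open>
  \<open>\<parallel>\<nabla>\<^sup>k u\<parallel>\<^sup>2\<close> and \<open>\<parallel>\<nabla>\<^sup>k\<^sup>-\<^sup>1 u\<^sub>t\<parallel>\<^sup>2\<close> are merely continuous in time, so one derivative is replaced by a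
  difference quotient in space.
\<close>

definition energy_diff :: "real \<Rightarrow> real \<Rightarrow> real" where
  "energy_diff h t = q t * kinetic_diff h t + potential_diff h t / q t - q' t * mixed_diff h t
     + lower_poly a m (X t)"

lemma U_Sob: "t \<in> {0..<T} \<Longrightarrow> U t \<in> Sob (Suc (Suc m))"
  and V_Sob: "t \<in> {0..<T} \<Longrightarrow> V t \<in> Sob (Suc m)"
  using Sob_continuous_on_imp(2) U V by blast+

text \<open>Space difference quotients commute with the Laplacian and with time differentiation, so
  the formal cancellation goes through one order lower. The two q'' terms no longer cancel exactly:
  the product rule yields \<open>mixed_diff\<close>, whereas \<open>lower_poly\<close> contributes
  the true mixed moment.\<close>

lemma energy_diff_deriv:
  assumes t: "t \<in> {0..<T}"
  shows "(energy_diff h has_real_derivative q'' t * (nabla_form (Suc m) (U t) (V t) - mixed_diff h t))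
    (at t within {0..<T})"
    and "(mixed_diff h has_real_derivative kinetic_diff h t - potential_diff h t / (q t)\<^sup>2) (at t within {0..<T})"
proof -
  \<comment> \<open>The difference quotient substitute for B_k; it enters as - 2 Y / q from the
    kinetic and + 2 Y / q from the potential part.\<close>
  define Y where "Y = (\<Sum>e\<in>Basis. nabla_form (Suc m) (diff_op h e (U t)) (diff_op h e (V t)))"
  let ?W = "\<lambda>t. lap (U t) /\<^sub>R (q t)\<^sup>2"
  have dU: "Sob_deriv_on {0..<T} (Suc m) (\<lambda>t. diff_op h e (U t)) (\<lambda>t. diff_op h e (V t))"
    and dV: "Sob_deriv_on {0..<T} m (\<lambda>t. diff_op h e (V t)) (\<lambda>t. diff_op h e (?W t))" for e
    by (intro Sob_deriv_on_diff_op U_deriv V_deriv_m)+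
  note dU' = Sob_deriv_on_SucD[OF dU]
  have form: "nabla_form m (diff_op h e F) (diff_op h e (?W t)) =
      - nabla_form (Suc m) (diff_op h e F) (diff_op h e (U t)) / (q t)\<^sup>2"
    if F: "F \<in> Sob (Suc m)" for F e
  proof -
    have "diff_op h e (?W t) = lap (diff_op h e (U t)) /\<^sub>R (q t)\<^sup>2"
      using lap_diff_op[OF U_Sob[OF t]] linear_scale[OF bounded_linear.linear[OF bounded_linear_diff_op]]
      by simp
    then show ?thesis
      using nabla_form_lap[OF Sob_diff_op[OF F] Sob_diff_op[OF U_Sob[OF t]], of h e h e]
        lap_Sob[OF Sob_diff_op[OF U_Sob[OF t]], of h e]
      by (simp add: nabla_form_scaleR_right divide_inverse mult.commute del: nabla_form.simps Sob.simps)
  qed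
  have K: "(kinetic_diff h has_real_derivative (- 2 / (q t)\<^sup>2) * Y) (at t within {0..<T})"
  proof -
    have "(kinetic_diff h has_real_derivative (\<Sum>e\<in>Basis.
        nabla_form m (diff_op h e (V t)) (diff_op h e (?W t)) +
        nabla_form m (diff_op h e (?W t)) (diff_op h e (V t)))) (at t within {0..<T})"
      unfolding kinetic_diff_def[abs_def] by (intro DERIV_sum nabla_form_has_derivative dV t)
    moreover have "nabla_form m (diff_op h e (V t)) (diff_op h e (?W t)) +
        nabla_form m (diff_op h e (?W t)) (diff_op h e (V t)) =
        (- 2 / (q t)\<^sup>2) * nabla_form (Suc m) (diff_op h e (U t)) (diff_op h e (V t))" for e
      unfolding nabla_form_commute[of m "diff_op h e (?W t)"] form[OF V_Sob[OF t]]
        nabla_form_commute[of "Suc m" "diff_op h e (V t)"] by simp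
    ultimately show ?thesis by (simp only: Y_def sum_distrib_left[symmetric])
  qed
  have P: "(potential_diff h has_real_derivative 2 * Y) (at t within {0..<T})"
  proof -
    have "(potential_diff h has_real_derivative (\<Sum>e\<in>Basis.
        nabla_form (Suc m) (diff_op h e (U t)) (diff_op h e (V t)) +
        nabla_form (Suc m) (diff_op h e (V t)) (diff_op h e (U t)))) (at t within {0..<T})"
      unfolding potential_diff_def[abs_def] by (intro DERIV_sum nabla_form_has_derivative dU t)
    then show ?thesis
      by (simp add: Y_def nabla_form_commute[of "Suc m" "diff_op h _ (V t)"] sum_distrib_left
          del: nabla_form.simps)
  qed
  show M: "(mixed_diff h has_real_derivative kinetic_diff h t - potential_diff h t / (q t)\<^sup>2) (at t within {0..<T})"
  proof -
    have "(mixed_diff h has_real_derivative (\<Sum>e\<in>Basis.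
        nabla_form m (diff_op h e (U t)) (diff_op h e (?W t)) +
        nabla_form m (diff_op h e (V t)) (diff_op h e (V t)))) (at t within {0..<T})"
      unfolding mixed_diff_def[abs_def] by (intro DERIV_sum nabla_form_has_derivative dU' dV t)
    then show ?thesis
      by (simp add: form[OF Sob_SucD[OF U_Sob[OF t]]] kinetic_diff_def potential_diff_def
          sum_divide_distrib sum_subtractf del: nabla_form.simps)
  qed
  have "(energy_diff h has_real_derivative
      (q' t * kinetic_diff h t + ((- 2 / (q t)\<^sup>2) * Y) * q t)
      + (2 * Y * q t - potential_diff h t * q' t) / (q t * q t)
      - (q'' t * mixed_diff h t + (kinetic_diff h t - potential_diff h t / (q t)\<^sup>2) * q' t)
      + q'' t * nabla_form (Suc m) (U t) (V t)) (at t within {0..<T})"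
    unfolding energy_diff_def[abs_def]
    by (intro DERIV_add DERIV_diff DERIV_mult DERIV_divide q_deriv q'_deriv lower_poly_deriv K P M q_nz t)
  moreover have "(q' t * kinetic_diff h t + ((- 2 / (q t)\<^sup>2) * Y) * q t)
      + (2 * Y * q t - potential_diff h t * q' t) / (q t * q t)
      - (q'' t * mixed_diff h t + (kinetic_diff h t - potential_diff h t / (q t)\<^sup>2) * q' t)
      + q'' t * nabla_form (Suc m) (U t) (V t) = q'' t * (nabla_form (Suc m) (U t) (V t) - mixed_diff h t)"
  proof -
    have "(q1 * K + ((- 2 / r\<^sup>2) * Y) * r) + (2 * Y * r - P * q1) / (r * r) - (q2 * M + (K - P / r\<^sup>2) * q1) + q2 * B =
        q2 * (B - M)" if "r \<noteq> 0" for q1 q2 K r P M B :: real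
      using that by (simp add: field_simps power2_eq_square)
    from this[OF q_nz[OF t]] show ?thesis .
  qed
  ultimately show "(energy_diff h has_real_derivative
      q'' t * (nabla_form (Suc m) (U t) (V t) - mixed_diff h t)) (at t within {0..<T})"
    by simp
qed

lemma diff_limits:
  assumes t: "t \<in> {0..<T}"
  shows "((\<lambda>h. energy_diff h t) \<longlongrightarrow> energy t) (at 0)"
    and "((\<lambda>h. mixed_diff h t) \<longlongrightarrow> nabla_form (Suc m) (U t) (V t)) (at 0)"
proof -
  note UV = U_Sob[OF t] V_Sob[OF t]
  have K: "((\<lambda>h. kinetic_diff h t) \<longlongrightarrow> nabla_form (Suc m) (V t) (V t)) (at 0)"
    unfolding kinetic_diff_def nabla_form.simps(2)[of m]
    by (intro tendsto_sum nabla_form_diff_op_tendsto UV)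
  have P: "((\<lambda>h. potential_diff h t) \<longlongrightarrow> nabla_form (Suc (Suc m)) (U t) (U t)) (at 0)"
    unfolding potential_diff_def nabla_form.simps(2)[of "Suc m"]
    by (intro tendsto_sum nabla_form_diff_op_tendsto UV)
  have M: "((\<lambda>h. mixed_diff h t) \<longlongrightarrow> nabla_form (Suc m) (U t) (V t)) (at 0)"
    unfolding mixed_diff_def nabla_form.simps(2)[of m]
    by (intro tendsto_sum nabla_form_diff_op_tendsto UV Sob_SucD[OF UV(1)])
  show "((\<lambda>h. energy_diff h t) \<longlongrightarrow> energy t) (at 0)"
    unfolding energy_diff_def energy_def using q_nz[OF t] by (intro tendsto_intros K P M)
  show "((\<lambda>h. mixed_diff h t) \<longlongrightarrow> nabla_form (Suc m) (U t) (V t)) (at 0)" by (rule M)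
qed

text \<open>The bound does not depend on h and is continuous in time, hence a majorant for the
  passage to the limit in \<open>energy_constant\<close>.\<close>

lemma mixed_diff_bound:
  assumes t: "t \<in> {0..<T}"
  shows "\<bar>mixed_diff h t\<bar> \<le> (nabla_form (Suc m) (U t) (U t) + nabla_form (Suc m) (V t) (V t)) / 2"
proof -
  note UV = Sob_SucD[OF U_Sob[OF t]] V_Sob[OF t]
  have "\<bar>nabla_form m (diff_op h e (U t)) (diff_op h e (V t))\<bar>
      \<le> (nabla_form m (pd e (U t)) (pd e (U t)) + nabla_form m (pd e (V t)) (pd e (V t))) / 2"
    if e: "e \<in> Basis" for e
    using nabla_form_bound[OF Sob_diff_op[OF Sob_SucD[OF UV(1)]] Sob_diff_op[OF Sob_SucD[OF UV(2)]], of h e h e]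
      divide_right_mono[OF add_mono[OF nabla_form_diff_op_le[OF UV(1) e, of h] nabla_form_diff_op_le[OF UV(2) e, of h]], of 2]
    by (auto intro: order_trans)
  then have "\<bar>mixed_diff h t\<bar> \<le> (\<Sum>e\<in>Basis. (nabla_form m (pd e (U t)) (pd e (U t)) + nabla_form m (pd e (V t)) (pd e (V t))) / 2)"
    unfolding mixed_diff_def by (intro order_trans[OF sum_abs] sum_mono)
  then show ?thesis by (simp add: sum.distrib flip: sum_divide_distrib)
qed

lemma continuous_coefficients:
  "continuous_on {0..<T} q''" "j \<le> Suc m \<Longrightarrow> continuous_on {0..<T} (\<lambda>t. nabla_form j (U t) (U t))"
  "j \<le> Suc m \<Longrightarrow> continuous_on {0..<T} (\<lambda>t. nabla_form j (U t) (V t))"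
  "j \<le> Suc m \<Longrightarrow> continuous_on {0..<T} (\<lambda>t. nabla_form j (V t) (V t))"
proof -
  show UU: "continuous_on {0..<T} (\<lambda>t. nabla_form j (U t) (U t))"
    and "continuous_on {0..<T} (\<lambda>t. nabla_form j (U t) (V t))"
    and VV: "continuous_on {0..<T} (\<lambda>t. nabla_form j (V t) (V t))" if "j \<le> Suc m" for j
    using that Sob_continuous_on_mono[OF U, of j] Sob_continuous_on_mono[OF V, of j]
    by (auto intro: nabla_form_continuous_on)
  have q: "continuous_on {0..<T} q"
    using UU[of 1] by (auto intro!: continuous_intros simp del: nabla_form.simps)
  show "continuous_on {0..<T} q''"
    unfolding q''_def[abs_def] using m q_nz
    by (intro continuous_intros UU VV q) auto
qed

lemma energy_constant:
  assumes t: "t \<in> {0..<T}"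
  shows "energy t = energy 0"
proof -
  \<comment> \<open>Dominated convergence is applied along the sequence h = 1 / (n + 1), which stays
    away from h = 0, where \<open>diff_op\<close> is the zero map.\<close>
  let ?h = "\<lambda>n. inverse (real (Suc n))"
  let ?B = "\<lambda>s. nabla_form (Suc m) (U s) (V s)"
  let ?f = "\<lambda>n s. q'' s * (?B s - mixed_diff (?h n) s)"
  let ?w = "\<lambda>s. \<bar>q'' s\<bar> * (\<bar>?B s\<bar> + (nabla_form (Suc m) (U s) (U s) + nabla_form (Suc m) (V s) (V s)) / 2)"
  have sub: "{0..t} \<subseteq> {0..<T}" using t by auto
  have h: "filterlim ?h (at 0) sequentially"
    using LIMSEQ_inverse_real_of_nat by (simp add: filterlim_at)
  have FTC: "(?f n has_integral energy_diff (?h n) t - energy_diff (?h n) 0) {0..t}" for n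
  proof (rule fundamental_theorem_of_calculus)
    fix s assume "s \<in> {0..t}"
    then have "s \<in> {0..<T}" using sub by blast
    from DERIV_subset[OF energy_diff_deriv(1)[OF this] sub]
    show "(energy_diff (?h n) has_vector_derivative ?f n s) (at s within {0..t})"
      by (simp add: has_real_derivative_iff_has_vector_derivative)
  qed (use t in simp)
  have "(\<lambda>n. integral {0..t} (?f n)) \<longlonglongrightarrow> integral {0..t} (\<lambda>s. 0)"
  proof (rule dominated_convergence(2))
    show "?f n integrable_on {0..t}" for n using FTC by blast
    have "continuous_on {0..<T} ?w"
      by (intro continuous_intros continuous_coefficients) auto
    then show "?w integrable_on {0..t}"
      using sub by (intro integrable_continuous_interval) (rule continuous_on_subset)
    fix s assume "s \<in> {0..t}"
    then have s: "s \<in> {0..<T}" using sub by blast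
    show "norm (?f n s) \<le> ?w s" for n
    proof -
      have "\<bar>?B s - mixed_diff (?h n) s\<bar> \<le> \<bar>?B s\<bar> + (nabla_form (Suc m) (U s) (U s) + nabla_form (Suc m) (V s) (V s)) / 2"
        using mixed_diff_bound[OF s, of "?h n"] by linarith
      then show ?thesis by (simp add: abs_mult mult_left_mono del: nabla_form.simps)
    qed
    have "(\<lambda>n. ?f n s) \<longlonglongrightarrow> q'' s * (?B s - ?B s)"
      by (intro tendsto_intros filterlim_compose[OF diff_limits(2)[OF s] h])
    then show "(\<lambda>n. ?f n s) \<longlonglongrightarrow> 0" by simp
  qed
  then have "(\<lambda>n. energy_diff (?h n) t - energy_diff (?h n) 0) \<longlonglongrightarrow> 0"
    by (simp only: integral_unique[OF FTC] integral_0)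
  moreover have "(\<lambda>n. energy_diff (?h n) t - energy_diff (?h n) 0) \<longlonglongrightarrow> energy t - energy 0"
    using t T by (intro tendsto_intros filterlim_compose[OF diff_limits(1) h]) auto
  ultimately have "energy t - energy 0 = 0" by (rule LIMSEQ_unique[symmetric])
  then show ?thesis by simp
qed

end

theorem theorem1p3:
  fixes a b :: real and k :: nat
  assumes "a \<noteq> 0" and "k \<ge> 3"
  shows "\<exists>J :: real \<Rightarrow> (real \<Rightarrow> real ^ 'n \<Rightarrow> real) \<Rightarrow> real \<Rightarrow> real.
    functional_of_order_le a b (k - 1) J \<and>
    (\<forall>(T :: real) (u :: real \<Rightarrow> real ^ 'n \<Rightarrow> real).
       0 < T \<longrightarrow>
       (\<forall>j\<in>{0, 1}. u \<in> sobolev_C j T (k - j)) \<longrightarrow>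
       (\<forall>t\<in>{0..<T}. q_fun a b u t \<noteq> 0) \<longrightarrow>
       is_solution a b T u \<longrightarrow>
       (\<lambda>t. q_fun a b u t * (nabla_norm (k - 1) (time_deriv T u t))\<^sup>2
            + (nabla_norm k (u t))\<^sup>2 / q_fun a b u t
            - scalar_deriv T 1 (q_fun a b u) t * nabla_inner (k - 1) (u t) (time_deriv T u t)
            + J T u t) constant_on {0..<T})"
proof -
  \<comment> \<open>With this shift u lies in H^(m+2), u_t in H^(m+1), and J has order at most m +
    1.\<close>
  define m where "m = k - 2"
  have k: "k = Suc (Suc m)" and k1: "k - 1 = Suc m" and m: "1 \<le> m" using assms(2) by (simp_all add: m_def)
  define J :: "real \<Rightarrow> (real \<Rightarrow> real ^ 'n \<Rightarrow> real) \<Rightarrow> real \<Rightarrow> real" where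
    "J T u t = lower_poly a m (arg_value a b T u t)" for T u t
  have P: "lower_poly a m \<in> polynomials (moment_args (Suc m))" by (rule lower_poly_polynomials[OF m])
  show ?thesis
    unfolding k1
  proof (intro exI[of _ J] conjI allI impI)
    show "functional_of_order_le a b (Suc m) J"
      using polynomials_mono[OF P moment_args_subset] m by (auto simp: functional_of_order_le_def J_def)
    fix T :: real and u :: "real \<Rightarrow> real ^ 'n \<Rightarrow> real"
    assume T: "0 < T" and reg: "\<forall>j\<in>{0, 1}. u \<in> sobolev_C j T (k - j)"
      and q_nz: "\<forall>t\<in>{0..<T}. q_fun a b u t \<noteq> 0" and sol: "is_solution a b T u"
    define U where "U = (\<lambda>t. abs_lsq (u t))"
    define V where "V = (\<lambda>t. abs_lsq (time_deriv T u t))"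
    have u0: "u \<in> sobolev_C 0 T (Suc (Suc m))" and u1: "u \<in> sobolev_C (Suc 0) T (Suc m)"
      using reg unfolding k by auto
    have us: "u t \<in> sobolev (Suc (Suc m))" and vs: "time_deriv T u t \<in> sobolev (Suc m)"
      if "t \<in> {0..<T}" for t
      using u0 that sobolev_C_1_deriv(3)[OF u1 that] by auto
    have us': "u t \<in> sobolev j" if "t \<in> {0..<T}" "j \<le> Suc (Suc m)" for t j
      using us[OF that(1)] Sob_mono[OF _ that(2)] by (auto simp: sobolev_iff)
    have vs': "time_deriv T u t \<in> sobolev j" if "t \<in> {0..<T}" "j \<le> Suc m" for t j
      using vs[OF that(1)] Sob_mono[OF _ that(2)] by (auto simp: sobolev_iff)
    have abs_eq: "abs_lsq (u t) = U t" "abs_lsq (time_deriv T u t) = V t" for t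
      by (simp_all add: U_def V_def)
    have U: "Sob_continuous_on {0..<T} (Suc (Suc m)) U"
      unfolding U_def by (rule sobolev_C_0_Sob[OF u0])
    have V: "Sob_continuous_on {0..<T} (Suc m) V" and UV: "Sob_deriv_on {0..<T} (Suc m) U V"
      unfolding U_def V_def by (rule sobolev_C_1_deriv[OF u1])+
    have q: "q_fun a b u t = a * nabla_form (Suc 0) (U t) (U t) + b" if "t \<in> {0..<T}" for t
      using nabla_norm_square[OF us'[OF that, of 1]] by (simp add: q_fun_def U_def del: nabla_form.simps)
    have cont: "continuous_on {0..<T} (q_fun a b u)"
    proof -
      have "continuous_on {0..<T} (\<lambda>t. a * nabla_form (Suc 0) (U t) (U t) + b)"
        using Sob_continuous_on_mono[OF U, of 1]
        by (intro continuous_intros nabla_form_continuous_on) auto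
      then show ?thesis by (rule continuous_on_eq) (simp add: q)
    qed
    have "Sob_deriv_on {0..<T} 0 V (\<lambda>t. lap (U t) /\<^sub>R (q_fun a b u t)\<^sup>2)"
      unfolding U_def
    proof (rule solution_second_derivative[OF T sol _ _ _ _ cont])
      show "u t \<in> L2" if "t \<in> {0..<T}" for t using us[OF that] by (rule sobolev_L2)
      show "Sob_continuous_on {0..<T} 2 (\<lambda>t. abs_lsq (u t))"
        using Sob_continuous_on_mono[OF U, of 2] by (simp add: U_def)
      show "Sob_deriv_on {0..<T} 0 (\<lambda>t. abs_lsq (u t)) V"
        using Sob_deriv_on_mono[OF UV, of 0] by (simp only: U_def)
      show "continuous_on {0..<T} V" by (rule Sob_continuous_on_imp(1)[OF V])
    qed (use q_nz in blast)
    then have VW: "Sob_deriv_on {0..<T} 0 V (\<lambda>t. lap (U t) /\<^sub>R (a * nabla_form (Suc 0) (U t) (U t) + b)\<^sup>2)"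
      by (rule Sob_deriv_on_cong[rotated 2]) (simp_all add: q)
    interpret evolution T a b m U V
      by unfold_locales (use T m U V UV VW q_nz q in auto)
    have "q_fun a b u t * (nabla_norm (Suc m) (time_deriv T u t))\<^sup>2
            + (nabla_norm k (u t))\<^sup>2 / q_fun a b u t
            - scalar_deriv T 1 (q_fun a b u) t * nabla_inner (Suc m) (u t) (time_deriv T u t)
            + J T u t = energy 0" if t: "t \<in> {0..<T}" for t
    proof -
      have "(q_fun a b u has_vector_derivative q' t) (at t within {0..<T})"
        using q_deriv[OF t] unfolding has_real_derivative_iff_has_vector_derivative
        by (rule has_vector_derivative_transform[OF t, rotated]) (rule q)
      \<comment> \<open>The derivative within [0,T) is unique because every t, including t = 0, is a
        limit point of that interval.\<close>
      then have q'_eq: "scalar_deriv T 1 (q_fun a b u) t = q' t"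
        using at_within_atLeastLessThan_nontrivial[OF t]
        by (simp add: scalar_deriv_def vector_derivative_within)
      have J_eq: "J T u t = lower_poly a m (X t)"
        unfolding J_def
      \<comment> \<open>The two assignments are compared on \<open>moment_args (Suc m)\<close>,
        where both return q or moments of u; at \<open>Q_deriv\<close> the assignment
        \<open>X\<close> holds the placeholder 0.\<close>
      proof (rule polynomials_cong[OF P])
        fix v assume "v \<in> moment_args (Suc m)"
        then show "arg_value a b T u t v = X t v"
          using q[OF t] nabla_norm_square[OF us'[OF t]] nabla_norm_square[OF vs'[OF t]]
            nabla_inner_eq[OF us'[OF t] vs'[OF t]]
          by (auto simp: moment_args_def abs_eq simp del: nabla_form.simps)
      qed
      show ?thesis
        using energy_constant[OF t] nabla_norm_square[OF vs[OF t]] nabla_norm_square[OF us[OF t]]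
          nabla_inner_eq[OF us'[OF t] vs[OF t]]
        unfolding energy_def q'_eq J_eq k
        by (simp add: q[OF t] abs_eq del: nabla_form.simps)
    qed
    then show "(\<lambda>t. q_fun a b u t * (nabla_norm (Suc m) (time_deriv T u t))\<^sup>2
            + (nabla_norm k (u t))\<^sup>2 / q_fun a b u t
            - scalar_deriv T 1 (q_fun a b u) t * nabla_inner (Suc m) (u t) (time_deriv T u t)
            + J T u t) constant_on {0..<T}"
      unfolding constant_on_def by blast
  qed
qed

end
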